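(* Let $\phi:\mathcal{A}_0\to\mathcal{A}_0\otimes\mathcal{B}(\widehat{\mathsf{k}})$ be a flow generator with $\mathcal{A}_\phi=\mathcal{A}_0$, and suppose that either (a) $\mathcal{A}_0$ contains its square roots, or (b) $\mathcal{A}$ is the universal $C^*$-algebra generated by isometries $\{s_i:i\in I\}$ satisfying relations $\{p_k:k\in K\}$ and $\mathcal{A}_0$ is the $*$-algebra generated by $\{s_i:i\in I\}$. Let $(\bar\jmath_t)_{t\ge0}$ be the family of unital $*$-homomorphisms $\bar\jmath_t:\mathcal{A}\to\mathcal{B}(\mathsf{h}\bar\otimes\mathcal{F})$ such that $\bar\jmath_t(x)=j_t(x)$ on $\mathsf{h}\otimes\mathcal{E}$ for all $x\in\mathcal{A}_0$. Then $(\bar\jmath_t)_{t\ge0}$ is a Feller cocycle for the shift semigroup on $\mathcal{B}(\mathcal{F})$: for all $s,t\ge0$, $f,g\in L^2(\mathbb{R}_+;\mathsf{k})$ and $a\in\mathcal{A}$, (i) $\bar\jmath_0[0,0](a)=a$, (ii) $\bar\jmath_t[f,g](a)\in\mathcal{A}$, (iii) $t\mapsto\bar\jmath_t[f,g](a)$ is norm continuous, and (iv) $\bar\jmath_{s+t}[f,g]=\bar\jmath_s[f,g]\circ\bar\jmath_t[f(\cdot+s),g(\cdot+s)]$. Consequently, setting $$T_t(a):=\bar\jmath_t[0,0](a)=(1_{\mathsf{h}}\otimes\langle\varepsilon(0)|)\,\bar\jmath_t(a)\,(1_{\mathsf{h}}\otimes|\varepsilon(0)\rangle)\qquad\text{for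 all }a\in\mathcal{A}$$ gives a strongly continuous semigroup $T=(T_t)_{t\ge0}$ of completely positive contractions on $\mathcal{A}$ such that $T_t(x)=\exp(t\phi^\omega_\omega)(x):=\sum_{n\ge0}\frac{t^n}{n!}(\phi^\omega_\omega)^n(x)$ for all $x\in\mathcal{A}_0$ and $t\ge0$. In particular, $T_t(1)=1$ for all $t\ge0$ and $\mathcal{A}_0$ is a core for the generator of $T$.
   Context: Conventions: inner products are linear in the second variable; $\otimes$ is the algebraic tensor product and $\bar\otimes$ the Hilbert-space tensor product; $|\xi\rangle:\mathbb{C}\to\mathsf{H}$, $\lambda\mapsto\lambda\xi$ and $\langle\xi|:\mathsf{H}\to\mathbb{C}$, $\eta\mapsto\langle\xi,\eta\rangle$ for a vector $\xi$ in a Hilbert space $\mathsf{H}$. Setting: $\mathcal{A}\subseteq\mathcal{B}(\mathsf{h})$ is a unital $C^*$-algebra of operators on a Hilbert space $\mathsf{h}$, with identity $1=1_{\mathsf{h}}$; $\mathcal{A}_0\subseteq\mathcal{A}$ is a norm-dense $*$-subalgebra containing $1$; $\mathsf{k}$ is a Hilbert space, $\widehat{\mathsf{k}}:=\mathbb{C}\oplus\mathsf{k}$, $\omega:=(1,0)\in\widehat{\mathsf{k}}$, $P_{\mathsf{k}}\in\mathcal{B}(\widehat{\mathsf{k}})$ is the orthogonal projection onto $\mathsf{k}$ and $\Delta:=1_{\mathsf{h}}\otimes P_{\mathsf{k}}$. Elements of $\mathcal{A}_0\otimes\mathcal{B}(\widehat{\mathsf{k}})^{\otimes n}$ are regarded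 as bounded operators on $\mathsf{h}\bar\otimes\widehat{\mathsf{k}}^{\bar\otimes n}$, with the operator norm. A flow generator is a $*$-linear map $\phi:\mathcal{A}_0\to\mathcal{A}_0\otimes\mathcal{B}(\widehat{\mathsf{k}})$ such that $\phi(1)=0$ and $\phi(xy)=\phi(x)(y\otimes 1_{\widehat{\mathsf{k}}})+(x\otimes 1_{\widehat{\mathsf{k}}})\phi(y)+\phi(x)\Delta\phi(y)$ for all $x,y\in\mathcal{A}_0$. For $\xi,\chi\in\widehat{\mathsf{k}}$, $\phi^\xi_\chi:\mathcal{A}_0\to\mathcal{A}_0$, $x\mapsto(1_{\mathsf{h}}\otimes\langle\xi|)\phi(x)(1_{\mathsf{h}}\otimes|\chi\rangle)$. The quantum random walk of $\phi$ is given by $\phi_0:=\iota_{\mathcal{A}_0}$ (the identity map) and $\phi_{n+1}:=(\phi_n\otimes\iota_{\mathcal{B}(\widehat{\mathsf{k}})})\circ\phi$. Set $\mathcal{A}_\phi:=\{x\in\mathcal{A}_0:\ \exists\, C_x,M_x>0 \text{ with } \|\phi_n(x)\|\le C_xM_x^n \text{ for all } n\ge 0\}$. $\mathcal{A}_0$ contains its square roots if $x^{1/2}\in\mathcal{A}_0$ for every non-negative $x\in\mathcal{A}_0$. In (b): $\mathcal{A}$ is the smallest unital $C^*$-algebra containing $\{s_i\}$; each $p_k$ is a complex polynomial in non-commuting indeterminates $X_i,X_i^*$ ($i\in I$), the polynomials $X_i^*X_i-1$ are among the $p_k$, $p_k(s_i,s_i^*:i\in I)=0$ for all $k$, and for every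 unital $C^*$-algebra $\mathcal{B}'$ with elements $b_i$ satisfying $p_k(b_i,b_i^*:i\in I)=0$ for all $k$ there is a unique $*$-homomorphism $\mathcal{A}\to\mathcal{B}'$ with $s_i\mapsto b_i$ for all $i$. Fock space: $\mathcal{F}$ is Boson Fock space over $L^2(\mathbb{R}_+;\mathsf{k})$, with exponential vectors $\varepsilon(f)$, $\langle\varepsilon(f),\varepsilon(g)\rangle=e^{\langle f,g\rangle}$; $\mathcal{E}$ is the linear span of all $\varepsilon(f)$; $u\varepsilon(f):=u\otimes\varepsilon(f)$; $\widehat{f}(t):=(1,f(t))\in\widehat{\mathsf{k}}$; $f_{t)}:=1_{[0,t)}f$. For $n\ge1$ and $T\in\mathcal{B}(\mathsf{h}\bar\otimes\widehat{\mathsf{k}}^{\bar\otimes n})$, $\Lambda^n_t(T)$ (the $n$-fold quantum Wiener integral) is the operator with domain $\mathsf{h}\otimes\mathcal{E}$ determined by $$\langle u\varepsilon(f),\Lambda^n_t(T)v\varepsilon(g)\rangle=\int_{D_n(t)}\langle u\otimes\widehat{f}(t_1)\otimes\cdots\otimes\widehat{f}(t_n),T(v\otimes\widehat{g}(t_1)\otimes\cdots\otimes\widehat{g}(t_n))\rangle\,d\mathbf{t}\ \langle\varepsilon(f),\varepsilon(g)\rangle,$$ where $D_n(t)=\{\mathbf{t}\in[0,t]^n:t_1<\cdots<t_n\}$; and $\Lambda^0_t(T):=T\otimes 1_{\mathcal{F}}$. For $x\in\mathcal{A}_\phi$, $j_t(x):=\sum_{n\ge0}\Lambda^n_t(\phi_n(x))$,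 which converges strongly absolutely on $\mathsf{h}\otimes\mathcal{E}$. Under hypothesis (a) or (b), with $\mathcal{A}_\phi=\mathcal{A}_0$, the unital $*$-homomorphisms $\bar\jmath_t$ of the claim exist. For $t\ge0$, $f,g\in L^2(\mathbb{R}_+;\mathsf{k})$ and $a\in\mathcal{A}$: $\bar\jmath_t[f,g](a):=(1_{\mathsf{h}}\otimes\langle\varepsilon(f_{t)})|)\,\bar\jmath_t(a)\,(1_{\mathsf{h}}\otimes|\varepsilon(g_{t)})\rangle)$. *)

theory Defs
  imports "HOL-Analysis.Analysis" "HOL-Algebra.Ring" "HOL-Library.Poly_Mapping"
begin

section \<open>Complex Hilbert spaces\<close>

class complex_vector = real_vector +
  fixes scaleC :: "complex \<Rightarrow> 'a \<Rightarrow> 'a"  (infixr \<open>*\<^sub>C\<close> 75)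
  assumes scaleR_scaleC: "r *\<^sub>R x = complex_of_real r *\<^sub>C x"
    and scaleC_add_right: "c *\<^sub>C (x + y) = c *\<^sub>C x + c *\<^sub>C y"
    and scaleC_add_left: "(c + d) *\<^sub>C x = c *\<^sub>C x + d *\<^sub>C x"
    and scaleC_scaleC: "c *\<^sub>C d *\<^sub>C x = (c * d) *\<^sub>C x"
    and scaleC_one: "1 *\<^sub>C x = x"

global_interpretation cvec: vector_space "scaleC :: complex \<Rightarrow> 'a \<Rightarrow> 'a :: complex_vector"
  by unfold_locales (simp_all add: scaleC_add_right scaleC_add_left scaleC_scaleC scaleC_one)

text \<open>Inner products are linear in the second variable.\<close>

class complex_hilbert = complex_vector + banach +
  fixes cinner :: "'a \<Rightarrow> 'a \<Rightarrow> complex"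
  assumes cinner_commute: "cinner x y = cnj (cinner y x)"
    and cinner_add_right: "cinner x (y + z) = cinner x y + cinner x z"
    and cinner_scaleC_right: "cinner x (c *\<^sub>C y) = c * cinner x y"
    and norm_eq_sqrt_cinner: "norm x = sqrt (Re (cinner x x))"

lemma cinner_self: "cinner x x = of_real ((norm x)\<^sup>2)" for x :: "'a::complex_hilbert"
proof -
  have "0 \<le> sqrt (Re (cinner x x))"
    using norm_eq_sqrt_cinner[of x] norm_ge_zero[of x] by linarith
  hence "(norm x)\<^sup>2 = Re (cinner x x)"
    by (simp add: norm_eq_sqrt_cinner)
  moreover have "Im (cinner x x) = 0"
    using arg_cong[OF cinner_commute[of x x], of Im] by simp
  ultimately show ?thesis by (simp add: complex_eq_iff)
qed

lemma cinner_scaleC_left: "cinner (c *\<^sub>C x) y = cnj c * cinner x y"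
  for x y :: "'a::complex_hilbert"
  using cinner_commute[of "c *\<^sub>C x" y] cinner_commute[of x y]
  by (simp add: cinner_scaleC_right)

lemma norm_scaleC: "norm (c *\<^sub>C x) = cmod c * norm x" for x :: "'a::complex_hilbert"
proof -
  have "complex_of_real ((norm (c *\<^sub>C x))\<^sup>2) = c * cnj c * cinner x x"
    unfolding cinner_self[symmetric] by (simp add: cinner_scaleC_left cinner_scaleC_right)
  also have "\<dots> = of_real ((cmod c * norm x)\<^sup>2)"
    by (simp only: cinner_self complex_norm_square[symmetric] power_mult_distrib of_real_mult)
  finally have "(norm (c *\<^sub>C x))\<^sup>2 = (cmod c * norm x)\<^sup>2"
    using of_real_eq_iff by blast
  thus ?thesis by (simp add: power2_eq_iff_nonneg)
qed

instantiation complex :: complex_hilbert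
begin
definition scaleC_complex :: "complex \<Rightarrow> complex \<Rightarrow> complex" where "scaleC_complex c z = c * z"
definition cinner_complex :: "complex \<Rightarrow> complex \<Rightarrow> complex" where "cinner_complex w z = cnj w * z"
instance
  by standard
    (auto simp: scaleC_complex_def cinner_complex_def scaleR_conv_of_real algebra_simps cmod_def
        power2_eq_square)
end

instantiation prod :: (complex_vector, complex_vector) complex_vector
begin
definition scaleC_prod :: "complex \<Rightarrow> 'a \<times> 'b \<Rightarrow> 'a \<times> 'b"
  where "scaleC_prod c x = (c *\<^sub>C fst x, c *\<^sub>C snd x)"
instance
  by standard
    (auto simp: scaleC_prod_def prod_eq_iff scaleR_scaleC scaleC_add_right scaleC_add_left
        scaleC_scaleC scaleC_one)
end

instantiation prod :: (complex_hilbert, complex_hilbert) complex_hilbert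
begin
definition cinner_prod :: "'a \<times> 'b \<Rightarrow> 'a \<times> 'b \<Rightarrow> complex"
  where "cinner_prod x y = cinner (fst x) (fst y) + cinner (snd x) (snd y)"
instance
proof
  fix x y z :: "'a \<times> 'b" and c :: complex
  show "cinner x y = cnj (cinner y x)"
    using cinner_commute[of "fst x" "fst y"] cinner_commute[of "snd x" "snd y"]
    by (simp add: cinner_prod_def)
  show "cinner x (y + z) = cinner x y + cinner x z"
    by (simp add: cinner_prod_def cinner_add_right)
  show "cinner x (c *\<^sub>C y) = c * cinner x y"
    by (simp add: cinner_prod_def scaleC_prod_def cinner_scaleC_right algebra_simps)
  show "norm x = sqrt (Re (cinner x x))"
    by (simp add: cinner_prod_def cinner_self norm_prod_def)
qed
end

section \<open>Bounded operators\<close>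

instantiation blinfun :: (real_normed_vector, complex_hilbert) complex_vector
begin
lift_definition scaleC_blinfun :: "complex \<Rightarrow> ('a \<Rightarrow>\<^sub>L 'b) \<Rightarrow> ('a \<Rightarrow>\<^sub>L 'b)"
  is "\<lambda>c T x. c *\<^sub>C T x"
proof -
  fix c :: complex and T :: "'a \<Rightarrow> 'b"
  assume T: "bounded_linear T"
  then interpret bounded_linear T .
  obtain K where "\<And>x. norm (T x) \<le> norm x * K"
    using bounded by blast
  hence "\<And>x. norm (c *\<^sub>C T x) \<le> norm x * (cmod c * K)"
    unfolding norm_scaleC by (subst mult.left_commute, intro mult_left_mono) simp_all
  thus "bounded_linear (\<lambda>x. c *\<^sub>C T x)"
    by (intro bounded_linear_intro[where K = "cmod c * K"])
       (simp_all add: add scaleR scaleC_add_right scaleR_scaleC scaleC_scaleC mult.commute)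
qed
instance
  by standard (transfer; auto simp: scaleR_scaleC scaleC_add_right scaleC_add_left
      scaleC_scaleC scaleC_one)+
end

text \<open>Elements of \<^typ>\<open>'a \<Rightarrow>\<^sub>L 'b\<close> are only real-linear; \<open>bop\<close> is the set of bounded
  \<^emph>\<open>complex\<close>-linear operators.\<close>

definition bop :: "('a::complex_hilbert \<Rightarrow>\<^sub>L 'b::complex_hilbert) set"
  where "bop = {T. \<forall>c x. blinfun_apply T (c *\<^sub>C x) = c *\<^sub>C blinfun_apply T x}"

definition adj :: "('a::complex_hilbert \<Rightarrow>\<^sub>L 'b::complex_hilbert) \<Rightarrow> ('b \<Rightarrow>\<^sub>L 'a)"
  where "adj T = (THE S. \<forall>x y. cinner (blinfun_apply S y) x = cinner y (blinfun_apply T x))"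

definition clinear_on :: "'a::complex_vector set \<Rightarrow> ('a \<Rightarrow> 'b::complex_vector) \<Rightarrow> bool"
  where "clinear_on S F \<longleftrightarrow>
    (\<forall>x\<in>S. \<forall>y\<in>S. F (x + y) = F x + F y) \<and> (\<forall>c. \<forall>x\<in>S. F (c *\<^sub>C x) = c *\<^sub>C F x)"

definition positive_op :: "('a::complex_hilbert \<Rightarrow>\<^sub>L 'a) \<Rightarrow> bool"
  where "positive_op T \<longleftrightarrow> T \<in> bop \<and> (\<forall>u. cinner u (blinfun_apply T u) \<in> \<real>\<^sub>\<ge>\<^sub>0)"

definition op_sqrt :: "('a::complex_hilbert \<Rightarrow>\<^sub>L 'a) \<Rightarrow> ('a \<Rightarrow>\<^sub>L 'a)"
  where "op_sqrt T = (THE S. positive_op S \<and> S o\<^sub>L S = T)"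

section \<open>Operator algebras and abstract unital C*-algebras\<close>

definition star_subalgebra :: "('h::complex_hilbert \<Rightarrow>\<^sub>L 'h) set \<Rightarrow> bool"
  where "star_subalgebra S \<longleftrightarrow> S \<subseteq> bop \<and> cvec.subspace S \<and>
    (\<forall>x\<in>S. \<forall>y\<in>S. x o\<^sub>L y \<in> S) \<and> (\<forall>x\<in>S. adj x \<in> S)"

definition unital_cstar_of_operators :: "('h::complex_hilbert \<Rightarrow>\<^sub>L 'h) set \<Rightarrow> bool"
  where "unital_cstar_of_operators S \<longleftrightarrow> star_subalgebra S \<and> id_blinfun \<in> S \<and> closed S"

record 'c cstar = "'c ring" +
  scale :: "complex \<Rightarrow> 'c \<Rightarrow> 'c"
  star :: "'c \<Rightarrow> 'c"
  nrm :: "'c \<Rightarrow> real"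

locale unital_cstar_algebra = ring B for B :: "('c, 'm) cstar_scheme" (structure) +
  assumes scale_closed: "x \<in> carrier B \<Longrightarrow> scale B c x \<in> carrier B"
    and scale_add_right: "\<lbrakk>x \<in> carrier B; y \<in> carrier B\<rbrakk> \<Longrightarrow>
        scale B c (x \<oplus> y) = scale B c x \<oplus> scale B c y"
    and scale_add_left: "x \<in> carrier B \<Longrightarrow> scale B (c + d) x = scale B c x \<oplus> scale B d x"
    and scale_scale: "x \<in> carrier B \<Longrightarrow> scale B c (scale B d x) = scale B (c * d) x"
    and scale_one: "x \<in> carrier B \<Longrightarrow> scale B 1 x = x"
    and scale_mult_left: "\<lbrakk>x \<in> carrier B; y \<in> carrier B\<rbrakk> \<Longrightarrow>
        scale B c x \<otimes> y = scale B c (x \<otimes> y)"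
    and scale_mult_right: "\<lbrakk>x \<in> carrier B; y \<in> carrier B\<rbrakk> \<Longrightarrow>
        x \<otimes> scale B c y = scale B c (x \<otimes> y)"
    and nrm_nonneg: "x \<in> carrier B \<Longrightarrow> 0 \<le> nrm B x"
    and nrm_eq_0: "x \<in> carrier B \<Longrightarrow> nrm B x = 0 \<longleftrightarrow> x = \<zero>"
    and nrm_triangle: "\<lbrakk>x \<in> carrier B; y \<in> carrier B\<rbrakk> \<Longrightarrow> nrm B (x \<oplus> y) \<le> nrm B x + nrm B y"
    and nrm_scale: "x \<in> carrier B \<Longrightarrow> nrm B (scale B c x) = cmod c * nrm B x"
    and nrm_mult: "\<lbrakk>x \<in> carrier B; y \<in> carrier B\<rbrakk> \<Longrightarrow> nrm B (x \<otimes> y) \<le> nrm B x * nrm B y"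
    and nrm_complete: "Metric_space.mcomplete (carrier B) (\<lambda>x y. nrm B (x \<ominus> y))"
    and star_closed: "x \<in> carrier B \<Longrightarrow> star B x \<in> carrier B"
    and star_star: "x \<in> carrier B \<Longrightarrow> star B (star B x) = x"
    and star_add: "\<lbrakk>x \<in> carrier B; y \<in> carrier B\<rbrakk> \<Longrightarrow> star B (x \<oplus> y) = star B x \<oplus> star B y"
    and star_scale: "x \<in> carrier B \<Longrightarrow> star B (scale B c x) = scale B (cnj c) (star B x)"
    and star_mult: "\<lbrakk>x \<in> carrier B; y \<in> carrier B\<rbrakk> \<Longrightarrow> star B (x \<otimes> y) = star B y \<otimes> star B x"
    and cstar_identity: "x \<in> carrier B \<Longrightarrow> nrm B (star B x \<otimes> x) = (nrm B x)\<^sup>2"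

definition op_cstar :: "('h::complex_hilbert \<Rightarrow>\<^sub>L 'h) set \<Rightarrow> ('h \<Rightarrow>\<^sub>L 'h) cstar"
  where "op_cstar S = \<lparr>carrier = S, mult = (o\<^sub>L), one = id_blinfun, zero = 0, add = (+),
    scale = scaleC, star = adj, nrm = norm\<rparr>"

definition star_hom :: "('a, 'm) cstar_scheme \<Rightarrow> ('b, 'n) cstar_scheme \<Rightarrow> ('a \<Rightarrow> 'b) \<Rightarrow> bool"
  where "star_hom R S \<pi> \<longleftrightarrow>
    (\<forall>x\<in>carrier R. \<pi> x \<in> carrier S) \<and>
    (\<forall>x\<in>carrier R. \<forall>y\<in>carrier R. \<pi> (x \<oplus>\<^bsub>R\<^esub> y) = \<pi> x \<oplus>\<^bsub>S\<^esub> \<pi> y) \<and>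
    (\<forall>x\<in>carrier R. \<forall>y\<in>carrier R. \<pi> (x \<otimes>\<^bsub>R\<^esub> y) = \<pi> x \<otimes>\<^bsub>S\<^esub> \<pi> y) \<and>
    (\<forall>c. \<forall>x\<in>carrier R. \<pi> (scale R c x) = scale S c (\<pi> x)) \<and>
    (\<forall>x\<in>carrier R. \<pi> (star R x) = star S (\<pi> x))"

definition unital_star_hom :: "('a, 'm) cstar_scheme \<Rightarrow> ('b, 'n) cstar_scheme \<Rightarrow> ('a \<Rightarrow> 'b) \<Rightarrow> bool"
  where "unital_star_hom R S \<pi> \<longleftrightarrow> star_hom R S \<pi> \<and> \<pi> \<one>\<^bsub>R\<^esub> = \<one>\<^bsub>S\<^esub>"

section \<open>Universal C*-algebras generated by isometries\<close>

datatype 'i letter = X 'i | Xstar 'i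

type_synonym 'i ncpoly = "'i letter list \<Rightarrow>\<^sub>0 complex"

definition word_eval :: "('c, 'm) cstar_scheme \<Rightarrow> ('i \<Rightarrow> 'c) \<Rightarrow> 'i letter list \<Rightarrow> 'c"
  where "word_eval B b w =
    foldr (\<lambda>l y. (case l of X i \<Rightarrow> b i | Xstar i \<Rightarrow> star B (b i)) \<otimes>\<^bsub>B\<^esub> y) w \<one>\<^bsub>B\<^esub>"

definition poly_eval :: "('c, 'm) cstar_scheme \<Rightarrow> ('i \<Rightarrow> 'c) \<Rightarrow> 'i ncpoly \<Rightarrow> 'c"
  where "poly_eval B b p =
    finsum B (\<lambda>w. scale B (Poly_Mapping.lookup p w) (word_eval B b w)) (Poly_Mapping.keys p)"

text \<open>The universal property quantifies over all unital C*-algebras with carrier contained in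
  the type \<^typ>\<open>nat \<Rightarrow> 'i ncpoly\<close>. There is no loss of generality: in a unital C*-algebra generated
  by \<open>1\<close> and a family \<open>(b\<^sub>i)\<close> every element is the limit of a sequence of non-commutative polynomials
  in the \<open>b\<^sub>i, b\<^sub>i\<^sup>*\<close>, so the algebra is isomorphic to one of that kind; and any *-homomorphism
  from an algebra generated by the \<open>s\<^sub>i\<close> that sends \<open>s\<^sub>i\<close> to \<open>b\<^sub>i\<close> has its range in the subalgebra
  generated by \<open>1\<close> and the \<open>b\<^sub>i\<close>. Uniqueness of homomorphisms is uniqueness on the carrier.\<close>

definition universal_isometry_algebra ::
    "('h::complex_hilbert \<Rightarrow>\<^sub>L 'h) set \<Rightarrow> ('i \<Rightarrow> ('h \<Rightarrow>\<^sub>L 'h)) \<Rightarrow> ('r \<Rightarrow> 'i ncpoly) \<Rightarrow> bool"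
  where "universal_isometry_algebra A s p \<longleftrightarrow>
    range s \<subseteq> bop \<and>
    A = \<Inter>{B. unital_cstar_of_operators B \<and> range s \<subseteq> B} \<and>
    (\<forall>i. Poly_Mapping.single [Xstar i, X i] 1 - Poly_Mapping.single [] 1 \<in> range p) \<and>
    (\<forall>k. poly_eval (op_cstar A) s (p k) = 0) \<and>
    (\<forall>(B :: (nat \<Rightarrow> 'i ncpoly) cstar) b.
      unital_cstar_algebra B \<and> range b \<subseteq> carrier B \<and> (\<forall>k. poly_eval B b (p k) = \<zero>\<^bsub>B\<^esub>) \<longrightarrow>
      (\<exists>\<pi>. star_hom (op_cstar A) B \<pi> \<and> (\<forall>i. \<pi> (s i) = b i) \<and>
        (\<forall>\<pi>'. star_hom (op_cstar A) B \<pi>' \<and> (\<forall>i. \<pi>' (s i) = b i) \<longrightarrow> (\<forall>x\<in>A. \<pi>' x = \<pi> x))))"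

definition generated_star_algebra :: "('h::complex_hilbert \<Rightarrow>\<^sub>L 'h) set \<Rightarrow> ('h \<Rightarrow>\<^sub>L 'h) set"
  where "generated_star_algebra S = \<Inter>{B. star_subalgebra B \<and> S \<subseteq> B}"

section \<open>Hilbert-space tensor products\<close>

text \<open>Tensor products are used through any realisation: \<open>tens\<close> exhibits \<open>'c\<close> as the completion of
  the algebraic tensor product of \<open>'a\<close> and \<open>'b\<close> for the usual inner product.\<close>

definition bilinear_isometric ::
    "('a::complex_hilbert \<Rightarrow> 'b::complex_hilbert \<Rightarrow> 'c::complex_hilbert) \<Rightarrow> bool"
  where "bilinear_isometric tens \<longleftrightarrow>
    (\<forall>x. clinear_on UNIV (tens x)) \<and> (\<forall>y. clinear_on UNIV (\<lambda>x. tens x y)) \<and>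
    (\<forall>x x' y y'. cinner (tens x y) (tens x' y') = cinner x x' * cinner y y')"

definition hilbert_tensor ::
    "('a::complex_hilbert \<Rightarrow> 'b::complex_hilbert \<Rightarrow> 'c::complex_hilbert) \<Rightarrow> bool"
  where "hilbert_tensor tens \<longleftrightarrow>
    bilinear_isometric tens \<and> closure (cvec.span {tens x y | x y. True}) = UNIV"

text \<open>All the spaces \<open>h \<otimes> K\<^sup>\<otimes>\<^sup>n\<close> (Hilbert-space tensor powers, \<open>n \<ge> 0\<close>) are realised at once, as the
  orthogonal summands of a single Hilbert space \<open>'p\<close>: \<open>emb u\<close> is the copy of \<open>u \<in> h\<close> in the
  \<open>0\<close>-th summand \<open>h\<close>, and for \<open>\<zeta>\<close> in the \<open>n\<close>-th summand \<open>app \<zeta> \<xi>\<close> is \<open>\<zeta> \<otimes> \<xi>\<close> in the \<open>(n+1)\<close>-st.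
  An operator on \<open>h \<otimes> K\<^sup>\<otimes>\<^sup>n\<close> is regarded as an operator on \<open>'p\<close> that vanishes on the other
  summands, which does not alter its norm, products or adjoint.\<close>

definition tensor_word :: "('h \<Rightarrow> 'p) \<Rightarrow> ('p \<Rightarrow> 'q \<Rightarrow> 'p) \<Rightarrow> 'h \<Rightarrow> 'q list \<Rightarrow> 'p"
  where "tensor_word emb app u \<xi>s = foldl app (emb u) \<xi>s"

definition tensor_tower ::
    "('h::complex_hilbert \<Rightarrow> 'p::complex_hilbert) \<Rightarrow> ('p \<Rightarrow> 'q::complex_hilbert \<Rightarrow> 'p) \<Rightarrow> bool"
  where "tensor_tower emb app \<longleftrightarrow>
    clinear_on UNIV emb \<and> (\<forall>u v. cinner (emb u) (emb v) = cinner u v) \<and>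
    bilinear_isometric app \<and> (\<forall>u \<zeta> \<xi>. cinner (emb u) (app \<zeta> \<xi>) = 0) \<and>
    closure (cvec.span {tensor_word emb app u \<xi>s | u \<xi>s. True}) = UNIV"

context
  fixes emb :: "'h::complex_hilbert \<Rightarrow> 'p::complex_hilbert"
    and app :: "'p \<Rightarrow> 'q::complex_hilbert \<Rightarrow> 'p"
begin

text \<open>\<open>level0 a\<close> is \<open>a \<in> B(h)\<close> acting on the \<open>0\<close>-th summand; \<open>op_tensor T b\<close> is \<open>T \<otimes> b\<close>, an
  operator on the \<open>(n+1)\<close>-st summand if \<open>T\<close> is one on the \<open>n\<close>-th.\<close>

definition level0 :: "('h \<Rightarrow>\<^sub>L 'h) \<Rightarrow> ('p \<Rightarrow>\<^sub>L 'p)"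
  where "level0 a = (THE S. S \<in> bop \<and>
    (\<forall>u. blinfun_apply S (emb u) = emb (blinfun_apply a u)) \<and>
    (\<forall>\<zeta> \<xi>. blinfun_apply S (app \<zeta> \<xi>) = 0))"

definition op_tensor :: "('p \<Rightarrow>\<^sub>L 'p) \<Rightarrow> ('q \<Rightarrow>\<^sub>L 'q) \<Rightarrow> ('p \<Rightarrow>\<^sub>L 'p)"
  where "op_tensor T b = (THE S. S \<in> bop \<and>
    (\<forall>u. blinfun_apply S (emb u) = 0) \<and>
    (\<forall>\<zeta> \<xi>. blinfun_apply S (app \<zeta> \<xi>) = app (blinfun_apply T \<zeta>) (blinfun_apply b \<xi>)))"

definition tensor1 :: "('h \<Rightarrow>\<^sub>L 'h) \<Rightarrow> ('q \<Rightarrow>\<^sub>L 'q) \<Rightarrow> ('p \<Rightarrow>\<^sub>L 'p)"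
  where "tensor1 a b = op_tensor (level0 a) b"

text \<open>The algebraic tensor product of \<open>A0\<close> and \<open>B(K)\<close>.\<close>

definition alg_tensor :: "('h \<Rightarrow>\<^sub>L 'h) set \<Rightarrow> ('p \<Rightarrow>\<^sub>L 'p) set"
  where "alg_tensor A0 = cvec.span {tensor1 a b | a b. a \<in> A0 \<and> b \<in> bop}"

text \<open>\<open>amplify A0 \<psi>\<close> is \<open>\<psi> \<otimes> id\<close> on the algebraic tensor product of \<open>A0\<close> and \<open>B(K)\<close>.\<close>

definition amplify :: "('h \<Rightarrow>\<^sub>L 'h) set \<Rightarrow> (('h \<Rightarrow>\<^sub>L 'h) \<Rightarrow> ('p \<Rightarrow>\<^sub>L 'p)) \<Rightarrow> ('p \<Rightarrow>\<^sub>L 'p) \<Rightarrow> ('p \<Rightarrow>\<^sub>L 'p)"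
  where "amplify A0 \<psi> T = (THE S. \<exists>ab. set ab \<subseteq> A0 \<times> bop \<and>
    T = (\<Sum>(a, b)\<leftarrow>ab. tensor1 a b) \<and> S = (\<Sum>(a, b)\<leftarrow>ab. op_tensor (\<psi> a) b))"

text \<open>\<open>ket \<xi>\<close> is \<open>1 \<otimes> |\<xi>\<rangle> : h \<rightarrow> h \<otimes> K\<close>; its adjoint is \<open>1 \<otimes> \<langle>\<xi>|\<close> (on the first summand, and
  zero on the others).\<close>

definition ket :: "'q \<Rightarrow> ('h \<Rightarrow>\<^sub>L 'p)"
  where "ket \<xi> = Blinfun (\<lambda>u. app (emb u) \<xi>)"

definition slice :: "(('h \<Rightarrow>\<^sub>L 'h) \<Rightarrow> ('p \<Rightarrow>\<^sub>L 'p)) \<Rightarrow> 'q \<Rightarrow> 'q \<Rightarrow> ('h \<Rightarrow>\<^sub>L 'h) \<Rightarrow> ('h \<Rightarrow>\<^sub>L 'h)"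
  where "slice \<phi> \<xi> \<eta> x = adj (ket \<xi>) o\<^sub>L \<phi> x o\<^sub>L ket \<eta>"

primrec random_walk :: "('h \<Rightarrow>\<^sub>L 'h) set \<Rightarrow> (('h \<Rightarrow>\<^sub>L 'h) \<Rightarrow> ('p \<Rightarrow>\<^sub>L 'p)) \<Rightarrow> nat \<Rightarrow> ('h \<Rightarrow>\<^sub>L 'h) \<Rightarrow> ('p \<Rightarrow>\<^sub>L 'p)"
  where
    "random_walk A0 \<phi> 0 = level0"
  | "random_walk A0 \<phi> (Suc n) = (\<lambda>x. amplify A0 (random_walk A0 \<phi> n) (\<phi> x))"

definition A_phi :: "('h \<Rightarrow>\<^sub>L 'h) set \<Rightarrow> (('h \<Rightarrow>\<^sub>L 'h) \<Rightarrow> ('p \<Rightarrow>\<^sub>L 'p)) \<Rightarrow> ('h \<Rightarrow>\<^sub>L 'h) set"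
  where "A_phi A0 \<phi> = {x \<in> A0. \<exists>C>0. \<exists>M>0. \<forall>n. norm (random_walk A0 \<phi> n x) \<le> C * M ^ n}"

end

section \<open>Flow generators\<close>

text \<open>From here on the second tensor factor is \<^typ>\<open>complex \<times> 'k\<close>.\<close>

definition omega :: "complex \<times> 'k::complex_hilbert"
  where "omega = (1, 0)"

definition P_k :: "(complex \<times> 'k::complex_hilbert) \<Rightarrow>\<^sub>L (complex \<times> 'k)"
  where "P_k = Blinfun (\<lambda>(z, \<xi>). (0, \<xi>))"

definition flow_generator ::
    "('h::complex_hilbert \<Rightarrow> 'p::complex_hilbert) \<Rightarrow> ('p \<Rightarrow> complex \<times> 'k::complex_hilbert \<Rightarrow> 'p) \<Rightarrow>
      ('h \<Rightarrow>\<^sub>L 'h) set \<Rightarrow> (('h \<Rightarrow>\<^sub>L 'h) \<Rightarrow> ('p \<Rightarrow>\<^sub>L 'p)) \<Rightarrow> bool"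
  where "flow_generator emb app A0 \<phi> \<longleftrightarrow>
    (\<forall>x\<in>A0. \<phi> x \<in> alg_tensor emb app A0) \<and>
    clinear_on A0 \<phi> \<and>
    (\<forall>x\<in>A0. \<phi> (adj x) = adj (\<phi> x)) \<and>
    \<phi> id_blinfun = 0 \<and>
    (\<forall>x\<in>A0. \<forall>y\<in>A0. \<phi> (x o\<^sub>L y) =
        (\<phi> x o\<^sub>L tensor1 emb app y id_blinfun) + (tensor1 emb app x id_blinfun o\<^sub>L \<phi> y)
        + (\<phi> x o\<^sub>L tensor1 emb app id_blinfun P_k o\<^sub>L \<phi> y))"

section \<open>Fock space and quantum Wiener integrals\<close>

abbreviation half_line :: "real measure"
  where "half_line \<equiv> restrict_space lborel {0..}"

text \<open>Elements of \<open>L\<^sup>2(\<real>\<^sub>+; k)\<close> are represented by functions on \<open>\<real>\<close> whose values on the negative axis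
  are irrelevant; every class has a representative that is everywhere on \<open>\<real>\<^sub>+\<close> a pointwise limit
  of simple functions. \<open>k\<close> need not be separable, so Borel measurability would not suffice.\<close>

definition L2 :: "(real \<Rightarrow> 'k::complex_hilbert) set"
  where "L2 = {f. (\<exists>s. (\<forall>m. simple_function half_line (s m)) \<and> (\<forall>r\<ge>0. (\<lambda>m. s m r) \<longlonglongrightarrow> f r)) \<and>
    integrable half_line (\<lambda>r. (norm (f r))\<^sup>2)}"

definition L2_inner :: "(real \<Rightarrow> 'k::complex_hilbert) \<Rightarrow> (real \<Rightarrow> 'k) \<Rightarrow> complex"
  where "L2_inner f g = (LINT r|half_line. cinner (f r) (g r))"

definition upto_time :: "real \<Rightarrow> (real \<Rightarrow> 'k::complex_hilbert) \<Rightarrow> (real \<Rightarrow> 'k)"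
  where "upto_time t f = (\<lambda>r. indicator {0..<t} r *\<^sub>R f r)"

text \<open>Boson Fock space over \<open>L\<^sup>2(\<real>\<^sub>+; k)\<close> with its exponential vectors, in any realisation. The
  inner-product formula makes \<open>\<epsilon> f\<close> depend only on the almost-everywhere class of \<open>f\<close>.\<close>

definition boson_fock :: "((real \<Rightarrow> 'k::complex_hilbert) \<Rightarrow> 'f::complex_hilbert) \<Rightarrow> bool"
  where "boson_fock \<epsilon> \<longleftrightarrow>
    (\<forall>f\<in>L2. \<forall>g\<in>L2. cinner (\<epsilon> f) (\<epsilon> g) = exp (L2_inner f g)) \<and>
    closure (cvec.span (\<epsilon> ` L2)) = UNIV"

definition fhat :: "(real \<Rightarrow> 'k) \<Rightarrow> real \<Rightarrow> complex \<times> 'k"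
  where "fhat f r = (1, f r)"

definition simplex_times :: "nat \<Rightarrow> real \<Rightarrow> (nat \<Rightarrow> real) set"
  where "simplex_times n t = {\<tau> \<in> {..<n} \<rightarrow>\<^sub>E {0..t}. \<forall>i j. i < j \<and> j < n \<longrightarrow> \<tau> i < \<tau> j}"

context
  fixes emb :: "'h::complex_hilbert \<Rightarrow> 'p::complex_hilbert"
    and app :: "'p \<Rightarrow> complex \<times> 'k::complex_hilbert \<Rightarrow> 'p"
    and \<epsilon> :: "(real \<Rightarrow> 'k) \<Rightarrow> 'f::complex_hilbert"
    and tensF :: "'h \<Rightarrow> 'f \<Rightarrow> 'g::complex_hilbert"
begin

definition exp_domain :: "'g set"
  where "exp_domain = cvec.span {tensF u (\<epsilon> f) | u f. f \<in> L2}"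

text \<open>\<open>wiener_integral n t T L\<close>: the operator \<open>L\<close> with domain \<open>exp_domain\<close> is the \<open>n\<close>-fold quantum
  Wiener integral of \<open>T\<close>. Values of \<open>L\<close> outside \<open>exp_domain\<close> are irrelevant. For \<open>n = 0\<close>, \<open>T\<close> is
  an operator \<open>a\<close> on \<open>h\<close> placed at level \<open>0\<close>, and \<open>L\<close> is \<open>a \<otimes> 1\<close>.\<close>

definition wiener_integral :: "nat \<Rightarrow> real \<Rightarrow> ('p \<Rightarrow>\<^sub>L 'p) \<Rightarrow> ('g \<Rightarrow> 'g) \<Rightarrow> bool"
  where "wiener_integral n t T L \<longleftrightarrow> clinear_on exp_domain L \<and>
    (if n = 0 then
       \<exists>a\<in>bop. T = level0 emb app a \<and>
         (\<forall>v. \<forall>g\<in>L2. L (tensF v (\<epsilon> g)) = tensF (blinfun_apply a v) (\<epsilon> g))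
     else
       \<forall>u v. \<forall>f\<in>L2. \<forall>g\<in>L2. cinner (tensF u (\<epsilon> f)) (L (tensF v (\<epsilon> g))) =
         (LINT \<tau>:simplex_times n t|Pi\<^sub>M {..<n} (\<lambda>_. lborel).
            cinner (tensor_word emb app u (map (\<lambda>i. fhat f (\<tau> i)) [0..<n]))
              (blinfun_apply T (tensor_word emb app v (map (\<lambda>i. fhat g (\<tau> i)) [0..<n]))))
         * cinner (\<epsilon> f) (\<epsilon> g))"

text \<open>\<open>J = j\<^sub>t(x) = \<Sum>\<^sub>n \<Lambda>\<^sup>n\<^sub>t(\<phi>\<^sub>n(x))\<close> on \<open>exp_domain\<close>, with strong convergence of the series.\<close>

definition is_flow_series ::
    "('h \<Rightarrow>\<^sub>L 'h) set \<Rightarrow> (('h \<Rightarrow>\<^sub>L 'h) \<Rightarrow> ('p \<Rightarrow>\<^sub>L 'p)) \<Rightarrow> real \<Rightarrow> ('h \<Rightarrow>\<^sub>L 'h) \<Rightarrow> ('g \<Rightarrow>\<^sub>L 'g) \<Rightarrow> bool"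
  where "is_flow_series A0 \<phi> t x J \<longleftrightarrow>
    (\<exists>\<Lambda>. (\<forall>n. wiener_integral n t (random_walk emb app A0 \<phi> n x) (\<Lambda> n)) \<and>
         (\<forall>\<zeta>\<in>exp_domain. (\<lambda>n. \<Lambda> n \<zeta>) sums blinfun_apply J \<zeta>))"

definition ketF :: "'f \<Rightarrow> ('h \<Rightarrow>\<^sub>L 'g)"
  where "ketF \<eta> = Blinfun (\<lambda>u. tensF u \<eta>)"

text \<open>\<open>fock_slice j t f g a\<close> is \<open>j\<^sub>t[f,g](a)\<close>.\<close>

definition fock_slice ::
    "(real \<Rightarrow> ('h \<Rightarrow>\<^sub>L 'h) \<Rightarrow> ('g \<Rightarrow>\<^sub>L 'g)) \<Rightarrow> real \<Rightarrow> (real \<Rightarrow> 'k) \<Rightarrow> (real \<Rightarrow> 'k) \<Rightarrow> ('h \<Rightarrow>\<^sub>L 'h) \<Rightarrow> ('h \<Rightarrow>\<^sub>L 'h)"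
  where "fock_slice j t f g a =
    adj (ketF (\<epsilon> (upto_time t f))) o\<^sub>L j t a o\<^sub>L ketF (\<epsilon> (upto_time t g))"

definition feller_cocycle ::
    "('h \<Rightarrow>\<^sub>L 'h) set \<Rightarrow> (real \<Rightarrow> ('h \<Rightarrow>\<^sub>L 'h) \<Rightarrow> ('g \<Rightarrow>\<^sub>L 'g)) \<Rightarrow> bool"
  where "feller_cocycle A j \<longleftrightarrow>
    (\<forall>a\<in>A. fock_slice j 0 (\<lambda>_. 0) (\<lambda>_. 0) a = a) \<and>
    (\<forall>t\<ge>0. \<forall>f\<in>L2. \<forall>g\<in>L2. \<forall>a\<in>A. fock_slice j t f g a \<in> A) \<and>
    (\<forall>f\<in>L2. \<forall>g\<in>L2. \<forall>a\<in>A. continuous_on {0..} (\<lambda>t. fock_slice j t f g a)) \<and>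
    (\<forall>s\<ge>0. \<forall>t\<ge>0. \<forall>f\<in>L2. \<forall>g\<in>L2. \<forall>a\<in>A.
       fock_slice j (s + t) f g a =
       fock_slice j s f g (fock_slice j t (\<lambda>r. f (r + s)) (\<lambda>r. g (r + s)) a))"

definition vacuum_expectation ::
    "(real \<Rightarrow> ('h \<Rightarrow>\<^sub>L 'h) \<Rightarrow> ('g \<Rightarrow>\<^sub>L 'g)) \<Rightarrow> real \<Rightarrow> ('h \<Rightarrow>\<^sub>L 'h) \<Rightarrow> ('h \<Rightarrow>\<^sub>L 'h)"
  where "vacuum_expectation j t a = adj (ketF (\<epsilon> (\<lambda>_. 0))) o\<^sub>L j t a o\<^sub>L ketF (\<epsilon> (\<lambda>_. 0))"

end

section \<open>Semigroups of completely positive contractions\<close>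

text \<open>Positivity of an \<open>n \<times> n\<close> matrix of operators on \<open>h\<close>, as an operator on \<open>h\<^sup>n\<close>.\<close>

definition positive_matrix :: "nat \<Rightarrow> (nat \<Rightarrow> nat \<Rightarrow> ('h::complex_hilbert \<Rightarrow>\<^sub>L 'h)) \<Rightarrow> bool"
  where "positive_matrix n a \<longleftrightarrow>
    (\<forall>u. (\<Sum>i<n. \<Sum>j<n. cinner (u i) (blinfun_apply (a i j) (u j))) \<in> \<real>\<^sub>\<ge>\<^sub>0)"

definition completely_positive_on ::
    "('h::complex_hilbert \<Rightarrow>\<^sub>L 'h) set \<Rightarrow> (('h \<Rightarrow>\<^sub>L 'h) \<Rightarrow> ('h \<Rightarrow>\<^sub>L 'h)) \<Rightarrow> bool"
  where "completely_positive_on A S \<longleftrightarrow>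
    (\<forall>n a. (\<forall>i<n. \<forall>j<n. a i j \<in> A) \<and> positive_matrix n a \<longrightarrow> positive_matrix n (\<lambda>i j. S (a i j)))"

definition cp_contraction_semigroup ::
    "('h::complex_hilbert \<Rightarrow>\<^sub>L 'h) set \<Rightarrow> (real \<Rightarrow> ('h \<Rightarrow>\<^sub>L 'h) \<Rightarrow> ('h \<Rightarrow>\<^sub>L 'h)) \<Rightarrow> bool"
  where "cp_contraction_semigroup A T \<longleftrightarrow>
    (\<forall>t\<ge>0. (\<forall>a\<in>A. T t a \<in> A) \<and> clinear_on A (T t) \<and> (\<forall>a\<in>A. norm (T t a) \<le> norm a) \<and>
       completely_positive_on A (T t)) \<and>
    (\<forall>a\<in>A. T 0 a = a) \<and>
    (\<forall>s\<ge>0. \<forall>t\<ge>0. \<forall>a\<in>A. T (s + t) a = T s (T t a)) \<and>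
    (\<forall>a\<in>A. continuous_on {0..} (\<lambda>t. T t a))"

definition generator_graph ::
    "'a::real_normed_vector set \<Rightarrow> (real \<Rightarrow> 'a \<Rightarrow> 'a) \<Rightarrow> ('a \<times> 'a) set"
  where "generator_graph A T =
    {(a, b). a \<in> A \<and> b \<in> A \<and> ((\<lambda>t. (T t a - a) /\<^sub>R t) \<longlongrightarrow> b) (at_right 0)}"

definition is_core :: "'a::real_normed_vector set \<Rightarrow> ('a \<times> 'a) set \<Rightarrow> bool"
  where "is_core D G \<longleftrightarrow> D \<subseteq> Domain G \<and> G \<subseteq> closure (G \<inter> D \<times> UNIV)"

end

theory Submission
  imports Defs
begin

text \<open>Peeling off the latest time of the simplex integrals shows that \<open>\<Lambda>\<^sup>n\<^sub>t(\<phi>\<^sub>n(x))\<close>, evaluated weakly at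
  exponential vectors of bounded \<open>f\<close> and \<open>g\<close>, is an iterated operator-valued integral
  \<open>I\<^sub>n(t, x) = \<integral>\<^sub>0\<^sup>t I\<^bsub>n-1\<^esub>(r, \<phi>\<^bsub>r\<^esub>(x)) dr\<close>, where \<open>\<phi>\<^bsub>r\<^esub>\<close> is the slice of \<open>\<phi>\<close> at \<open>(1, f(r))\<close> and \<open>(1, g(r))\<close>. Since
  \<open>\<parallel>\<phi>\<^sub>n(x)\<parallel> \<le> C M\<^sup>n\<close>, its norm is at most \<open>C (M c t)\<^sup>n / n!\<close>; hence the sum \<open>F(t, x)\<close> over \<open>n\<close> lies in \<open>A\<close>, is norm
  continuous in \<open>t\<close> and solves \<open>F(t, x) = x + \<integral>\<^sub>0\<^sup>t F(r, \<phi>\<^bsub>r\<^esub>(x)) dr\<close>. The same factorial estimate makes solutions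
  that are bounded in \<open>x\<close> unique, and uniqueness gives the cocycle identity. Contractivity of
  \<open>*\<close>-homomorphisms extends everything from \<open>A\<^sub>0\<close> to \<open>A\<close>, and truncation of \<open>f\<close> and \<open>g\<close> extends it to all of
  \<open>L\<^sup>2\<close>. For \<open>f = g = 0\<close> the elements of \<open>A\<^sub>0\<close> are entire vectors of the semigroup; together with the
  averages of \<open>T\<^sub>r(a)\<close> over \<open>r \<in> [0, t]\<close> this yields the core. Complete positivity holds because a
  strictly positive matrix over \<open>A\<close> is of the form \<open>b\<^sup>*b\<close> with entries of \<open>b\<close> in \<open>A\<close>.\<close>

section \<open>Complex Hilbert spaces and adjoints\<close>

text \<open>The slices of \<open>\<phi>\<close> may be unbounded, so estimates in the norm of
  \<open>A\<close> cannot be iterated. The numbers \<open>norm (rw n x)\<close> replace that norm: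
  they form a scale on which a slice acts as a shift, the n-th number of a slice of x being at most
  the (n+1)-st number of x times the norms of the two slicing vectors. Each slice costs one shift,
  and each time integration pays for it with a factor t/n. The second obstacle is measurability,
  since neither k nor a space of operators need be separable. It disappears because
  \<open>\<phi> x\<close> is a finite sum of elementary tensors with first factors in
  \<open>A0\<close>: the integrands are finite sums of bounded Borel scalar functions times norm
  continuous operator functions. For the same reason slices stay in \<open>A0\<close>. Exponential
  vectors contribute only a scalar, the exponential of the integral of \<langle>f(r), g(r)\<rangle>
  over [0,t]. Its exponent is additive in time, so the cocycle identity may be proved for the
  normalised sums. Contractivity and complete positivity both rest on the equation b = (z + b^2)/2,
  solved inside a closed *-algebra, so that square roots never leave the algebra.\<close>

lemma cinner_add_left: "cinner (x + y) z = cinner x z + cinner y (z::'a::complex_hilbert)"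
  using cinner_commute[of "x + y" z] cinner_commute[of x z] cinner_commute[of y z]
  by (simp add: cinner_add_right)

lemma cinner_zero_right [simp]: "cinner x (0::'a::complex_hilbert) = 0"
  using cinner_add_right[of x 0 0] by simp

lemma cinner_zero_left [simp]: "cinner (0::'a::complex_hilbert) x = 0"
  using cinner_add_left[of 0 0 x] by simp

lemma cinner_scaleR_right: "cinner x (r *\<^sub>R y) = of_real r * cinner x (y::'a::complex_hilbert)"
  by (simp add: scaleR_scaleC cinner_scaleC_right)

lemma cinner_scaleR_left: "cinner (r *\<^sub>R x) y = of_real r * cinner x (y::'a::complex_hilbert)"
  by (simp add: scaleR_scaleC cinner_scaleC_left)

lemma cinner_minus_right: "cinner x (- y) = - cinner x (y::'a::complex_hilbert)"
  using cinner_add_right[of x y "-y"] by (simp add: add_eq_0_iff2 minus_equation_iff)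

lemma cinner_minus_left: "cinner (- x) y = - cinner x (y::'a::complex_hilbert)"
  using cinner_add_left[of x "-x" y] by (simp add: add_eq_0_iff2 minus_equation_iff)

lemma cinner_diff_right: "cinner x (y - z) = cinner x y - cinner x (z::'a::complex_hilbert)"
  using cinner_add_right[of x y "-z"] by (simp add: cinner_minus_right)

lemma cinner_diff_left: "cinner (x - y) z = cinner x z - cinner y (z::'a::complex_hilbert)"
  using cinner_add_left[of x "-y" z] by (simp add: cinner_minus_left)

lemmas cinner_algebra = cinner_add_left cinner_add_right cinner_diff_left cinner_diff_right
  cinner_scaleC_left cinner_scaleC_right cinner_scaleR_left cinner_scaleR_right

lemma cinner_sum_right: "cinner x (\<Sum>i\<in>I. g i) = (\<Sum>i\<in>I. cinner x (g i :: 'a::complex_hilbert))"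
  by (induction I rule: infinite_finite_induct) (auto simp: cinner_add_right)

lemma cinner_sum_left: "cinner (\<Sum>i\<in>I. g i) x = (\<Sum>i\<in>I. cinner (g i) (x :: 'a::complex_hilbert))"
  by (induction I rule: infinite_finite_induct) (auto simp: cinner_add_left)

lemma norm_sq_cinner: "(norm x)\<^sup>2 = Re (cinner x (x::'a::complex_hilbert))"
  by (simp add: cinner_self)

lemma cinner_self_eq_0: "cinner x x = 0 \<longleftrightarrow> x = (0::'a::complex_hilbert)"
  by (simp add: cinner_self)

lemma cinner_eq_right:
  assumes "\<And>x. cinner x y = cinner x (z::'a::complex_hilbert)" shows "y = z"
  using assms[of "y - z"] cinner_self_eq_0[of "y - z"] by (simp add: cinner_diff_right)

lemma cinner_eq_left:
  assumes "\<And>x. cinner y x = cinner z (x::'a::complex_hilbert)" shows "y = z"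
  using assms[of "y - z"] cinner_self_eq_0[of "y - z"] by (simp add: cinner_diff_left)

lemma norm_add_sq: "(norm (x + y))\<^sup>2 = (norm x)\<^sup>2 + 2 * Re (cinner x y) + (norm (y::'a::complex_hilbert))\<^sup>2"
  unfolding norm_sq_cinner using cinner_commute[of x y] by (simp add: cinner_algebra)

lemma norm_diff_sq: "(norm (x - y))\<^sup>2 = (norm x)\<^sup>2 - 2 * Re (cinner x y) + (norm (y::'a::complex_hilbert))\<^sup>2"
  using norm_add_sq[of x "-y"] by (simp add: cinner_minus_right)

lemma cauchy_schwarz: "cmod (cinner x y) \<le> norm x * norm (y::'a::complex_hilbert)"
proof (cases "y = 0")
  case False
  define c where "c = cinner y x / of_real ((norm y)\<^sup>2)"
  have ny: "(norm y)\<^sup>2 > 0" using False by simp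
  have sq: "cinner y x * cinner x y = of_real ((cmod (cinner x y))\<^sup>2)"
    using cinner_commute[of y x] by (simp only: complex_norm_square mult.commute)
  have "cinner (x - c *\<^sub>C y) (x - c *\<^sub>C y) =
      cinner x x - c * cinner x y - cnj c * cinner y x + cnj c * c * cinner y y"
    by (simp add: cinner_algebra algebra_simps)
  also have "cnj c = cinner x y / of_real ((norm y)\<^sup>2)"
    using cinner_commute[of x y] by (simp add: c_def)
  also have "cinner x x - c * cinner x y - cinner x y / of_real ((norm y)\<^sup>2) * cinner y x
      + cinner x y / of_real ((norm y)\<^sup>2) * c * cinner y y
      = of_real ((norm x)\<^sup>2 - (cmod (cinner x y))\<^sup>2 / (norm y)\<^sup>2)"
    using ny sq by (simp add: c_def cinner_self field_simps)
  finally have "(norm (x - c *\<^sub>C y))\<^sup>2 = (norm x)\<^sup>2 - (cmod (cinner x y))\<^sup>2 / (norm y)\<^sup>2"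
    unfolding cinner_self of_real_eq_iff .
  hence "(cmod (cinner x y))\<^sup>2 / (norm y)\<^sup>2 \<le> (norm x)\<^sup>2"
    by (metis diff_ge_0_iff_ge zero_le_power2)
  hence "(cmod (cinner x y))\<^sup>2 \<le> (norm x * norm y)\<^sup>2"
    using ny by (simp add: field_simps power_mult_distrib)
  thus ?thesis by (rule power2_le_imp_le) simp
qed simp

lemma bounded_bilinear_cinner: "bounded_bilinear (cinner :: 'a::complex_hilbert \<Rightarrow> 'a \<Rightarrow> complex)"
  by standard
     (auto simp: cinner_algebra scaleR_conv_of_real intro!: exI[of _ 1] cauchy_schwarz)

lemmas tendsto_cinner = bounded_bilinear.tendsto[OF bounded_bilinear_cinner]

lemma norm_le_cinnerI:
  assumes "0 \<le> K" "\<And>y. cmod (cinner y x) \<le> K * norm (y::'a::complex_hilbert)"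
  shows "norm x \<le> K"
proof (cases "x = 0")
  case False
  have "norm x * norm x \<le> K * norm x"
    using assms(2)[of x] by (simp add: cinner_self power2_eq_square norm_mult)
  thus ?thesis using False by simp
qed (use assms in auto)

text \<open>If z represents f, then |x|^2 - 2 Re f(x) equals |x - z|^2 - |z|^2. So z is found as the
  minimiser of this functional: completeness gives existence, and the first-order condition gives
  the real part of the identity.\<close>

lemma riesz_representation:
  fixes f :: "'a::complex_hilbert \<Rightarrow> complex"
  assumes f: "bounded_linear f" and fC: "\<And>c x. f (c *\<^sub>C x) = c * f x"
  shows "\<exists>z. \<forall>x. f x = cinner z x"
proof -
  interpret f: bounded_linear f by fact
  obtain K where K: "\<And>x. norm (f x) \<le> norm x * K" "K \<ge> 0"
    using f.nonneg_bounded by blast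
  define E where "E x = (norm x)\<^sup>2 - 2 * Re (f x)" for x
  have E_lb: "- K\<^sup>2 \<le> E x" for x
  proof -
    have "Re (f x) \<le> norm x * K" using K(1)[of x] complex_Re_le_cmod order_trans by blast
    hence "E x \<ge> (norm x)\<^sup>2 - 2 * (norm x * K)" by (simp add: E_def)
    moreover have "0 \<le> (norm x - K)\<^sup>2" by simp
    ultimately show ?thesis by (simp add: power2_diff)
  qed
  define d where "d = Inf (range E)"
  have bdd: "bdd_below (range E)" using E_lb by (auto intro!: bdd_belowI)
  have d_le: "d \<le> E x" for x unfolding d_def by (intro cInf_lower bdd) auto
  \<comment> \<open>The parallelogram law, in which the linear part of \<open>E\<close> cancels. It
    forces minimising sequences to be Cauchy.\<close>
  have mid: "(norm (x - y))\<^sup>2 = 2 * E x + 2 * E y - 4 * E ((1/2) *\<^sub>R (x + y))" for x y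
    unfolding E_def by (simp add: norm_add_sq norm_diff_sq f.scaleR f.add cinner_scaleR_left
        cinner_scaleR_right field_simps power_divide)
  have "\<exists>x. E x < d + 1 / real (Suc n)" for n
    using cInf_lessD[of "range E" "d + 1 / real (Suc n)"] by (auto simp: d_def)
  then obtain X where X: "\<And>n. E (X n) < d + 1 / real (Suc n)" by metis
  have "Cauchy X"
  proof (rule metric_CauchyI)
    fix e :: real assume e: "e > 0"
    obtain N where N: "1 / real (Suc N) < e\<^sup>2 / 4"
      using reals_Archimedean[of "e\<^sup>2/4"] e by (auto simp: inverse_eq_divide)
    have "dist (X m) (X n) < e" if "m \<ge> N" "n \<ge> N" for m n
    proof -
      have "1 / real (Suc m) \<le> 1 / real (Suc N)" "1 / real (Suc n) \<le> 1 / real (Suc N)"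
        using that by (auto simp: field_simps)
      hence "(norm (X m - X n))\<^sup>2 < e\<^sup>2"
        using mid[of "X m" "X n"] X[of m] X[of n] d_le[of "(1/2) *\<^sub>R (X m + X n)"] N by linarith
      thus ?thesis using e by (simp add: dist_norm power2_less_imp_less)
    qed
    thus "\<exists>M. \<forall>m\<ge>M. \<forall>n\<ge>M. dist (X m) (X n) < e" by blast
  qed
  then obtain z where z: "X \<longlonglongrightarrow> z" using Cauchy_convergent_iff convergent_def by blast
  have "(\<lambda>n. E (X n)) \<longlonglongrightarrow> E z"
    unfolding E_def by (intro tendsto_intros z f.tendsto)
  moreover have "(\<lambda>n. d + 1 / real (Suc n)) \<longlonglongrightarrow> d"
    using tendsto_add[OF tendsto_const LIMSEQ_inverse_real_of_nat] by (simp add: inverse_eq_divide)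
  ultimately have Ez: "E z \<le> d"
    using X by (intro LIMSEQ_le) (auto intro!: exI[of _ 0] less_imp_le)
  have re: "Re (cinner z y) = Re (f y)" for y
  proof -
    define b where "b = Re (cinner z y) - Re (f y)"
    have *: "0 \<le> t\<^sup>2 * (norm y)\<^sup>2 + 2 * t * b" for t
    proof -
      have "E z \<le> E (z + t *\<^sub>R y)" using Ez d_le order_trans by blast
      thus ?thesis
        by (simp add: E_def b_def norm_add_sq f.add f.scaleR cinner_scaleR_right
            power_mult_distrib algebra_simps)
    qed
    show ?thesis
    proof (cases "y = 0")
      case False
      \<comment> \<open>The choice t = -b/|y|^2 minimises the quadratic polynomial in t; its minimal
        value can be nonnegative only if b = 0.\<close>
      have "0 \<le> - (b\<^sup>2 / (norm y)\<^sup>2)"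
        using *[of "- b / (norm y)\<^sup>2"] False by (simp add: field_simps power2_eq_square)
      moreover have "(norm y)\<^sup>2 > 0" using False by simp
      ultimately have "b = 0" by (simp add: divide_le_0_iff zero_le_divide_iff)
      thus ?thesis by (simp add: b_def)
    qed (simp add: f.zero)
  qed
  have "f y = cinner z y" for y
  proof (rule complex_eqI)
    show "Re (f y) = Re (cinner z y)" using re by simp
    show "Im (f y) = Im (cinner z y)" using re[of "\<i> *\<^sub>C y"] by (simp add: cinner_scaleC_right fC)
  qed
  thus ?thesis by blast
qed

section \<open>Complex scalars and complex-linear operators\<close>

lemma norm_scaleC_blinfun:
  "norm (c *\<^sub>C T) = cmod c * norm (T :: 'a::real_normed_vector \<Rightarrow>\<^sub>L 'b::complex_hilbert)"
proof -
  have le: "norm (c *\<^sub>C T) \<le> cmod c * norm T" for c and T :: "'a \<Rightarrow>\<^sub>L 'b"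
    by (intro norm_blinfun_bound)
       (auto simp: scaleC_blinfun.rep_eq norm_scaleC mult.assoc intro!: mult_left_mono norm_blinfun)
  show ?thesis
  proof (cases "c = 0")
    case False
    have "norm T = norm (inverse c *\<^sub>C c *\<^sub>C T)" using False by (simp add: scaleC_scaleC scaleC_one)
    also have "\<dots> \<le> inverse (cmod c) * norm (c *\<^sub>C T)"
      using le[of "inverse c" "c *\<^sub>C T"] by (simp add: norm_inverse)
    finally have "cmod c * norm T \<le> norm (c *\<^sub>C T)" using False by (simp add: field_simps)
    thus ?thesis using le[of c T] by simp
  qed simp
qed

lemma bounded_bilinear_scaleC_blinfun:
  "bounded_bilinear (scaleC :: complex \<Rightarrow> ('a::real_normed_vector \<Rightarrow>\<^sub>L 'b::complex_hilbert) \<Rightarrow> _)"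
proof
  fix r :: real and a :: complex and b :: "'a \<Rightarrow>\<^sub>L 'b"
  show "(r *\<^sub>R a) *\<^sub>C b = r *\<^sub>R (a *\<^sub>C b)" "a *\<^sub>C (r *\<^sub>R b) = r *\<^sub>R (a *\<^sub>C b)"
    by (simp_all add: scaleR_scaleC scaleC_scaleC scaleC_complex_def mult.commute)
  show "\<exists>K. \<forall>a b. norm (a *\<^sub>C (b::'a \<Rightarrow>\<^sub>L 'b)) \<le> norm a * norm b * K"
    by (intro exI[of _ 1]) (simp add: norm_scaleC_blinfun)
qed (simp_all add: scaleC_add_left scaleC_add_right)

lemma bounded_linear_scaleC_hilbert: "bounded_linear (\<lambda>x::'a::complex_hilbert. c *\<^sub>C x)"
  by (intro bounded_linear_intro[where K = "cmod c"])
     (auto simp: scaleC_add_right scaleR_scaleC scaleC_scaleC norm_scaleC mult.commute)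

lemma bop_scaleC: "T \<in> bop \<Longrightarrow> blinfun_apply T (c *\<^sub>C x) = c *\<^sub>C blinfun_apply T x"
  by (simp add: bop_def)

lemma bop_zero [simp]: "0 \<in> bop" by (simp add: bop_def)
lemma bop_id [simp]: "id_blinfun \<in> bop" by (simp add: bop_def)
lemma bop_add [intro]: "S \<in> bop \<Longrightarrow> T \<in> bop \<Longrightarrow> S + T \<in> bop"
  by (simp add: bop_def blinfun.add_left scaleC_add_right)
lemma bop_diff [intro]: "S \<in> bop \<Longrightarrow> T \<in> bop \<Longrightarrow> S - T \<in> bop"
  by (simp add: bop_def blinfun.diff_left cvec.scale_right_diff_distrib)
lemma bop_scale [intro]: "T \<in> bop \<Longrightarrow> c *\<^sub>C T \<in> bop"
  by (simp add: bop_def scaleC_blinfun.rep_eq scaleC_scaleC mult.commute)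
lemma bop_compose [intro]: "S \<in> bop \<Longrightarrow> T \<in> bop \<Longrightarrow> S o\<^sub>L T \<in> bop"
  by (simp add: bop_def)
lemma bop_sum_list: "(\<And>i. i \<in> set I \<Longrightarrow> g i \<in> bop) \<Longrightarrow> (\<Sum>i\<leftarrow>I. g i) \<in> bop"
  by (induction I) auto
lemma bop_sum: "(\<And>i. i \<in> I \<Longrightarrow> g i \<in> bop) \<Longrightarrow> (\<Sum>i\<in>I. g i) \<in> bop"
  by (induction I rule: infinite_finite_induct) auto

lemma closed_bop: "closed bop"
proof -
  have "bop = (\<Inter>c. \<Inter>x. {T. blinfun_apply T (c *\<^sub>C x) = c *\<^sub>C blinfun_apply T x})"
    by (auto simp: bop_def)
  also have "closed \<dots>"
    by (intro closed_INT ballI closed_Collect_eq continuous_intros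
        bounded_linear.continuous_on[OF bounded_linear_scaleC_hilbert])
  finally show ?thesis .
qed

section \<open>Adjoints of complex-linear operators\<close>

lemma adj_exists:
  fixes T :: "'a::complex_hilbert \<Rightarrow>\<^sub>L 'b::complex_hilbert"
  assumes T: "T \<in> bop"
  shows "\<exists>S. \<forall>x y. cinner (blinfun_apply S y) x = cinner y (blinfun_apply T x)"
proof -
  have "\<exists>z. \<forall>x. cinner y (blinfun_apply T x) = cinner z x" for y
  proof (rule riesz_representation)
    show "bounded_linear (\<lambda>x. cinner y (blinfun_apply T x))"
      using bounded_linear_compose[OF bounded_bilinear.bounded_linear_right[OF bounded_bilinear_cinner]
        blinfun.bounded_linear_right] .
  qed (simp add: bop_scaleC[OF T] cinner_scaleC_right)
  then obtain S where S: "\<And>x y. cinner (S y) x = cinner y (blinfun_apply T x)" by metis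
  have "bounded_linear S"
  proof (rule bounded_linear_intro[where K = "norm T"])
    show "S (x + y) = S x + S y" for x y
      by (rule cinner_eq_left) (simp add: cinner_add_left S)
    show "S (r *\<^sub>R x) = r *\<^sub>R S x" for r x
      by (rule cinner_eq_left) (simp add: cinner_scaleR_left S)
    show "norm (S y) \<le> norm y * norm T" for y
    proof (rule norm_le_cinnerI)
      fix x
      have "cmod (cinner x (S y)) = cmod (cinner y (blinfun_apply T x))"
        using cinner_commute[of x "S y"] S[of y x] by (metis complex_mod_cnj)
      also have "\<dots> \<le> norm y * (norm T * norm x)"
        using cauchy_schwarz norm_blinfun by (meson mult_left_mono norm_ge_zero order_trans)
      finally show "cmod (cinner x (S y)) \<le> norm y * norm T * norm x" by (simp add: mult.assoc)
    qed simp
  qed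
  thus ?thesis using S by (intro exI[of _ "Blinfun S"]) (simp add: bounded_linear_Blinfun_apply)
qed

text \<open>The defining relation of \<open>adj\<close> has at most one solution, whatever
  \<open>T\<close> is, so exhibiting a solution settles the definite description. Complex linearity
  enters only through existence, by Riesz.\<close>

lemma adj_eqI:
  assumes "\<And>x y. cinner (blinfun_apply S y) x = cinner y (blinfun_apply T x)"
  shows "adj T = S"
  unfolding adj_def
proof (rule the_equality)
  show "\<forall>x y. cinner (blinfun_apply S y) x = cinner y (blinfun_apply T x)" using assms by blast
next
  fix R assume R: "\<forall>x y. cinner (blinfun_apply R y) x = cinner y (blinfun_apply T x)"
  show "R = S"
    by (rule blinfun_eqI, rule cinner_eq_left) (simp add: R assms)
qed

lemma cinner_adj_left: "T \<in> bop \<Longrightarrow> cinner (blinfun_apply (adj T) y) x = cinner y (blinfun_apply T x)"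
  using adj_exists[of T] adj_eqI by metis

lemma cinner_adj_right: "T \<in> bop \<Longrightarrow> cinner x (blinfun_apply (adj T) y) = cinner (blinfun_apply T x) y"
  using cinner_adj_left[of T y x] by (metis cinner_commute)

lemma adj_bop [intro]:
  assumes T: "T \<in> bop" shows "adj T \<in> bop"
proof -
  have "blinfun_apply (adj T) (c *\<^sub>C y) = c *\<^sub>C blinfun_apply (adj T) y" for c y
    by (rule cinner_eq_left) (simp add: cinner_adj_left[OF T] cinner_scaleC_left)
  thus ?thesis by (simp add: bop_def)
qed

lemma adj_adj: "T \<in> bop \<Longrightarrow> adj (adj T) = T"
  by (rule adj_eqI) (simp add: cinner_adj_right)

lemma adj_compose: "S \<in> bop \<Longrightarrow> T \<in> bop \<Longrightarrow> adj (S o\<^sub>L T) = adj T o\<^sub>L adj S"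
  by (rule adj_eqI) (simp add: cinner_adj_left)

lemma adj_add: "S \<in> bop \<Longrightarrow> T \<in> bop \<Longrightarrow> adj (S + T) = adj S + adj T"
  by (rule adj_eqI) (simp add: blinfun.add_left cinner_algebra cinner_adj_left)

lemma adj_diff: "S \<in> bop \<Longrightarrow> T \<in> bop \<Longrightarrow> adj (S - T) = adj S - adj T"
  by (rule adj_eqI) (simp add: blinfun.diff_left cinner_algebra cinner_adj_left)

lemma adj_scaleC: "T \<in> bop \<Longrightarrow> adj (c *\<^sub>C T) = cnj c *\<^sub>C adj T"
  by (rule adj_eqI) (simp add: scaleC_blinfun.rep_eq cinner_algebra cinner_adj_left)

lemma adj_scaleR: "T \<in> bop \<Longrightarrow> adj (r *\<^sub>R T) = r *\<^sub>R adj T"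
  by (simp add: scaleR_scaleC adj_scaleC)

lemma adj_zero [simp]: "adj 0 = 0" by (rule adj_eqI) simp

lemma adj_id [simp]: "adj id_blinfun = id_blinfun" by (rule adj_eqI) simp

lemma adj_sum: "(\<And>i. i \<in> I \<Longrightarrow> g i \<in> bop) \<Longrightarrow> adj (\<Sum>i\<in>I. g i) = (\<Sum>i\<in>I. adj (g i))"
  by (induction I rule: infinite_finite_induct) (auto simp: adj_add bop_sum)

lemma norm_adj_le: "T \<in> bop \<Longrightarrow> norm (adj T) \<le> norm T"
proof (rule norm_blinfun_bound)
  fix y assume T: "T \<in> bop"
  show "norm (blinfun_apply (adj T) y) \<le> norm T * norm y"
  proof (rule norm_le_cinnerI)
    fix x
    have "cmod (cinner x (blinfun_apply (adj T) y)) \<le> norm (blinfun_apply T x) * norm y"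
      unfolding cinner_adj_right[OF T] by (rule cauchy_schwarz)
    also have "\<dots> \<le> (norm T * norm x) * norm y"
      by (intro mult_right_mono norm_blinfun) simp
    finally show "cmod (cinner x (blinfun_apply (adj T) y)) \<le> norm T * norm y * norm x"
      by (simp add: mult_ac)
  qed simp
qed simp

lemma norm_adj: "T \<in> bop \<Longrightarrow> norm (adj T) = norm T"
  using norm_adj_le[of T] norm_adj_le[of "adj T"] by (metis adj_adj adj_bop order_antisym)

lemma tendsto_adj:
  assumes "(g \<longlongrightarrow> S) F" "\<And>x. g x \<in> bop" "S \<in> bop"
  shows "((\<lambda>x. adj (g x)) \<longlongrightarrow> adj S) F"
proof -
  have "((\<lambda>x. norm (g x - S)) \<longlongrightarrow> 0) F"
    using assms(1) tendsto_norm_zero LIM_zero by blast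
  moreover have "norm (adj (g x) - adj S) = norm (g x - S)" for x
    using assms(2,3) by (metis adj_diff norm_adj bop_diff)
  ultimately show ?thesis by (simp add: tendsto_iff dist_norm)
qed

lemma norm_le_cinnerI_op:
  fixes T :: "'a::real_normed_vector \<Rightarrow>\<^sub>L 'b::complex_hilbert"
  assumes "0 \<le> K" "\<And>u v. cmod (cinner u (blinfun_apply T v)) \<le> K * norm u * norm v"
  shows "norm T \<le> K"
  by (rule norm_blinfun_bound, rule assms(1), rule norm_le_cinnerI)
     (use assms in \<open>auto simp: mult_ac\<close>)

lemma blinfun_eq_cinnerI:
  fixes S T :: "'a::real_normed_vector \<Rightarrow>\<^sub>L 'b::complex_hilbert"
  assumes "\<And>u v. cinner u (blinfun_apply S v) = cinner u (blinfun_apply T v)"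
  shows "S = T"
  by (rule blinfun_eqI, rule cinner_eq_right) (rule assms)

lemma star_subalgebraD:
  assumes "star_subalgebra S"
  shows "S \<subseteq> bop" "cvec.subspace S" "\<And>x y. x \<in> S \<Longrightarrow> y \<in> S \<Longrightarrow> x o\<^sub>L y \<in> S"
    "\<And>x. x \<in> S \<Longrightarrow> adj x \<in> S"
  using assms by (auto simp: star_subalgebra_def)

lemma csubspace_scaleR: "cvec.subspace S \<Longrightarrow> x \<in> S \<Longrightarrow> r *\<^sub>R x \<in> S"
  by (simp add: scaleR_scaleC cvec.subspace_scale)

lemma csubspace_subspace: "cvec.subspace S \<Longrightarrow> subspace S"
  by (simp add: cvec.subspace_def subspace_def scaleR_scaleC)

section \<open>Square roots and contractivity of *-homomorphisms\<close>

text \<open>\<open>1 - b\<close> is a square root of \<open>1 - z\<close>; it is stated without the unit because \<open>M\<close> need not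
  contain it.\<close>

lemma exists_sqrt_one_minus:
  fixes M :: "('h::complex_hilbert \<Rightarrow>\<^sub>L 'h) set"
  assumes M: "star_subalgebra M" "closed M" and z: "z \<in> M" "adj z = z" "norm z < 1"
  shows "\<exists>b\<in>M. adj b = b \<and> 2 *\<^sub>R b = z + (b o\<^sub>L b)"
proof -
  note Mb = star_subalgebraD[OF M(1)]
  define r where "r = norm z"
  have r: "0 \<le> r" "r < 1" using z by (auto simp: r_def)
  \<comment> \<open>The equation for b is the fixed point equation of \<open>f\<close>. On the
    self-adjoint elements of \<open>M\<close> with norm at most r, \<open>f\<close> maps into the
    same set because |b|^2 \<le> r there, and its Lipschitz constant is r < 1.\<close>
  define C where "C = {b \<in> M. adj b = b \<and> norm b \<le> r}"
  define f where "f = (\<lambda>b. (1/2) *\<^sub>R (z + (b o\<^sub>L b)))"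
  have adjcont: "closed {b \<in> M. adj b = b}"
    unfolding closed_sequential_limits
  proof safe
    fix X l assume X: "\<forall>n. X n \<in> {b \<in> M. adj b = b}" and l: "X \<longlonglongrightarrow> l"
    show lM: "l \<in> M" using closed_sequentially[OF M(2), of X l] X l by blast
    have "(\<lambda>n. adj (X n)) \<longlonglongrightarrow> adj l"
      by (rule tendsto_adj[OF l]) (use X lM Mb(1) in auto)
    hence "X \<longlonglongrightarrow> adj l" using X by simp
    thus "adj l = l" using l LIMSEQ_unique by blast
  qed
  have "C = {b \<in> M. adj b = b} \<inter> cball 0 r" by (auto simp: C_def)
  hence "complete C" using adjcont by (simp add: complete_eq_closed closed_Int)
  moreover have "z \<in> C" using z by (simp add: C_def r_def)
  moreover have "f ` C \<subseteq> C"
  proof safe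
    fix b assume b: "b \<in> C"
    hence bM: "b \<in> M" "b \<in> bop" "z \<in> bop" "adj b = b" "norm b \<le> r" using Mb(1) z by (auto simp: C_def)
    have "f b \<in> M" unfolding f_def
      by (intro csubspace_scaleR Mb cvec.subspace_add z bM)
    moreover have "adj (f b) = f b"
      unfolding f_def using bM z by (simp add: adj_scaleR adj_add adj_compose bop_add bop_compose)
    moreover have "norm (f b) \<le> r"
    proof -
      have "norm (b o\<^sub>L b) \<le> norm b * norm b" by (rule norm_blinfun_compose)
      also have "\<dots> \<le> 1 * r" using bM r by (intro mult_mono) auto
      finally have "norm (z + (b o\<^sub>L b)) \<le> r + r"
        using norm_triangle_ineq[of z "b o\<^sub>L b"] by (simp add: r_def)
      thus ?thesis by (simp add: f_def)
    qed
    ultimately show "f b \<in> C" by (simp add: C_def)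
  qed
  moreover have "dist (f b) (f b') \<le> r * dist b b'" if "b \<in> C" "b' \<in> C" for b b'
  proof -
    have "f b - f b' = (1/2) *\<^sub>R ((b o\<^sub>L (b - b')) + ((b - b') o\<^sub>L b'))"
      by (rule blinfun_eqI)
         (simp add: f_def blinfun.scaleR_left blinfun.add_left blinfun.diff_left blinfun.diff_right
           algebra_simps)
    hence "dist (f b) (f b') = (1/2) * norm ((b o\<^sub>L (b - b')) + ((b - b') o\<^sub>L b'))"
      by (simp add: dist_norm)
    also have "\<dots> \<le> (1/2) * (norm b * norm (b - b') + norm (b - b') * norm b')"
      by (intro mult_left_mono norm_triangle_mono norm_blinfun_compose) auto
    also have "\<dots> \<le> (1/2) * (r * norm (b - b') + norm (b - b') * r)"
      using that by (intro mult_left_mono add_mono mult_right_mono) (auto simp: C_def)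
    finally show ?thesis by (simp add: dist_norm)
  qed
  ultimately have "\<exists>!b. b \<in> C \<and> f b = b"
    using r by (intro Banach_fix[where c = r]) auto
  then obtain b where b: "b \<in> C" "f b = b" by blast
  have "2 *\<^sub>R b = 2 *\<^sub>R f b" using b by simp
  thus ?thesis using b by (auto simp: C_def f_def)
qed

section \<open>Contractivity of unital *-homomorphisms\<close>

locale operator_hom =
  fixes A :: "('h::complex_hilbert \<Rightarrow>\<^sub>L 'h) set" and \<pi> :: "('h \<Rightarrow>\<^sub>L 'h) \<Rightarrow> ('g::complex_hilbert \<Rightarrow>\<^sub>L 'g)"
  assumes A: "unital_cstar_of_operators A"
    and hom: "unital_star_hom (op_cstar A) (op_cstar bop) \<pi>"
begin

lemma A_alg: "star_subalgebra A" and A_id: "id_blinfun \<in> A" and A_closed: "closed A"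
  using A by (auto simp: unital_cstar_of_operators_def)

lemma hom_bop: "x \<in> A \<Longrightarrow> \<pi> x \<in> bop"
  and hom_add: "x \<in> A \<Longrightarrow> y \<in> A \<Longrightarrow> \<pi> (x + y) = \<pi> x + \<pi> y"
  and hom_mult: "x \<in> A \<Longrightarrow> y \<in> A \<Longrightarrow> \<pi> (x o\<^sub>L y) = \<pi> x o\<^sub>L \<pi> y"
  and hom_scale: "x \<in> A \<Longrightarrow> \<pi> (c *\<^sub>C x) = c *\<^sub>C \<pi> x"
  and hom_adj: "x \<in> A \<Longrightarrow> \<pi> (adj x) = adj (\<pi> x)"
  and hom_id: "\<pi> id_blinfun = id_blinfun"
  using hom by (auto simp: unital_star_hom_def star_hom_def op_cstar_def)

lemma hom_scaleR: "x \<in> A \<Longrightarrow> \<pi> (r *\<^sub>R x) = r *\<^sub>R \<pi> x"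
  by (simp add: scaleR_scaleC hom_scale)

lemma hom_diff: "x \<in> A \<Longrightarrow> y \<in> A \<Longrightarrow> \<pi> (x - y) = \<pi> x - \<pi> y"
  using hom_add[of x "(-1) *\<^sub>R y"] hom_scaleR[of y "-1"]
    csubspace_scaleR[OF star_subalgebraD(2)[OF A_alg], of y "-1"] by simp

text \<open>For \<open>norm x < 1\<close> the element 1 - z, where z is the adjoint of x times x, is
  the square of a self-adjoint y in \<open>A\<close>. Applying \<open>\<pi>\<close> gives
  |\<pi>(y)u|^2 = |u|^2 - |\<pi>(x)u|^2, hence |\<pi>(x)u| \<le> |u|. The general case follows by
  scaling.\<close>

lemma hom_contractive:
  assumes x: "x \<in> A" shows "norm (\<pi> x) \<le> norm x"
proof -
  note S = star_subalgebraD[OF A_alg]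
  have unit: "norm (blinfun_apply (\<pi> x) u) \<le> norm u" if x: "x \<in> A" and nx: "norm x < 1" for x u
  proof -
    have xb: "x \<in> bop" "adj x \<in> bop" using S x by auto
    define z where "z = adj x o\<^sub>L x"
    have zA: "z \<in> A" using S x by (auto simp: z_def)
    have zsa: "adj z = z" using xb by (simp add: z_def adj_compose adj_adj)
    have "norm z \<le> norm x * norm x"
      unfolding z_def using norm_blinfun_compose[of "adj x" x] by (simp add: norm_adj xb)
    also have "\<dots> < 1 * 1" using nx by (intro mult_strict_mono') auto
    finally obtain b where b: "b \<in> A" "adj b = b" "2 *\<^sub>R b = z + (b o\<^sub>L b)"
      using exists_sqrt_one_minus[OF A_alg A_closed zA zsa] by auto
    define y where "y = id_blinfun - b"
    have yA: "y \<in> A" unfolding y_def by (intro cvec.subspace_diff S A_id b)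
    have ysa: "adj y = y" using b S by (auto simp: y_def adj_diff)
    have "y o\<^sub>L y = id_blinfun - z"
    proof (rule blinfun_eqI)
      fix v
      have "2 *\<^sub>R blinfun_apply b v = blinfun_apply z v + blinfun_apply b (blinfun_apply b v)"
        using arg_cong[OF b(3), of "\<lambda>T. blinfun_apply T v"]
        by (simp add: blinfun.scaleR_left blinfun.add_left)
      thus "blinfun_apply (y o\<^sub>L y) v = blinfun_apply (id_blinfun - z) v"
        by (simp add: y_def blinfun.diff_left blinfun.diff_right scaleR_2 algebra_simps)
    qed
    hence "\<pi> y o\<^sub>L \<pi> y = id_blinfun - \<pi> z"
      using hom_mult[OF yA yA] hom_diff[OF A_id zA] by (simp add: hom_id)
    moreover have "\<pi> z = adj (\<pi> x) o\<^sub>L \<pi> x"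
      using x S by (simp add: z_def hom_mult hom_adj)
    moreover have "adj (\<pi> y) = \<pi> y" using hom_adj[OF yA] ysa by simp
    ultimately have "(adj (\<pi> y) o\<^sub>L \<pi> y) = id_blinfun - (adj (\<pi> x) o\<^sub>L \<pi> x)" by simp
    hence "cinner u (blinfun_apply (adj (\<pi> y) o\<^sub>L \<pi> y) u) = cinner u (blinfun_apply (id_blinfun - (adj (\<pi> x) o\<^sub>L \<pi> x)) u)"
      by simp
    hence "(norm (blinfun_apply (\<pi> y) u))\<^sup>2 = (norm u)\<^sup>2 - (norm (blinfun_apply (\<pi> x) u))\<^sup>2"
      using hom_bop[OF x] hom_bop[OF yA]
      by (simp add: blinfun.diff_left cinner_diff_right cinner_adj_right cinner_self
          flip: of_real_power of_real_diff)
    hence "(norm (blinfun_apply (\<pi> x) u))\<^sup>2 \<le> (norm u)\<^sup>2"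
      by (metis diff_ge_0_iff_ge zero_le_power2)
    thus ?thesis by (simp add: abs_le_square_iff)
  qed
  show ?thesis
  proof (rule field_le_epsilon)
    fix e :: real assume e: "e > 0"
    \<comment> \<open>The extra e keeps x/c strictly inside the unit ball, also when x = 0.\<close>
    define c where "c = norm x + e"
    have c: "c > 0" using e by (simp add: c_def add_nonneg_pos)
    have "norm (blinfun_apply (\<pi> x) u) \<le> c * norm u" for u
    proof -
      have "norm (inverse c *\<^sub>R x) < 1" using c e by (simp add: c_def field_simps)
      from unit[OF _ this, of u] have "norm (inverse c *\<^sub>R blinfun_apply (\<pi> x) u) \<le> norm u"
        using x S by (simp add: csubspace_scaleR hom_scaleR blinfun.scaleR_left)
      thus ?thesis using c by (simp add: field_simps)
    qed
    thus "norm (\<pi> x) \<le> norm x + e" using c unfolding c_def by (intro norm_blinfun_bound) auto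
  qed
qed

end


section \<open>Tensor products of operators\<close>

text \<open>Prescribing values on a family that is total but in general linearly dependent. Lists of
  coefficients and indices name the elements of the span redundantly; since the bound holds for all
  lists, it applies to differences and shows that the prescription is consistent.\<close>

lemma bounded_operator_extension:
  fixes G :: "'i \<Rightarrow> 'a::complex_hilbert" and G' :: "'i \<Rightarrow> 'b::complex_hilbert"
  assumes dense: "closure (cvec.span (range G)) = UNIV"
    and bound: "\<And>L. norm (\<Sum>(c, i)\<leftarrow>L. c *\<^sub>C G' i) \<le> K * norm (\<Sum>(c, i)\<leftarrow>L. c *\<^sub>C G i)"
  shows "\<exists>S\<in>bop. \<forall>i. blinfun_apply S (G i) = G' i"
proof -
  define g where "g L = (\<Sum>(c, i)\<leftarrow>L. c *\<^sub>C G i)" for L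
  define g' where "g' L = (\<Sum>(c, i)\<leftarrow>L. c *\<^sub>C G' i)" for L
  define sc where "sc c L = map (\<lambda>(d, i). (c * d, i)) L" for c and L :: "(complex \<times> 'i) list"
  have g_app: "g (L @ L') = g L + g L'" "g' (L @ L') = g' L + g' L'" for L L'
    by (simp_all add: g_def g'_def)
  have g_sc: "g (sc c L) = c *\<^sub>C g L" "g' (sc c L) = c *\<^sub>C g' L" for c L
    by (induction L) (auto simp: g_def g'_def sc_def scaleC_add_right scaleC_scaleC)
  have gb: "norm (g' L) \<le> K * norm (g L)" for L
    using bound by (simp add: g_def g'_def)
  have span_g: "x \<in> range g" if "x \<in> cvec.span (range G)" for x
    using that
  proof (induction rule: cvec.span_induct_alt)
    case base
    have "g [] = 0" by (simp add: g_def)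
    thus ?case by (metis rangeI)
  next
    case (step c x y)
    then obtain i L where "x = G i" "y = g L" by auto
    hence "c *\<^sub>C x + y = g ((c, i) # L)" by (simp add: g_def)
    thus ?case by simp
  qed
  \<comment> \<open>\<open>P\<close> is the closure of the graph of the map on the span. The bound
    makes it single-valued, and density together with completeness of the target makes it everywhere
    defined.\<close>
  define P where "P x y \<longleftrightarrow> (\<exists>L. (\<lambda>n. g (L n)) \<longlonglongrightarrow> x \<and> (\<lambda>n. g' (L n)) \<longlonglongrightarrow> y)" for x y
  have P_add: "P (x + x') (y + y')" if xy: "P x y" "P x' y'" for x x' y y'
  proof -
    obtain L L' where "(\<lambda>n. g (L n)) \<longlonglongrightarrow> x" "(\<lambda>n. g' (L n)) \<longlonglongrightarrow> y"
      "(\<lambda>n. g (L' n)) \<longlonglongrightarrow> x'" "(\<lambda>n. g' (L' n)) \<longlonglongrightarrow> y'" using xy by (auto simp: P_def)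
    hence "(\<lambda>n. g (L n @ L' n)) \<longlonglongrightarrow> x + x'" "(\<lambda>n. g' (L n @ L' n)) \<longlonglongrightarrow> y + y'"
      unfolding g_app by (auto intro: tendsto_add)
    thus ?thesis unfolding P_def by (intro exI[of _ "\<lambda>n. L n @ L' n"]) simp
  qed
  have P_sc: "P (c *\<^sub>C x) (c *\<^sub>C y)" if xy: "P x y" for c x y
  proof -
    obtain L where "(\<lambda>n. g (L n)) \<longlonglongrightarrow> x" "(\<lambda>n. g' (L n)) \<longlonglongrightarrow> y" using xy by (auto simp: P_def)
    hence "(\<lambda>n. g (sc c (L n))) \<longlonglongrightarrow> c *\<^sub>C x" "(\<lambda>n. g' (sc c (L n))) \<longlonglongrightarrow> c *\<^sub>C y"
      unfolding g_sc by (auto intro: bounded_linear.tendsto[OF bounded_linear_scaleC_hilbert])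
    thus ?thesis unfolding P_def by (intro exI[of _ "\<lambda>n. sc c (L n)"]) simp
  qed
  have P_bound: "norm y \<le> K * norm x" if xy: "P x y" for x y
  proof -
    obtain L where "(\<lambda>n. g (L n)) \<longlonglongrightarrow> x" "(\<lambda>n. g' (L n)) \<longlonglongrightarrow> y" using xy by (auto simp: P_def)
    hence "(\<lambda>n. norm (g' (L n))) \<longlonglongrightarrow> norm y" "(\<lambda>n. K * norm (g (L n))) \<longlonglongrightarrow> K * norm x"
      by (auto intro!: tendsto_intros)
    thus ?thesis by (rule LIMSEQ_le) (use gb in auto)
  qed
  have P_uniq: "y = y'" if "P x y" "P x y'" for x y y'
  proof -
    have "P (x + (-1) *\<^sub>C x) (y + (-1) *\<^sub>C y')" by (intro P_add P_sc that)
    from P_bound[OF this] show ?thesis by simp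
  qed
  have P_ex: "\<exists>y. P x y" for x
  proof -
    have "x \<in> closure (cvec.span (range G))" using dense by simp
    then obtain X where X: "\<And>n. X n \<in> cvec.span (range G)" "X \<longlonglongrightarrow> x"
      unfolding closure_sequential by blast
    have "\<forall>n. \<exists>L. X n = g L" using span_g X(1) by blast
    then obtain L where "\<And>n. X n = g (L n)" by metis
    hence L: "X = (\<lambda>n. g (L n))" by auto
    have "Cauchy (\<lambda>n. g (L n))" using X(2) L LIMSEQ_imp_Cauchy by blast
    have d: "norm (g' (L m) - g' (L n)) \<le> K * norm (g (L m) - g (L n))" for m n
      using gb[of "L m @ sc (-1) (L n)"] by (simp add: g_app g_sc)
    have "Cauchy (\<lambda>n. g' (L n))"
    proof (rule metric_CauchyI)
      fix e :: real assume e: "e > 0"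
      obtain M where M: "\<And>m n. m \<ge> M \<Longrightarrow> n \<ge> M \<Longrightarrow> dist (g (L m)) (g (L n)) < e / (\<bar>K\<bar> + 1)"
        using \<open>Cauchy (\<lambda>n. g (L n))\<close> e metric_CauchyD[of "\<lambda>n. g (L n)" "e / (\<bar>K\<bar> + 1)"] by auto
      have "dist (g' (L m)) (g' (L n)) < e" if "m \<ge> M" "n \<ge> M" for m n
      proof -
        have "dist (g' (L m)) (g' (L n)) \<le> (\<bar>K\<bar> + 1) * dist (g (L m)) (g (L n))"
          using d[of m n] unfolding dist_norm
          by (rule order_trans) (intro mult_right_mono, auto)
        also have "\<dots> < e" using M[OF that] by (simp add: field_simps)
        finally show ?thesis .
      qed
      thus "\<exists>M. \<forall>m\<ge>M. \<forall>n\<ge>M. dist (g' (L m)) (g' (L n)) < e" by blast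
    qed
    then obtain y where "(\<lambda>n. g' (L n)) \<longlonglongrightarrow> y" using Cauchy_convergent_iff convergent_def by blast
    thus ?thesis using X(2) L by (auto simp: P_def)
  qed
  then obtain S where S: "\<And>x. P x (S x)" by metis
  have S_eq: "P x y \<Longrightarrow> S x = y" for x y using S P_uniq by blast
  have lin: "bounded_linear S"
  proof (rule bounded_linear_intro[where K = K])
    show "S (x + y) = S x + S y" for x y by (intro S_eq P_add S)
    show "S (r *\<^sub>R x) = r *\<^sub>R S x" for r x unfolding scaleR_scaleC by (intro S_eq P_sc S)
    show "norm (S x) \<le> norm x * K" for x using P_bound[OF S] by (simp add: mult.commute)
  qed
  have "S (c *\<^sub>C x) = c *\<^sub>C S x" for c x by (intro S_eq P_sc S)
  hence "Blinfun S \<in> bop" using lin by (simp add: bop_def bounded_linear_Blinfun_apply)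
  moreover have "S (G i) = G' i" for i
    by (rule S_eq, unfold P_def, rule exI[of _ "\<lambda>_. [(1, i)]"]) (simp add: g_def g'_def scaleC_one)
  ultimately show ?thesis using lin by (intro bexI[of _ "Blinfun S"]) (auto simp: bounded_linear_Blinfun_apply)
qed

lemma bilinear_isometricD:
  assumes "bilinear_isometric tens"
  shows "tens (x + x') y = tens x y + tens x' y" "tens x (y + y') = tens x y + tens x y'"
    "tens (c *\<^sub>C x) y = c *\<^sub>C tens x y" "tens x (c *\<^sub>C y) = c *\<^sub>C tens x y"
    "cinner (tens x y) (tens x' y') = cinner x x' * cinner y y'"
  using assms by (auto simp: bilinear_isometric_def clinear_on_def)

lemma bilinear_isometric_flip:
  "bilinear_isometric tens \<Longrightarrow> bilinear_isometric (\<lambda>y x. tens x y)"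
  by (auto simp: bilinear_isometric_def)

lemma bilinear_isometric_norm:
  assumes "bilinear_isometric tens" shows "norm (tens x y) = norm x * norm y"
proof -
  have "complex_of_real ((norm (tens x y))\<^sup>2) = of_real ((norm x * norm y)\<^sup>2)"
    unfolding cinner_self[symmetric] bilinear_isometricD(5)[OF assms] by (simp add: cinner_self power_mult_distrib)
  hence "(norm (tens x y))\<^sup>2 = (norm x * norm y)\<^sup>2" unfolding of_real_eq_iff .
  thus ?thesis by (simp add: power2_eq_iff_nonneg)
qed

lemma bilinear_isometric_zero:
  assumes "bilinear_isometric tens" shows "tens 0 y = 0" "tens x 0 = 0"
  using bilinear_isometric_norm[OF assms, of 0 y] bilinear_isometric_norm[OF assms, of x 0] by auto

text \<open>Gram-Schmidt in the second factor only. The new decomposition is chosen before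
  \<open>T\<close>, so one orthonormal family computes the norms of the sum both with and without
  \<open>T\<close> applied to the first factors.\<close>

lemma tensor_orthonormalize:
  fixes tens :: "'a::complex_hilbert \<Rightarrow> 'b::complex_hilbert \<Rightarrow> 'c::complex_hilbert"
  assumes t: "bilinear_isometric tens"
  shows "\<exists>(n::nat) z e. (\<forall>i<n. \<forall>j<n. cinner (e i) (e j) = (if i = j then 1 else 0)) \<and>
    (\<forall>T::'a \<Rightarrow> 'a. clinear_on UNIV T \<longrightarrow> (\<Sum>(x, y)\<leftarrow>L. tens (T x) y) = (\<Sum>j<n. tens (T (z j)) (e j)))"
proof (induction L)
  case Nil
  show ?case by (intro exI[of _ 0]) simp
next
  case (Cons p L)
  obtain x y where p: "p = (x, y)" by fastforce
  obtain n and z :: "nat \<Rightarrow> 'a" and e :: "nat \<Rightarrow> 'b" where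
    on: "\<And>i j. i < n \<Longrightarrow> j < n \<Longrightarrow> cinner (e i) (e j) = (if i = j then 1 else 0)" and
    eq: "\<And>T::'a \<Rightarrow> 'a. clinear_on UNIV T \<Longrightarrow> (\<Sum>(x, y)\<leftarrow>L. tens (T x) y) = (\<Sum>j<n. tens (T (z j)) (e j))"
    using Cons by metis
  note t' = bilinear_isometricD[OF t]
  have tsum: "tens w (\<Sum>j\<in>J. k j) = (\<Sum>j\<in>J. tens w (k j))" for w k and J :: "nat set"
    by (induction J rule: infinite_finite_induct) (auto simp: t' bilinear_isometric_zero[OF t])
  define c where "c j = cinner (e j) y" for j
  define r where "r = y - (\<Sum>j<n. c j *\<^sub>C e j)"
  have er: "cinner (e i) r = 0" if "i < n" for i
  proof -
    have "cinner (e i) (\<Sum>j<n. c j *\<^sub>C e j) = (\<Sum>j<n. if i = j then c j else 0)"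
      unfolding cinner_sum_right by (intro sum.cong) (use that on in \<open>auto simp: cinner_scaleC_right\<close>)
    thus ?thesis using that by (simp add: r_def cinner_diff_right c_def)
  qed
  have re: "cinner r (e i) = 0" if "i < n" for i
    using er[OF that] cinner_commute[of r "e i"] by simp
  \<comment> \<open>The component of y along each old \<open>e j\<close> is absorbed into
    \<open>z j\<close>. The remainder r, if nonzero, becomes a new unit vector, and its length is
    moved to the first factor.\<close>
  define z' where "z' j = (if j < n then z j + c j *\<^sub>C x else norm r *\<^sub>R x)" for j
  define e' where "e' j = (if j < n then e j else inverse (norm r) *\<^sub>R r)" for j
  have eq': "(\<Sum>(x, y)\<leftarrow>p # L. tens (T x) y) = (\<Sum>j<n. tens (T (z' j)) (e' j)) + tens (T x) r"
    if T: "clinear_on UNIV T" for T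
  proof -
    have "(\<Sum>j<n. tens (T (z' j)) (e' j)) = (\<Sum>j<n. tens (T (z j)) (e j) + tens (T x) (c j *\<^sub>C e j))"
      using T by (intro sum.cong) (auto simp: z'_def e'_def clinear_on_def t')
    also have "\<dots> = (\<Sum>(x, y)\<leftarrow>L. tens (T x) y) + tens (T x) (y - r)"
      by (simp add: sum.distrib eq[OF T] r_def tsum)
    finally show ?thesis using t'(2)[of "T x" "y - r" r] by (simp add: p)
  qed
  show ?case
  proof (cases "r = 0")
    case True
    show ?thesis
      by (intro exI[of _ n] exI[of _ z'] exI[of _ e'])
         (use eq' True on in \<open>auto simp: e'_def bilinear_isometric_zero[OF t]\<close>)
  next
    case False
    have rr: "cinner (e' n) (e' n) = 1"
      using False by (simp add: e'_def cinner_scaleR_left cinner_scaleR_right cinner_self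
          power2_eq_square flip: of_real_mult)
    have "(\<Sum>(x, y)\<leftarrow>p # L. tens (T x) y) = (\<Sum>j<Suc n. tens (T (z' j)) (e' j))"
      if T: "clinear_on UNIV T" for T
    proof -
      have "T (norm r *\<^sub>R x) = complex_of_real (norm r) *\<^sub>C T x"
        using T by (simp add: clinear_on_def scaleR_scaleC)
      thus ?thesis using eq'[OF T] False
        by (simp add: z'_def e'_def scaleR_scaleC t' scaleC_scaleC scaleC_one flip: of_real_mult)
    qed
    moreover have "cinner (e' i) (e' j) = (if i = j then 1 else 0)" if "i < Suc n" "j < Suc n" for i j
    proof (cases "i = n \<and> j = n")
      case True thus ?thesis using rr by simp
    next
      case F: False
      thus ?thesis using that on er re
        by (auto simp: e'_def cinner_scaleR_left cinner_scaleR_right less_Suc_eq)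
    qed
    ultimately show ?thesis by blast
  qed
qed

lemma tensor_left_bound:
  fixes tens :: "'a::complex_hilbert \<Rightarrow> 'b::complex_hilbert \<Rightarrow> 'c::complex_hilbert"
  assumes t: "bilinear_isometric tens" and T: "T \<in> bop"
  shows "norm (\<Sum>(x, y)\<leftarrow>L. tens (blinfun_apply T x) y) \<le> norm T * norm (\<Sum>(x, y)\<leftarrow>L. tens x y)"
proof -
  obtain n and z :: "nat \<Rightarrow> 'a" and e :: "nat \<Rightarrow> 'b" where
    "\<forall>i<n. \<forall>j<n. cinner (e i) (e j) = (if i = j then 1 else 0)"
    "\<forall>T::'a \<Rightarrow> 'a. clinear_on UNIV T \<longrightarrow> (\<Sum>(x, y)\<leftarrow>L. tens (T x) y) = (\<Sum>j<n. tens (T (z j)) (e j))"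
    using tensor_orthonormalize[OF t, of L] by (elim exE conjE)
  hence on: "\<And>i j. i < n \<Longrightarrow> j < n \<Longrightarrow> cinner (e i) (e j) = (if i = j then 1 else 0)" and
    eq: "\<And>T::'a \<Rightarrow> 'a. clinear_on UNIV T \<Longrightarrow> (\<Sum>(x, y)\<leftarrow>L. tens (T x) y) = (\<Sum>j<n. tens (T (z j)) (e j))"
    by blast+
  have sq: "(norm (\<Sum>j<n. tens (w j) (e j)))\<^sup>2 = (\<Sum>j<n. (norm (w j))\<^sup>2)" for w
  proof -
    have "cinner (\<Sum>j<n. tens (w j) (e j)) (\<Sum>j<n. tens (w j) (e j)) =
        (\<Sum>i<n. \<Sum>j<n. if i = j then cinner (w j) (w j) else 0)"
      unfolding cinner_sum_left cinner_sum_right bilinear_isometricD[OF t]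
      by (intro sum.cong refl) (auto simp: on)
    also have "\<dots> = of_real (\<Sum>j<n. (norm (w j))\<^sup>2)" by (simp add: cinner_self)
    finally show ?thesis unfolding cinner_self of_real_eq_iff .
  qed
  have lin: "clinear_on UNIV (blinfun_apply T)" "clinear_on UNIV (\<lambda>x::'a. x)"
    using T by (auto simp: clinear_on_def blinfun.add_right bop_scaleC)
  have "(norm (\<Sum>j<n. tens (blinfun_apply T (z j)) (e j)))\<^sup>2 \<le> (\<Sum>j<n. (norm T * norm (z j))\<^sup>2)"
    unfolding sq by (intro sum_mono power_mono norm_blinfun) auto
  also have "\<dots> = (norm T * norm (\<Sum>j<n. tens (z j) (e j)))\<^sup>2"
    by (simp add: power_mult_distrib sum_distrib_left sq)
  finally have "norm (\<Sum>j<n. tens (blinfun_apply T (z j)) (e j)) \<le> norm T * norm (\<Sum>j<n. tens (z j) (e j))"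
    by (rule power2_le_imp_le) simp
  thus ?thesis using eq[OF lin(1)] eq[OF lin(2)] by simp
qed

text \<open>T \<otimes> b is the product of T \<otimes> 1 and 1 \<otimes> b; the second factor is
  bounded like the first after exchanging the roles of the two spaces.\<close>

lemma tensor_both_bound:
  fixes tens :: "'a::complex_hilbert \<Rightarrow> 'b::complex_hilbert \<Rightarrow> 'c::complex_hilbert"
  assumes t: "bilinear_isometric tens" and T: "T \<in> bop" "b \<in> bop"
  shows "norm (\<Sum>(x, y)\<leftarrow>L. tens (blinfun_apply T x) (blinfun_apply b y)) \<le>
    norm T * norm b * norm (\<Sum>(x, y)\<leftarrow>L. tens x y)"
proof -
  have flip: "(\<Sum>(y, x)\<leftarrow>map prod.swap L. h y x) = (\<Sum>(x, y)\<leftarrow>L. h y x)" for h :: "'b \<Rightarrow> 'a \<Rightarrow> 'c"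
    by (induction L) auto
  have "norm (\<Sum>(x, y)\<leftarrow>map (\<lambda>(x, y). (x, blinfun_apply b y)) L. tens (blinfun_apply T x) y) \<le>
    norm T * norm (\<Sum>(x, y)\<leftarrow>map (\<lambda>(x, y). (x, blinfun_apply b y)) L. tens x y)"
    by (rule tensor_left_bound[OF t T(1)])
  also have "(\<Sum>(x, y)\<leftarrow>map (\<lambda>(x, y). (x, blinfun_apply b y)) L. tens x y) =
     (\<Sum>(x, y)\<leftarrow>L. tens x (blinfun_apply b y))"
    by (induction L) auto
  also have "norm \<dots> \<le> norm b * norm (\<Sum>(x, y)\<leftarrow>L. tens x y)"
    using tensor_left_bound[OF bilinear_isometric_flip[OF t] T(2), of "map prod.swap L"]
    unfolding flip .
  also have "(\<Sum>(x, y)\<leftarrow>map (\<lambda>(x, y). (x, blinfun_apply b y)) L. tens (blinfun_apply T x) y) =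
     (\<Sum>(x, y)\<leftarrow>L. tens (blinfun_apply T x) (blinfun_apply b y))"
    by (induction L) auto
  finally show ?thesis by (simp add: mult_left_mono mult.assoc)
qed

section \<open>The tower of tensor powers\<close>

locale tower =
  fixes emb :: "'h::complex_hilbert \<Rightarrow> 'p::complex_hilbert"
    and app :: "'p \<Rightarrow> 'q::complex_hilbert \<Rightarrow> 'p"
  assumes tower: "tensor_tower emb app"
begin

lemma app_isometric: "bilinear_isometric app"
  using tower by (simp add: tensor_tower_def)

lemma emb_add: "emb (u + v) = emb u + emb v" and emb_scale: "emb (c *\<^sub>C u) = c *\<^sub>C emb u"
  and emb_inner: "cinner (emb u) (emb v) = cinner u v"
  and emb_app: "cinner (emb u) (app \<zeta> \<xi>) = 0"
  using tower by (auto simp: tensor_tower_def clinear_on_def)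

lemma app_emb: "cinner (app \<zeta> \<xi>) (emb u) = 0"
  using emb_app[of u \<zeta> \<xi>] cinner_commute[of "app \<zeta> \<xi>" "emb u"] by simp

lemmas app_algebra = bilinear_isometricD[OF app_isometric]
lemmas app_zero [simp] = bilinear_isometric_zero[OF app_isometric]
lemmas norm_app = bilinear_isometric_norm[OF app_isometric]

lemma emb_zero [simp]: "emb 0 = 0"
  using emb_scale[of 0 0] by simp

lemma norm_emb: "norm (emb u) = norm u"
  by (simp add: norm_eq_sqrt_cinner emb_inner)

text \<open>A nonempty word is \<open>app\<close> of a shorter one. Hence the tower is the direct
  sum of h and a copy of its own tensor product with K, and an operator is determined by what it
  does on these two pieces.\<close>

lemma tower_dense: "closure (cvec.span (range emb \<union> {app \<zeta> \<xi> | \<zeta> \<xi>. True})) = UNIV"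
proof -
  have "tensor_word emb app u \<xi>s \<in> range emb \<union> {app \<zeta> \<xi> | \<zeta> \<xi>. True}" for u \<xi>s
    by (cases \<xi>s rule: rev_cases) (auto simp: tensor_word_def)
  hence "closure (cvec.span {tensor_word emb app u \<xi>s | u \<xi>s. True}) \<subseteq>
     closure (cvec.span (range emb \<union> {app \<zeta> \<xi> | \<zeta> \<xi>. True}))"
    by (intro closure_mono cvec.span_mono) auto
  thus ?thesis using tower by (auto simp: tensor_tower_def)
qed

lemma tower_bop_eqI:
  fixes S T :: "'p \<Rightarrow>\<^sub>L 'b::complex_hilbert"
  assumes "S \<in> bop" "T \<in> bop" "\<And>u. blinfun_apply S (emb u) = blinfun_apply T (emb u)"
    "\<And>\<zeta> \<xi>. blinfun_apply S (app \<zeta> \<xi>) = blinfun_apply T (app \<zeta> \<xi>)"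
  shows "S = T"
proof -
  have "cvec.span (range emb \<union> {app \<zeta> \<xi> | \<zeta> \<xi>. True}) \<subseteq> {x. blinfun_apply S x = blinfun_apply T x}"
    using assms
    by (intro cvec.span_minimal) (auto simp: cvec.subspace_def blinfun.add_right bop_scaleC)
  moreover have "closed {x. blinfun_apply S x = blinfun_apply T x}"
    by (intro closed_Collect_eq continuous_intros)
  ultimately have "{x. blinfun_apply S x = blinfun_apply T x} = UNIV"
    using closure_minimal tower_dense by blast
  thus ?thesis by (intro blinfun_eqI) blast
qed

lemma tower_vec_eqI:
  assumes "\<And>u. cinner (emb u) x = cinner (emb u) y" "\<And>\<zeta> \<xi>. cinner (app \<zeta> \<xi>) x = cinner (app \<zeta> \<xi>) y"
  shows "x = y"
proof -
  have "cvec.span (range emb \<union> {app \<zeta> \<xi> | \<zeta> \<xi>. True}) \<subseteq> {z. cinner z x = cinner z y}"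
    using assms
    by (intro cvec.span_minimal) (auto simp: cvec.subspace_def cinner_algebra)
  moreover have "closed {z. cinner z x = cinner z y}"
    by (intro closed_Collect_eq bounded_bilinear.continuous_on[OF bounded_bilinear_cinner] continuous_intros)
  ultimately have "{z. cinner z x = cinner z y} = UNIV"
    using closure_minimal tower_dense by blast
  thus ?thesis by (rule_tac cinner_eq_right) blast
qed

text \<open>This is the direct sum of a and T \<otimes> b with respect to that decomposition of the
  tower. Setting one of the two summands to zero yields \<open>op_tensor\<close> or
  \<open>level0\<close>.\<close>

lemma tower_op_exists:
  assumes a: "a \<in> bop" and T: "T \<in> bop" and b: "b \<in> bop"
  shows "\<exists>S\<in>bop. (\<forall>u. blinfun_apply S (emb u) = emb (blinfun_apply a u)) \<and>
    (\<forall>\<zeta> \<xi>. blinfun_apply S (app \<zeta> \<xi>) = app (blinfun_apply T \<zeta>) (blinfun_apply b \<xi>))"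
proof -
  define G where "G i = (case i of Inl u \<Rightarrow> emb u | Inr (\<zeta>, \<xi>) \<Rightarrow> app \<zeta> \<xi>)" for i
  define G' where "G' i = (case i of Inl u \<Rightarrow> emb (blinfun_apply a u)
      | Inr (\<zeta>, \<xi>) \<Rightarrow> app (blinfun_apply T \<zeta>) (blinfun_apply b \<xi>))" for i
  have "range G = range emb \<union> {app \<zeta> \<xi> | \<zeta> \<xi>. True}"
  proof
    show "range G \<subseteq> range emb \<union> {app \<zeta> \<xi> | \<zeta> \<xi>. True}"
    proof (rule image_subsetI)
      show "G i \<in> range emb \<union> {app \<zeta> \<xi> | \<zeta> \<xi>. True}" for i
        by (cases i) (auto simp: G_def split: prod.splits)
    qed
    have "emb u = G (Inl u)" "app \<zeta> \<xi> = G (Inr (\<zeta>, \<xi>))" for u \<zeta> \<xi> by (auto simp: G_def)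
    thus "range emb \<union> {app \<zeta> \<xi> | \<zeta> \<xi>. True} \<subseteq> range G" by auto
  qed
  hence dense: "closure (cvec.span (range G)) = UNIV" using tower_dense by simp
  have "norm (\<Sum>(c, i)\<leftarrow>L. c *\<^sub>C G' i) \<le> (norm a + norm T * norm b) * norm (\<Sum>(c, i)\<leftarrow>L. c *\<^sub>C G i)" for L
  proof -
    have "\<exists>u M. (\<Sum>(c, i)\<leftarrow>L. c *\<^sub>C G i) = emb u + (\<Sum>(x, y)\<leftarrow>M. app x y) \<and>
       (\<Sum>(c, i)\<leftarrow>L. c *\<^sub>C G' i) = emb (blinfun_apply a u) +
          (\<Sum>(x, y)\<leftarrow>M. app (blinfun_apply T x) (blinfun_apply b y))"
    proof (induction L)
      case Nil
      show ?case by (intro exI[of _ 0] exI[of _ "[]"]) simp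
    next
      case (Cons q L)
      obtain c i where q: "q = (c, i)" by fastforce
      obtain u M where uM: "(\<Sum>(c, i)\<leftarrow>L. c *\<^sub>C G i) = emb u + (\<Sum>(x, y)\<leftarrow>M. app x y)"
       "(\<Sum>(c, i)\<leftarrow>L. c *\<^sub>C G' i) = emb (blinfun_apply a u) +
          (\<Sum>(x, y)\<leftarrow>M. app (blinfun_apply T x) (blinfun_apply b y))" using Cons by blast
      show ?case
      proof (cases i)
        case (Inl v)
        show ?thesis
          by (intro exI[of _ "c *\<^sub>C v + u"] exI[of _ M])
             (simp add: q Inl G_def G'_def uM[unfolded G_def G'_def] emb_add emb_scale blinfun.add_right
               bop_scaleC[OF a] add.assoc)
      next
        case (Inr w)
        obtain \<zeta> \<xi> where w: "w = (\<zeta>, \<xi>)" by fastforce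
        show ?thesis
          by (intro exI[of _ u] exI[of _ "(c *\<^sub>C \<zeta>, \<xi>) # M"])
             (simp add: q Inr w G_def G'_def uM[unfolded G_def G'_def] app_algebra
               bop_scaleC[OF T] add.left_commute)
      qed
    qed
    then obtain u M where uM: "(\<Sum>(c, i)\<leftarrow>L. c *\<^sub>C G i) = emb u + (\<Sum>(x, y)\<leftarrow>M. app x y)"
       "(\<Sum>(c, i)\<leftarrow>L. c *\<^sub>C G' i) = emb (blinfun_apply a u) +
          (\<Sum>(x, y)\<leftarrow>M. app (blinfun_apply T x) (blinfun_apply b y))" by blast
    define s where "s = (\<Sum>(x, y)\<leftarrow>M. app x y)"
    \<comment> \<open>The two pieces are orthogonal, so each component is dominated by the norm of
      the sum and may be estimated separately.\<close>
    have "cinner (emb u) s = 0"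
      unfolding s_def by (induction M) (auto simp: cinner_add_right emb_app)
    hence sq: "(norm (emb u + s))\<^sup>2 = (norm (emb u))\<^sup>2 + (norm s)\<^sup>2"
      by (simp add: norm_add_sq)
    have n1: "norm u \<le> norm (emb u + s)"
      by (rule power2_le_imp_le) (use sq in \<open>auto simp: norm_emb\<close>)
    have n2: "norm s \<le> norm (emb u + s)"
      by (rule power2_le_imp_le) (use sq in auto)
    have "norm (\<Sum>(c, i)\<leftarrow>L. c *\<^sub>C G' i) \<le> norm (blinfun_apply a u) +
        norm (\<Sum>(x, y)\<leftarrow>M. app (blinfun_apply T x) (blinfun_apply b y))"
      unfolding uM using norm_triangle_ineq norm_emb by metis
    also have "\<dots> \<le> norm a * norm u + norm T * norm b * norm s"
      unfolding s_def by (intro add_mono norm_blinfun tensor_both_bound app_isometric T b)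
    also have "\<dots> \<le> norm a * norm (emb u + s) + norm T * norm b * norm (emb u + s)"
      using n1 n2 by (intro add_mono mult_left_mono) auto
    finally show ?thesis unfolding uM s_def by (simp add: algebra_simps)
  qed
  from bounded_operator_extension[OF dense this] obtain S where
    S: "S \<in> bop" "\<And>i. blinfun_apply S (G i) = G' i" by blast
  show ?thesis
  proof (intro bexI[of _ S] conjI allI S(1))
    show "blinfun_apply S (emb u) = emb (blinfun_apply a u)" for u
      using S(2)[of "Inl u"] by (simp add: G_def G'_def)
    show "blinfun_apply S (app \<zeta> \<xi>) = app (blinfun_apply T \<zeta>) (blinfun_apply b \<xi>)" for \<zeta> \<xi>
      using S(2)[of "Inr (\<zeta>, \<xi>)"] by (simp add: G_def G'_def)
  qed
qed

section \<open>Operators at level zero and elementary tensors\<close>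

lemma
  assumes "a \<in> bop"
  shows level0_bop: "level0 emb app a \<in> bop"
    and level0_emb: "blinfun_apply (level0 emb app a) (emb u) = emb (blinfun_apply a u)"
    and level0_app: "blinfun_apply (level0 emb app a) (app \<zeta> \<xi>) = 0"
proof -
  have "\<exists>!S. S \<in> bop \<and> (\<forall>u. blinfun_apply S (emb u) = emb (blinfun_apply a u)) \<and>
    (\<forall>\<zeta> \<xi>. blinfun_apply S (app \<zeta> \<xi>) = 0)"
  proof (rule ex_ex1I)
    show "\<exists>S. S \<in> bop \<and> (\<forall>u. blinfun_apply S (emb u) = emb (blinfun_apply a u)) \<and>
      (\<forall>\<zeta> \<xi>. blinfun_apply S (app \<zeta> \<xi>) = 0)"
      using tower_op_exists[OF assms bop_zero bop_zero] by auto
  qed (auto intro: tower_bop_eqI)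
  from theI'[OF this] show "level0 emb app a \<in> bop"
    "blinfun_apply (level0 emb app a) (emb u) = emb (blinfun_apply a u)"
    "blinfun_apply (level0 emb app a) (app \<zeta> \<xi>) = 0"
    by (auto simp: level0_def)
qed

lemma
  assumes "T \<in> bop" "b \<in> bop"
  shows op_tensor_bop: "op_tensor emb app T b \<in> bop"
    and op_tensor_emb: "blinfun_apply (op_tensor emb app T b) (emb u) = 0"
    and op_tensor_app: "blinfun_apply (op_tensor emb app T b) (app \<zeta> \<xi>) =
        app (blinfun_apply T \<zeta>) (blinfun_apply b \<xi>)"
proof -
  have "\<exists>!S. S \<in> bop \<and> (\<forall>u. blinfun_apply S (emb u) = 0) \<and>
    (\<forall>\<zeta> \<xi>. blinfun_apply S (app \<zeta> \<xi>) = app (blinfun_apply T \<zeta>) (blinfun_apply b \<xi>))"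
  proof (rule ex_ex1I)
    show "\<exists>S. S \<in> bop \<and> (\<forall>u. blinfun_apply S (emb u) = 0) \<and>
      (\<forall>\<zeta> \<xi>. blinfun_apply S (app \<zeta> \<xi>) = app (blinfun_apply T \<zeta>) (blinfun_apply b \<xi>))"
      using tower_op_exists[OF bop_zero assms] by auto
  qed (auto intro: tower_bop_eqI)
  from theI'[OF this] show "op_tensor emb app T b \<in> bop"
    "blinfun_apply (op_tensor emb app T b) (emb u) = 0"
    "blinfun_apply (op_tensor emb app T b) (app \<zeta> \<xi>) = app (blinfun_apply T \<zeta>) (blinfun_apply b \<xi>)"
    by (auto simp: op_tensor_def)
qed

lemma level0_clinear: "clinear_on bop (level0 emb app)"
proof -
  have "level0 emb app (a + b) = level0 emb app a + level0 emb app b"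
    if "a \<in> bop" "b \<in> bop" for a b
    by (rule tower_bop_eqI)
       (use that in \<open>auto simp: level0_bop level0_emb level0_app bop_add blinfun.add_left emb_add\<close>)
  moreover have "level0 emb app (c *\<^sub>C a) = c *\<^sub>C level0 emb app a" if "a \<in> bop" for c a
    by (rule tower_bop_eqI)
       (use that in \<open>auto simp: level0_bop level0_emb level0_app bop_scale scaleC_blinfun.rep_eq emb_scale\<close>)
  ultimately show ?thesis by (auto simp: clinear_on_def)
qed

text \<open>Serves order zero: the zeroth Wiener integral names its operator on h only through the
  copy at level zero.\<close>

lemma level0_inject:
  assumes "a \<in> bop" "b \<in> bop" "level0 emb app a = level0 emb app b" shows "a = b"
proof (rule blinfun_eqI)
  fix u
  have "emb (blinfun_apply a u) = emb (blinfun_apply b u)"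
    using assms level0_emb by metis
  hence "norm (emb (blinfun_apply a u + (-1) *\<^sub>C blinfun_apply b u)) = 0"
    by (simp only: emb_add emb_scale) simp
  thus "blinfun_apply a u = blinfun_apply b u" by (simp add: norm_emb)
qed

lemma norm_le_level0: "a \<in> bop \<Longrightarrow> norm a \<le> norm (level0 emb app a)"
  by (rule norm_blinfun_bound) (auto simp: level0_emb[symmetric] norm_emb[symmetric]
    intro: order_trans[OF _ norm_blinfun] simp del: norm_emb)

section \<open>Slices and amplifications\<close>

lemma ket_apply: "blinfun_apply (ket emb app \<xi>) u = app (emb u) \<xi>"
  and ket_bop: "ket emb app \<xi> \<in> bop"
proof -
  have "bounded_linear (\<lambda>u. app (emb u) \<xi>)"
    by (rule bounded_linear_intro[where K = "norm \<xi>"])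
       (auto simp: emb_add emb_scale app_algebra scaleR_scaleC norm_app norm_emb)
  thus "blinfun_apply (ket emb app \<xi>) u = app (emb u) \<xi>" "ket emb app \<xi> \<in> bop"
    by (auto simp: ket_def bop_def bounded_linear_Blinfun_apply emb_scale app_algebra)
qed

lemma slice_inner:
  assumes "\<phi> x \<in> bop"
  shows "cinner u (blinfun_apply (slice emb app \<phi> \<xi> \<eta> x) v) =
    cinner (app (emb u) \<xi>) (blinfun_apply (\<phi> x) (app (emb v) \<eta>))"
  by (simp add: slice_def cinner_adj_right ket_bop ket_apply)

text \<open>The slice of a \<otimes> b is the scalar \<langle>\<xi>, b \<eta>\<rangle> times a. So
  the dependence on \<xi> and \<eta> sits in finitely many scalars, while the operators a stay
  fixed; both the invariance of \<open>A0\<close> and all later measurability come from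
  this.\<close>

lemma slice_sum_tensor:
  assumes ab: "set ab \<subseteq> bop \<times> bop" and x: "\<phi> x = (\<Sum>(a, b)\<leftarrow>ab. tensor1 emb app a b)"
  shows "slice emb app \<phi> \<xi> \<eta> x = (\<Sum>(a, b)\<leftarrow>ab. cinner \<xi> (blinfun_apply b \<eta>) *\<^sub>C a)"
proof (rule blinfun_eq_cinnerI)
  fix u v
  have "\<phi> x \<in> bop"
    unfolding x tensor1_def using ab by (intro bop_sum_list) (auto intro!: op_tensor_bop level0_bop)
  hence "cinner u (blinfun_apply (slice emb app \<phi> \<xi> \<eta> x) v) =
    cinner (app (emb u) \<xi>) (blinfun_apply (\<phi> x) (app (emb v) \<eta>))" by (rule slice_inner)
  also have "\<dots> = cinner u (blinfun_apply (\<Sum>(a, b)\<leftarrow>ab. cinner \<xi> (blinfun_apply b \<eta>) *\<^sub>C a) v)"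
    unfolding x using ab
    by (induction ab)
       (auto simp: tensor1_def blinfun.add_left op_tensor_app level0_bop level0_emb cinner_add_right
         app_algebra emb_inner scaleC_blinfun.rep_eq cinner_scaleC_right)
  finally show "cinner u (blinfun_apply (slice emb app \<phi> \<xi> \<eta> x) v) =
    cinner u (blinfun_apply (\<Sum>(a, b)\<leftarrow>ab. cinner \<xi> (blinfun_apply b \<eta>) *\<^sub>C a) v)" .
qed

lemma clinear_on_sum_list:
  assumes "clinear_on S F" "cvec.subspace S" "set ab \<subseteq> S \<times> UNIV"
  shows "F (\<Sum>(a, b)\<leftarrow>ab. h b *\<^sub>C a) = (\<Sum>(a, b)\<leftarrow>ab. h b *\<^sub>C F a)
     \<and> (\<Sum>(a, b)\<leftarrow>ab. h b *\<^sub>C a) \<in> S"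
  using assms(3)
proof (induction ab)
  case Nil
  have "F (0 *\<^sub>C 0) = 0 *\<^sub>C F 0" using assms(1,2) unfolding clinear_on_def cvec.subspace_def by blast
  thus ?case using assms(2) by (simp add: cvec.subspace_0)
next
  case (Cons q ab)
  obtain a b where q: "q = (a, b)" by fastforce
  have "a \<in> S" using Cons q by auto
  hence "h b *\<^sub>C a \<in> S" "F (h b *\<^sub>C a) = h b *\<^sub>C F a"
    using assms by (auto simp: clinear_on_def cvec.subspace_scale)
  moreover have "F (h b *\<^sub>C a + (\<Sum>(a, b)\<leftarrow>ab. h b *\<^sub>C a)) = F (h b *\<^sub>C a) + F (\<Sum>(a, b)\<leftarrow>ab. h b *\<^sub>C a)"
    using calculation Cons assms(1) by (auto simp: clinear_on_def)
  ultimately show ?case using Cons assms(2) by (auto simp: q cvec.subspace_add)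
qed

text \<open>The matrix elements of (\<psi> \<otimes> id)(T) at \<zeta> \<otimes> \<xi> and \<zeta>'
  \<otimes> \<eta> are those of \<psi> applied to the slice of T at \<xi>, \<eta>. They involve the
  chosen decomposition of T only through its slices.\<close>

lemma op_tensor_sum_inner:
  assumes \<psi>: "clinear_on A0 \<psi>" "\<psi> ` A0 \<subseteq> bop" and A0: "A0 \<subseteq> bop" "cvec.subspace A0"
    and ab: "set ab \<subseteq> A0 \<times> bop"
  shows "(\<Sum>(a, b)\<leftarrow>ab. op_tensor emb app (\<psi> a) b) \<in> bop"
    "blinfun_apply (\<Sum>(a, b)\<leftarrow>ab. op_tensor emb app (\<psi> a) b) (emb u) = 0"
    "cinner (emb u) (blinfun_apply (\<Sum>(a, b)\<leftarrow>ab. op_tensor emb app (\<psi> a) b) (app \<zeta>' \<eta>)) = 0"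
    "cinner (app \<zeta> \<xi>) (blinfun_apply (\<Sum>(a, b)\<leftarrow>ab. op_tensor emb app (\<psi> a) b) (app \<zeta>' \<eta>)) =
      cinner \<zeta> (blinfun_apply (\<psi> (\<Sum>(a, b)\<leftarrow>ab. cinner \<xi> (blinfun_apply b \<eta>) *\<^sub>C a)) \<zeta>')"
proof -
  show "(\<Sum>(a, b)\<leftarrow>ab. op_tensor emb app (\<psi> a) b) \<in> bop"
    using ab \<psi>(2) by (intro bop_sum_list) (auto intro!: op_tensor_bop)
  show "blinfun_apply (\<Sum>(a, b)\<leftarrow>ab. op_tensor emb app (\<psi> a) b) (emb u) = 0"
    using ab \<psi>(2) by (induction ab) (auto simp: blinfun.add_left op_tensor_emb image_subset_iff)
  show "cinner (emb u) (blinfun_apply (\<Sum>(a, b)\<leftarrow>ab. op_tensor emb app (\<psi> a) b) (app \<zeta>' \<eta>)) = 0"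
    using ab \<psi>(2)
    by (induction ab) (auto simp: blinfun.add_left op_tensor_app image_subset_iff cinner_add_right emb_app)
  have "cinner (app \<zeta> \<xi>) (blinfun_apply (\<Sum>(a, b)\<leftarrow>ab. op_tensor emb app (\<psi> a) b) (app \<zeta>' \<eta>)) =
      cinner \<zeta> (blinfun_apply (\<Sum>(a, b)\<leftarrow>ab. cinner \<xi> (blinfun_apply b \<eta>) *\<^sub>C \<psi> a) \<zeta>')"
    using ab \<psi>(2)
    by (induction ab) (auto simp: blinfun.add_left op_tensor_app image_subset_iff cinner_add_right
        app_algebra scaleC_blinfun.rep_eq cinner_scaleC_right)
  moreover have "set ab \<subseteq> A0 \<times> UNIV" using ab by auto
  ultimately show "cinner (app \<zeta> \<xi>) (blinfun_apply (\<Sum>(a, b)\<leftarrow>ab. op_tensor emb app (\<psi> a) b) (app \<zeta>' \<eta>)) =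
      cinner \<zeta> (blinfun_apply (\<psi> (\<Sum>(a, b)\<leftarrow>ab. cinner \<xi> (blinfun_apply b \<eta>) *\<^sub>C a)) \<zeta>')"
    using clinear_on_sum_list[OF \<psi>(1) A0(2), of ab "\<lambda>b. cinner \<xi> (blinfun_apply b \<eta>)"] by simp
qed

text \<open>Two decompositions of the same T have the same slices, hence the same matrix elements
  after amplification. This makes the definite description of \<open>amplify\<close> meaningful and
  computable from any decomposition.\<close>

lemma amplify_eq:
  assumes \<psi>: "clinear_on A0 \<psi>" "\<psi> ` A0 \<subseteq> bop" and A0: "A0 \<subseteq> bop" "cvec.subspace A0"
    and ab: "set ab \<subseteq> A0 \<times> bop" and T: "T = (\<Sum>(a, b)\<leftarrow>ab. tensor1 emb app a b)"
  shows "amplify emb app A0 \<psi> T = (\<Sum>(a, b)\<leftarrow>ab. op_tensor emb app (\<psi> a) b)"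
  unfolding amplify_def
proof (rule the_equality)
  show "\<exists>ab'. set ab' \<subseteq> A0 \<times> bop \<and> T = (\<Sum>(a, b)\<leftarrow>ab'. tensor1 emb app a b) \<and>
    (\<Sum>(a, b)\<leftarrow>ab. op_tensor emb app (\<psi> a) b) = (\<Sum>(a, b)\<leftarrow>ab'. op_tensor emb app (\<psi> a) b)"
    using ab T by blast
next
  fix S assume "\<exists>ab'. set ab' \<subseteq> A0 \<times> bop \<and> T = (\<Sum>(a, b)\<leftarrow>ab'. tensor1 emb app a b) \<and>
    S = (\<Sum>(a, b)\<leftarrow>ab'. op_tensor emb app (\<psi> a) b)"
  then obtain ab' where ab': "set ab' \<subseteq> A0 \<times> bop" "T = (\<Sum>(a, b)\<leftarrow>ab'. tensor1 emb app a b)"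
    "S = (\<Sum>(a, b)\<leftarrow>ab'. op_tensor emb app (\<psi> a) b)" by blast
  have "set ab \<subseteq> bop \<times> bop" "set ab' \<subseteq> bop \<times> bop" using ab ab' A0 by auto
  \<comment> \<open>The slice sees only the operator T, so a constant map stands in for the
    generator and its argument is a dummy.\<close>
  hence sl: "(\<Sum>(a, b)\<leftarrow>ab'. cinner \<xi> (blinfun_apply b \<eta>) *\<^sub>C a) =
      (\<Sum>(a, b)\<leftarrow>ab. cinner \<xi> (blinfun_apply b \<eta>) *\<^sub>C a)" for \<xi> \<eta>
    using slice_sum_tensor[of ab' "\<lambda>_. T" undefined \<xi> \<eta>] slice_sum_tensor[of ab "\<lambda>_. T" undefined \<xi> \<eta>]
      T ab'(2) by simp
  note 1 = op_tensor_sum_inner[OF \<psi> A0 ab] and 2 = op_tensor_sum_inner[OF \<psi> A0 ab'(1)]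
  show "S = (\<Sum>(a, b)\<leftarrow>ab. op_tensor emb app (\<psi> a) b)"
    unfolding ab'(3)
  proof (rule tower_bop_eqI)
    show "blinfun_apply (\<Sum>(a, b)\<leftarrow>ab'. op_tensor emb app (\<psi> a) b) (app \<zeta> \<eta>) =
      blinfun_apply (\<Sum>(a, b)\<leftarrow>ab. op_tensor emb app (\<psi> a) b) (app \<zeta> \<eta>)" for \<zeta> \<eta>
      by (rule tower_vec_eqI) (simp_all only: 1 2 sl)
  qed (simp_all only: 1 2)
qed

lemma alg_tensor_list:
  assumes A0: "cvec.subspace A0" "A0 \<subseteq> bop" and T: "T \<in> alg_tensor emb app A0"
  shows "\<exists>ab. set ab \<subseteq> A0 \<times> bop \<and> T = (\<Sum>(a, b)\<leftarrow>ab. tensor1 emb app a b)"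
  using T unfolding alg_tensor_def
proof (induction rule: cvec.span_induct_alt)
  case base
  show ?case by (intro exI[of _ "[]"]) simp
next
  case (step c x y)
  then obtain a b ab where ab: "x = tensor1 emb app a b" "a \<in> A0" "b \<in> bop" "set ab \<subseteq> A0 \<times> bop"
    "y = (\<Sum>(a, b)\<leftarrow>ab. tensor1 emb app a b)" by auto
  have ca: "c *\<^sub>C a \<in> A0" using ab A0 by (simp add: cvec.subspace_scale)
  have "c *\<^sub>C tensor1 emb app a b = tensor1 emb app (c *\<^sub>C a) b"
    unfolding tensor1_def
    by (rule tower_bop_eqI)
       (use ab ca A0 level0_clinear in \<open>auto simp: op_tensor_bop op_tensor_emb op_tensor_app level0_bop
          bop_scale scaleC_blinfun.rep_eq clinear_on_def app_algebra subset_iff\<close>)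
  thus ?case using ab ca by (intro exI[of _ "(c *\<^sub>C a, b) # ab"]) auto
qed

end

section \<open>Flow generators and their random walks\<close>

locale flow = tower emb app
  for emb :: "'h::complex_hilbert \<Rightarrow> 'p::complex_hilbert"
    and app :: "'p \<Rightarrow> complex \<times> 'k::complex_hilbert \<Rightarrow> 'p" +
  fixes A0 :: "('h \<Rightarrow>\<^sub>L 'h) set" and \<phi> :: "('h \<Rightarrow>\<^sub>L 'h) \<Rightarrow> ('p \<Rightarrow>\<^sub>L 'p)"
  assumes A0_alg: "star_subalgebra A0"
    and gen: "flow_generator emb app A0 \<phi>"
begin

abbreviation "sl \<equiv> slice emb app \<phi>"
abbreviation "rw \<equiv> random_walk emb app A0 \<phi>"

lemma A0_bop: "A0 \<subseteq> bop" and A0_subspace: "cvec.subspace A0"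
  using star_subalgebraD[OF A0_alg] by auto

lemma phi_list:
  assumes "x \<in> A0"
  shows "\<exists>ab. set ab \<subseteq> A0 \<times> bop \<and> \<phi> x = (\<Sum>(a, b)\<leftarrow>ab. tensor1 emb app a b)"
  using assms gen by (intro alg_tensor_list A0_subspace A0_bop) (auto simp: flow_generator_def)

lemma phi_bop: "x \<in> A0 \<Longrightarrow> \<phi> x \<in> bop"
proof -
  assume "x \<in> A0"
  then obtain ab where ab: "set ab \<subseteq> A0 \<times> bop" "\<phi> x = (\<Sum>(a, b)\<leftarrow>ab. tensor1 emb app a b)"
    using phi_list by blast
  show "\<phi> x \<in> bop"
    unfolding ab(2) tensor1_def using ab(1) A0_bop
    by (intro bop_sum_list) (auto intro!: op_tensor_bop level0_bop)
qed

lemma slice_list: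
  assumes "set ab \<subseteq> A0 \<times> bop" "\<phi> x = (\<Sum>(a, b)\<leftarrow>ab. tensor1 emb app a b)"
  shows "sl \<xi> \<eta> x = (\<Sum>(a, b)\<leftarrow>ab. cinner \<xi> (blinfun_apply b \<eta>) *\<^sub>C a)"
  using assms A0_bop by (intro slice_sum_tensor) auto

lemma slice_clinear: "clinear_on A0 (sl \<xi> \<eta>)"
proof -
  have lin: "clinear_on A0 \<phi>" using gen by (simp add: flow_generator_def)
  have "sl \<xi> \<eta> (x + y) = sl \<xi> \<eta> x + sl \<xi> \<eta> y" if xy: "x \<in> A0" "y \<in> A0" for x y
  proof -
    have s: "x + y \<in> A0" using xy A0_subspace cvec.subspace_add by blast
    have "\<phi> (x + y) = \<phi> x + \<phi> y" using lin xy by (simp add: clinear_on_def)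
    thus ?thesis
      by (rule_tac blinfun_eq_cinnerI)
         (simp add: slice_inner[of \<phi>, OF phi_bop[OF s]] slice_inner[of \<phi>, OF phi_bop[OF xy(1)]]
           slice_inner[of \<phi>, OF phi_bop[OF xy(2)]] blinfun.add_left cinner_add_right)
  qed
  moreover have "sl \<xi> \<eta> (c *\<^sub>C x) = c *\<^sub>C sl \<xi> \<eta> x" if x: "x \<in> A0" for c x
  proof -
    have s: "c *\<^sub>C x \<in> A0" using x A0_subspace cvec.subspace_scale by blast
    have "\<phi> (c *\<^sub>C x) = c *\<^sub>C \<phi> x" using lin x by (simp add: clinear_on_def)
    thus ?thesis
      by (rule_tac blinfun_eq_cinnerI)
         (simp add: slice_inner[of \<phi>, OF phi_bop[OF s]] slice_inner[of \<phi>, OF phi_bop[OF x]]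
           scaleC_blinfun.rep_eq cinner_scaleC_right)
  qed
  ultimately show ?thesis by (auto simp: clinear_on_def)
qed

lemma slice_A0: "x \<in> A0 \<Longrightarrow> sl \<xi> \<eta> x \<in> A0"
proof -
  assume "x \<in> A0"
  then obtain ab where ab: "set ab \<subseteq> A0 \<times> bop" "\<phi> x = (\<Sum>(a, b)\<leftarrow>ab. tensor1 emb app a b)"
    using phi_list by blast
  have "clinear_on A0 (\<lambda>x. x)" by (simp add: clinear_on_def)
  moreover have "set ab \<subseteq> A0 \<times> UNIV" using ab(1) by auto
  ultimately show "sl \<xi> \<eta> x \<in> A0"
    unfolding slice_list[OF ab]
    using clinear_on_sum_list[OF _ A0_subspace, of "\<lambda>x. x" ab] by simp
qed

text \<open>Linearity and boundedness must pass through the induction together: amplification by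
  \<open>rw n\<close> can be evaluated only once \<open>rw n\<close> is known to be linear on
  \<open>A0\<close> with values in \<open>bop\<close>.\<close>

lemma rw_linear_bop: "clinear_on A0 (rw n) \<and> rw n ` A0 \<subseteq> bop"
proof (induction n)
  case 0
  show ?case using level0_clinear A0_bop by (auto simp: clinear_on_def subset_iff level0_bop)
next
  case (Suc n)
  hence \<psi>: "clinear_on A0 (rw n)" "rw n ` A0 \<subseteq> bop" by auto
  have inner: "rw (Suc n) x \<in> bop \<and> blinfun_apply (rw (Suc n) x) (emb u) = 0 \<and>
      cinner (emb u) (blinfun_apply (rw (Suc n) x) (app \<zeta>' \<eta>)) = 0 \<and>
      cinner (app \<zeta> \<xi>) (blinfun_apply (rw (Suc n) x) (app \<zeta>' \<eta>)) =
        cinner \<zeta> (blinfun_apply (rw n (sl \<xi> \<eta> x)) \<zeta>')" if x: "x \<in> A0" for x u \<zeta> \<xi> \<zeta>' \<eta>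
  proof -
    obtain ab where ab: "set ab \<subseteq> A0 \<times> bop" "\<phi> x = (\<Sum>(a, b)\<leftarrow>ab. tensor1 emb app a b)"
      using phi_list[OF x] by blast
    have "rw (Suc n) x = (\<Sum>(a, b)\<leftarrow>ab. op_tensor emb app (rw n a) b)"
      using amplify_eq[OF \<psi> A0_bop A0_subspace ab] by simp
    thus ?thesis
      using op_tensor_sum_inner[OF \<psi> A0_bop A0_subspace ab(1)] slice_list[OF ab] by simp
  qed
  have "rw (Suc n) (x + y) = rw (Suc n) x + rw (Suc n) y" if xy: "x \<in> A0" "y \<in> A0" for x y
  proof (rule tower_bop_eqI)
    have s: "x + y \<in> A0" using xy A0_subspace cvec.subspace_add by blast
    note i = inner[OF xy(1)] inner[OF xy(2)] inner[OF s]
    have l: "rw n (sl \<xi> \<eta> (x + y)) = rw n (sl \<xi> \<eta> x) + rw n (sl \<xi> \<eta> y)" for \<xi> \<eta>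
      using \<psi>(1) slice_clinear xy slice_A0 by (auto simp: clinear_on_def)
    show "rw (Suc n) (x + y) \<in> bop" "rw (Suc n) x + rw (Suc n) y \<in> bop" using i by blast+
    show "blinfun_apply (rw (Suc n) (x + y)) (emb u) = blinfun_apply (rw (Suc n) x + rw (Suc n) y) (emb u)" for u
      by (simp only: i blinfun.add_left) simp
    show "blinfun_apply (rw (Suc n) (x + y)) (app \<zeta>' \<eta>) = blinfun_apply (rw (Suc n) x + rw (Suc n) y) (app \<zeta>' \<eta>)" for \<zeta>' \<eta>
      by (rule tower_vec_eqI; unfold blinfun.add_left cinner_add_right)
         (simp_all only: i l blinfun.add_left cinner_add_right add.right_neutral)
  qed
  moreover have "rw (Suc n) (c *\<^sub>C x) = c *\<^sub>C rw (Suc n) x" if x: "x \<in> A0" for c x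
  proof (rule tower_bop_eqI)
    have s: "c *\<^sub>C x \<in> A0" using x A0_subspace cvec.subspace_scale by blast
    note i = inner[OF x] inner[OF s]
    have l: "rw n (sl \<xi> \<eta> (c *\<^sub>C x)) = c *\<^sub>C rw n (sl \<xi> \<eta> x)" for \<xi> \<eta>
      using \<psi>(1) slice_clinear x slice_A0 by (auto simp: clinear_on_def)
    show "rw (Suc n) (c *\<^sub>C x) \<in> bop" "c *\<^sub>C rw (Suc n) x \<in> bop" using i by blast+
    show "blinfun_apply (rw (Suc n) (c *\<^sub>C x)) (emb u) = blinfun_apply (c *\<^sub>C rw (Suc n) x) (emb u)" for u
      unfolding scaleC_blinfun.rep_eq using i by simp
    show "blinfun_apply (rw (Suc n) (c *\<^sub>C x)) (app \<zeta>' \<eta>) = blinfun_apply (c *\<^sub>C rw (Suc n) x) (app \<zeta>' \<eta>)" for \<zeta>' \<eta>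
      by (rule tower_vec_eqI; unfold scaleC_blinfun.rep_eq cinner_scaleC_right)
         (simp_all only: i l scaleC_blinfun.rep_eq cinner_scaleC_right mult_zero_right)
  qed
  ultimately show ?case using inner by (auto simp: clinear_on_def)
qed

lemma rw_clinear: "clinear_on A0 (rw n)"
  using rw_linear_bop[of n] by auto

text \<open>The recursion behind everything that follows. In the walk the generator acts first and
  fills the last tensor factor, so fixing the vectors in that factor amounts to slicing the
  generator and taking one step fewer.\<close>

lemma rw_Suc_inner:
  assumes x: "x \<in> A0"
  shows "cinner (app \<zeta> \<xi>) (blinfun_apply (rw (Suc n) x) (app \<zeta>' \<eta>)) =
        cinner \<zeta> (blinfun_apply (rw n (sl \<xi> \<eta> x)) \<zeta>')"
proof -
  obtain ab where ab: "set ab \<subseteq> A0 \<times> bop" "\<phi> x = (\<Sum>(a, b)\<leftarrow>ab. tensor1 emb app a b)"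
    using phi_list[OF x] by blast
  have "rw (Suc n) x = (\<Sum>(a, b)\<leftarrow>ab. op_tensor emb app (rw n a) b)"
    using rw_linear_bop[of n] amplify_eq[OF _ _ A0_bop A0_subspace ab] by simp
  thus ?thesis
    using op_tensor_sum_inner(4)[OF _ _ A0_bop A0_subspace ab(1)] rw_linear_bop[of n] slice_list[OF ab]
    by simp
qed

text \<open>The shift estimate, which stands in for a norm bound on the slice maps
  themselves.\<close>

lemma norm_rw_slice:
  assumes x: "x \<in> A0"
  shows "norm (rw n (sl \<xi> \<eta> x)) \<le> norm (rw (Suc n) x) * (norm \<xi> * norm \<eta>)"
proof (rule norm_le_cinnerI_op)
  fix \<zeta> \<zeta>'
  have "cmod (cinner \<zeta> (blinfun_apply (rw n (sl \<xi> \<eta> x)) \<zeta>')) \<le>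
      norm (app \<zeta> \<xi>) * norm (blinfun_apply (rw (Suc n) x) (app \<zeta>' \<eta>))"
    unfolding rw_Suc_inner[OF x, symmetric] by (rule cauchy_schwarz)
  also have "\<dots> \<le> norm (app \<zeta> \<xi>) * (norm (rw (Suc n) x) * norm (app \<zeta>' \<eta>))"
    by (intro mult_left_mono norm_blinfun) simp
  finally show "cmod (cinner \<zeta> (blinfun_apply (rw n (sl \<xi> \<eta> x)) \<zeta>')) \<le>
      norm (rw (Suc n) x) * (norm \<xi> * norm \<eta>) * norm \<zeta> * norm \<zeta>'"
    by (simp add: norm_app mult_ac)
qed simp

lemma norm_le_rw0: "x \<in> A0 \<Longrightarrow> norm x \<le> norm (rw 0 x)"
  using norm_le_level0 A0_bop by auto

end


section \<open>Henstock--Kurzweil integrals of operator-valued functions\<close>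

text \<open>The Bochner integral is not available for operator-valued functions, because spaces of bounded
  operators are not second countable; the Henstock--Kurzweil integral has no such restriction.\<close>

lemma has_integral_closed_subspace:
  fixes f :: "real \<Rightarrow> 'a::real_normed_vector" and h :: "'a \<Rightarrow> 'b::real_normed_vector"
  assumes S: "subspace S" "closed S" and f: "\<And>r. r \<in> {a..b} \<Longrightarrow> f r \<in> S"
    and int: "(f has_integral y) {a..b}"
  shows "y \<in> S"
    and "\<lbrakk>\<And>u v. u \<in> S \<Longrightarrow> v \<in> S \<Longrightarrow> h (u + v) = h u + h v; \<And>r u. u \<in> S \<Longrightarrow> h (r *\<^sub>R u) = r *\<^sub>R h u;
      \<And>u. u \<in> S \<Longrightarrow> norm (h u) \<le> K * norm u\<rbrakk> \<Longrightarrow> ((\<lambda>r. h (f r)) has_integral h y) {a..b}"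
proof -
  define R where "R p = (\<Sum>(x, k)\<in>p. measure lborel k *\<^sub>R f x)" for p :: "(real \<times> real set) set"
  have lim: "(R \<longlongrightarrow> y) (division_filter (cbox a b))"
    using int unfolding R_def box_real[symmetric] has_integral_cbox .
  have div: "\<forall>\<^sub>F p in division_filter (cbox a b). p tagged_division_of (cbox a b)"
    by (rule eventually_division_filter_tagged_division)
  have RS: "R p \<in> S" if "p tagged_division_of (cbox a b)" for p
  proof -
    have "measure lborel k *\<^sub>R f x \<in> S" if "(x, k) \<in> p" for x k
      using tag_in_interval[OF \<open>p tagged_division_of (cbox a b)\<close> that] f S(1) by (auto intro: subspace_scale)
    thus ?thesis unfolding R_def by (intro subspace_sum[OF S(1)]) auto
  qed
  have RS_ev: "\<forall>\<^sub>F p in division_filter (cbox a b). R p \<in> S"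
    using div by eventually_elim (rule RS)
  show yS: "y \<in> S"
    by (rule Lim_in_closed_set[OF S(2) RS_ev division_filter_not_empty lim])
  \<comment> \<open>In the application \<open>S\<close> is \<open>A\<close> and \<open>h\<close> is
    linear and bounded on \<open>A\<close> only. It is therefore moved through the Riemann sums,
    which lie in \<open>S\<close>, and not applied as a bounded operator on the whole space.\<close>
  assume add: "\<And>u v. u \<in> S \<Longrightarrow> v \<in> S \<Longrightarrow> h (u + v) = h u + h v"
    and sc: "\<And>r u. u \<in> S \<Longrightarrow> h (r *\<^sub>R u) = r *\<^sub>R h u"
    and bd: "\<And>u. u \<in> S \<Longrightarrow> norm (h u) \<le> K * norm u"
  have h0: "h 0 = 0" using sc[of 0 0] S(1) subspace_0 by fastforce
  have hsum: "h (\<Sum>i\<in>I. g i) = (\<Sum>i\<in>I. h (g i)) \<and> (\<Sum>i\<in>I. g i) \<in> S"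
    if "\<And>i. i \<in> I \<Longrightarrow> g i \<in> S" for I and g :: "real \<times> real set \<Rightarrow> 'a"
    using that
    by (induction I rule: infinite_finite_induct) (auto simp: h0 add subspace_0[OF S(1)] subspace_add[OF S(1)])
  have hR: "h (R p) = (\<Sum>(x, k)\<in>p. measure lborel k *\<^sub>R h (f x))" if p: "p tagged_division_of (cbox a b)" for p
  proof -
    have fS: "f x \<in> S" if "(x, k) \<in> p" for x k
      using tag_in_interval[OF p that] f by auto
    have "h (R p) = (\<Sum>i\<in>p. h (case i of (x, k) \<Rightarrow> measure lborel k *\<^sub>R f x))"
      unfolding R_def using hsum[of p "\<lambda>(x, k). measure lborel k *\<^sub>R f x"] fS S(1) by (auto intro: subspace_scale)
    also have "\<dots> = (\<Sum>(x, k)\<in>p. measure lborel k *\<^sub>R h (f x))"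
      by (intro sum.cong) (use fS sc in auto)
    finally show ?thesis .
  qed
  have hdiff: "norm (h u - h v) \<le> K * norm (u - v)" if "u \<in> S" "v \<in> S" for u v
  proof -
    have "h (u - v) = h u - h v" using add[of u "(-1) *\<^sub>R v"] sc[of v "-1"] that S(1) subspace_scale by fastforce
    thus ?thesis using bd[of "u - v"] that S(1) subspace_diff by metis
  qed
  have "((\<lambda>p. h (R p)) \<longlongrightarrow> h y) (division_filter (cbox a b))"
  proof (rule LIM_zero_cancel, rule Lim_null_comparison)
    show "\<forall>\<^sub>F p in division_filter (cbox a b). norm (h (R p) - h y) \<le> K * norm (R p - y)"
      using RS_ev by eventually_elim (rule hdiff[OF _ yS])
    show "((\<lambda>p. K * norm (R p - y)) \<longlongrightarrow> 0) (division_filter (cbox a b))"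
      using tendsto_mult[OF tendsto_const tendsto_norm_zero[OF LIM_zero[OF lim]], of K] by simp
  qed
  moreover have "\<forall>\<^sub>F p in division_filter (cbox a b). h (R p) = (\<Sum>(x, k)\<in>p. measure lborel k *\<^sub>R h (f x))"
    using div by eventually_elim (rule hR)
  ultimately have "((\<lambda>p. \<Sum>(x, k)\<in>p. measure lborel k *\<^sub>R h (f x)) \<longlongrightarrow> h y) (division_filter (cbox a b))"
    by (rule Lim_transform_eventually)
  thus "((\<lambda>r. h (f r)) has_integral h y) {a..b}"
    unfolding box_real[symmetric] has_integral_cbox .
qed

lemma set_integrable_bounded_borel:
  fixes w :: "real \<Rightarrow> complex"
  assumes "w \<in> borel_measurable borel" "\<And>r. cmod (w r) \<le> B"
  shows "set_integrable lborel {a..b} w"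
  unfolding set_integrable_def
  by (rule integrableI_bounded_set_indicator[where B = B])
     (use assms in \<open>auto simp: emeasure_lborel_Icc_eq\<close>)

lemma integrable_on_bounded_borel:
  fixes w :: "real \<Rightarrow> complex"
  assumes "w \<in> borel_measurable borel" "\<And>r. cmod (w r) \<le> B"
  shows "w integrable_on {a..b}"
  using set_borel_integral_eq_integral(1)[OF set_integrable_bounded_borel[OF assms]] .

text \<open>On a fine grid the uniformly continuous \<open>G\<close> is replaced by its value at the
  left end of each cell. Every cell then contributes a bounded Borel scalar function times one fixed
  operator, and uniform limits preserve integrability.\<close>

lemma integrable_on_scaleC_continuous:
  fixes w :: "real \<Rightarrow> complex" and G :: "real \<Rightarrow> 'a::real_normed_vector \<Rightarrow>\<^sub>L 'b::complex_hilbert"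
  assumes w: "w \<in> borel_measurable borel" "\<And>r. cmod (w r) \<le> B"
    and G: "continuous_on {0..t} G"
  shows "(\<lambda>r. w r *\<^sub>C G r) integrable_on {0..t}"
  unfolding box_real(2)[symmetric]
proof (rule integrable_uniform_limit)
  fix e :: real assume e: "e > 0"
  have B: "B \<ge> 0" using w(2)[of 0] norm_ge_zero order_trans by blast
  have "uniformly_continuous_on {0..t} G" by (intro compact_uniformly_continuous G) simp
  moreover have "e / (B + 1) > 0" using e B by simp
  ultimately obtain d where d: "d > 0"
    "\<And>x y. x \<in> {0..t} \<Longrightarrow> y \<in> {0..t} \<Longrightarrow> dist y x < d \<Longrightarrow> dist (G y) (G x) < e / (B + 1)"
    unfolding uniformly_continuous_on_def by metis
  obtain N where N: "inverse (real (Suc N)) < d" using reals_Archimedean d(1) by blast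
  define M where "M = real (Suc N)"
  have M: "M > 0" "1 / M < d" using N by (auto simp: M_def inverse_eq_divide)
  define J where "J k = {real k / M..<real (Suc k) / M}" for k
  \<comment> \<open>The cells are half-open, so one beyond the integer part of t M is needed in
    order to contain the endpoint t.\<close>
  define Q where "Q = nat \<lfloor>t * M\<rfloor> + 1"
  define g where "g r = (\<Sum>k<Q. (indicator (J k) r * w r) *\<^sub>C G (real k / M))" for r
  have J_iff: "r \<in> J k \<longleftrightarrow> \<lfloor>r * M\<rfloor> = int k" for r k
    using M by (auto simp: J_def field_simps floor_eq_iff)
  have close: "norm (w r *\<^sub>C G r - g r) \<le> e" if r: "r \<in> {0..t}" for r
  proof -
    define k where "k = nat \<lfloor>r * M\<rfloor>"
    have k: "int k = \<lfloor>r * M\<rfloor>" using r M by (simp add: k_def)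
    have "\<lfloor>r * M\<rfloor> \<le> \<lfloor>t * M\<rfloor>" using r M by (intro floor_mono mult_right_mono) auto
    hence kQ: "k < Q" using k by (simp add: Q_def)
    have "g r = (\<Sum>k'<Q. if k' = k then w r *\<^sub>C G (real k / M) else 0)"
      unfolding g_def using k by (intro sum.cong) (auto simp: indicator_def J_iff)
    hence g: "g r = w r *\<^sub>C G (real k / M)" using kQ by simp
    have rk: "r \<in> J k" using k J_iff by simp
    hence le: "real k / M \<le> r" "r < real k / M + 1 / M"
      using M by (auto simp: J_def add_divide_distrib)
    have "dist (real k / M) r < d" using le M(2) by (simp add: dist_real_def)
    moreover have "real k / M \<in> {0..t}" using le r M by auto
    ultimately have "norm (G r - G (real k / M)) < e / (B + 1)"
      using d(2)[OF r] by (metis dist_commute dist_norm)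
    hence "cmod (w r) * norm (G r - G (real k / M)) \<le> B * (e / (B + 1))"
      using w(2)[of r] B by (intro mult_mono) auto
    also have "\<dots> \<le> e" using e B by (simp add: field_simps)
    finally show ?thesis
      unfolding g cvec.scale_right_diff_distrib[symmetric] norm_scaleC_blinfun .
  qed
  have "(\<lambda>r. (indicator (J k) r * w r) *\<^sub>C G (real k / M)) integrable_on {0..t}" for k
  proof -
    have "(\<lambda>r. indicator (J k) r * w r) integrable_on {0..t}"
    proof (rule integrable_on_bounded_borel)
      show "(\<lambda>r. indicator (J k) r * w r) \<in> borel_measurable borel"
        using w(1) by (auto simp: J_def)
      show "cmod (indicator (J k) r * w r) \<le> B" for r
        using w(2)[of r] B by (auto simp: indicator_def)
    qed
    from integrable_linear[OF this bounded_bilinear.bounded_linear_left[OF bounded_bilinear_scaleC_blinfun]]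
    show ?thesis by (simp add: o_def)
  qed
  hence "g integrable_on {0..t}" unfolding g_def by (intro integrable_sum) auto
  thus "\<exists>g. (\<forall>x\<in>cbox 0 t. norm (w x *\<^sub>C G x - g x) \<le> e) \<and> g integrable_on cbox 0 t"
    using close by (intro exI[of _ g]) auto
qed

text \<open>The limit of the integrals is supplied by the caller: in the applications it is the sum
  of a series that is already known.\<close>

lemma uniform_limit_has_integral:
  fixes f :: "nat \<Rightarrow> real \<Rightarrow> 'a::banach"
  assumes int: "\<And>n. (f n has_integral I n) {0..t}" and lim: "uniform_limit {0..t} f g sequentially"
    and I: "I \<longlonglongrightarrow> L"
  shows "(g has_integral L) {0..t}"
proof (cases "t \<ge> 0")
  case True
  have g: "g integrable_on {0..t}"
    unfolding box_real(2)[symmetric]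
  proof (rule integrable_uniform_limit)
    fix e :: real assume e: "e > 0"
    obtain n where "\<And>r. r \<in> {0..t} \<Longrightarrow> dist (f n r) (g r) < e"
      using lim e unfolding uniform_limit_iff eventually_sequentially by blast
    thus "\<exists>h. (\<forall>x\<in>cbox 0 t. norm (g x - h x) \<le> e) \<and> h integrable_on cbox 0 t"
      using int[of n] by (intro exI[of _ "f n"])
        (auto simp: dist_norm norm_minus_commute intro: less_imp_le has_integral_integrable)
  qed
  have "I \<longlonglongrightarrow> integral {0..t} g"
  proof (rule LIMSEQ_I)
    fix e :: real assume e: "e > 0"
    hence "e / (t + 1) > 0" using True by simp
    then obtain N where N: "\<And>n r. n \<ge> N \<Longrightarrow> r \<in> {0..t} \<Longrightarrow> dist (f n r) (g r) < e / (t + 1)"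
      using lim unfolding uniform_limit_iff eventually_sequentially by blast
    have "norm (I n - integral {0..t} g) < e" if n: "n \<ge> N" for n
    proof -
      have "((\<lambda>r. f n r - g r) has_integral (I n - integral {0..t} g)) (cbox 0 t)"
        using has_integral_diff[OF int[of n] integrable_integral[OF g]] by simp
      hence "norm (I n - integral {0..t} g) \<le> e / (t + 1) * measure lborel (cbox 0 t)"
        using N[OF n] True e by (intro has_integral_bound) (auto simp: dist_norm intro: less_imp_le)
      also have "\<dots> < e" using True e by (simp add: field_simps)
      finally show ?thesis .
    qed
    thus "\<exists>N. \<forall>n\<ge>N. norm (I n - integral {0..t} g) < e" by blast
  qed
  hence "integral {0..t} g = L" using I LIMSEQ_unique by blast
  thus ?thesis using integrable_integral[OF g] by simp
next
  case False
  hence "I n = 0" for n using int[of n] has_integral_empty_eq[of "f n" "I n"] by simp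
  hence "I = (\<lambda>_. 0)" by auto
  hence "L = 0" using I by (simp add: LIMSEQ_const_iff)
  thus ?thesis using False by simp
qed

lemma has_integral_translate:
  fixes f :: "real \<Rightarrow> 'a::real_normed_vector"
  assumes "(f has_integral y) {s..s + t}"
  shows "((\<lambda>r. f (s + r)) has_integral y) {0..t}"
  using has_integral_affinity'[of f y s "s + t" 1 s] assms by (simp add: add.commute)

lemma continuous_on_atLeastI:
  fixes f :: "real \<Rightarrow> 'a::metric_space"
  assumes "\<And>b. b \<ge> 0 \<Longrightarrow> continuous_on {0..b} f"
  shows "continuous_on {0..} f"
  unfolding continuous_on_iff
proof (intro ballI allI impI)
  fix x e :: real assume x: "x \<in> {0..}" and e: "e > 0"
  have "continuous_on {0..x + 1} f" using assms x by simp
  then obtain d where d: "d > 0" "\<And>y. y \<in> {0..x + 1} \<Longrightarrow> dist y x < d \<Longrightarrow> dist (f y) (f x) < e"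
    using x e unfolding continuous_on_iff by (metis atLeastAtMost_iff atLeast_iff le_add_same_cancel1 zero_le_one)
  show "\<exists>d>0. \<forall>x'\<in>{0..}. dist x' x < d \<longrightarrow> dist (f x') (f x) < e"
    by (intro exI[of _ "min d 1"]) (use d in \<open>auto simp: dist_real_def\<close>)
qed

text \<open>The induction step of the factorial bounds: q times one term of the exponential series
  in q r integrates to the next term. Later q is c^2, the price of one slice.\<close>

lemma has_integral_power_fact:
  fixes q t :: real
  assumes "t \<ge> 0"
  shows "((\<lambda>r. q * (q * r) ^ n / fact n) has_integral (q * t) ^ Suc n / fact (Suc n)) {0..t}"
proof -
  have "((\<lambda>r. (q * r) ^ Suc n / fact (Suc n)) has_vector_derivative q * (q * r) ^ n / fact n) (at r within {0..t})" for r :: real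
  proof -
    have "((\<lambda>r. (q * r) ^ Suc n / fact (Suc n)) has_real_derivative
        real (Suc n) * q * (q * r) ^ n / fact (Suc n)) (at r within {0..t})"
      by (rule DERIV_cdivide) (auto intro!: derivative_eq_intros simp del: power_Suc)
    also have "real (Suc n) * q * (q * r) ^ n / fact (Suc n) = q * (q * r) ^ n / fact n"
      unfolding fact_Suc by (simp del: of_nat_Suc)
    finally show ?thesis unfolding has_real_derivative_iff_has_vector_derivative .
  qed
  from fundamental_theorem_of_calculus[OF assms this] show ?thesis by simp
qed

section \<open>The iterated integrals\<close>

locale flow_in_algebra = flow emb app A0 \<phi>
  for emb :: "'h::complex_hilbert \<Rightarrow> 'p::complex_hilbert"
    and app :: "'p \<Rightarrow> complex \<times> 'k::complex_hilbert \<Rightarrow> 'p"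
    and A0 :: "('h \<Rightarrow>\<^sub>L 'h) set" and \<phi> :: "('h \<Rightarrow>\<^sub>L 'h) \<Rightarrow> ('p \<Rightarrow>\<^sub>L 'p)" +
  fixes A :: "('h \<Rightarrow>\<^sub>L 'h) set"
  assumes A_closed: "closed A" and A_subspace: "cvec.subspace A"
    and A0_A: "A0 \<subseteq> A" and A_dense: "A \<subseteq> closure A0"
    and growth: "A_phi emb app A0 \<phi> = A0"
begin

text \<open>\<open>iter_int \<xi> \<eta> n t x\<close> has the matrix elements of \<open>\<Lambda>\<^sup>n\<^sub>t(\<phi>\<^sub>n(x))\<close> between exponential vectors with
  paths \<open>\<xi> = (1, f)\<close> and \<open>\<eta> = (1, g)\<close>, up to the factor \<open>\<langle>\<epsilon>(f), \<epsilon>(g)\<rangle>\<close>. The latest time is the outermost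
  variable because \<open>\<phi>\<close> acts first in the last tensor factor.\<close>

primrec iter_int :: "(real \<Rightarrow> complex \<times> 'k) \<Rightarrow> (real \<Rightarrow> complex \<times> 'k) \<Rightarrow> nat \<Rightarrow> real \<Rightarrow>
    ('h \<Rightarrow>\<^sub>L 'h) \<Rightarrow> ('h \<Rightarrow>\<^sub>L 'h)" where
  "iter_int \<xi> \<eta> 0 t x = x"
| "iter_int \<xi> \<eta> (Suc n) t x = integral {0..t} (\<lambda>r. iter_int \<xi> \<eta> n r (sl (\<xi> r) (\<eta> r) x))"

definition flow_sum :: "(real \<Rightarrow> complex \<times> 'k) \<Rightarrow> (real \<Rightarrow> complex \<times> 'k) \<Rightarrow> real \<Rightarrow>
    ('h \<Rightarrow>\<^sub>L 'h) \<Rightarrow> ('h \<Rightarrow>\<^sub>L 'h)" where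
  "flow_sum \<xi> \<eta> t x = suminf (\<lambda>n. iter_int \<xi> \<eta> n t x)"

text \<open>Measurability is asked only of the scalars \<langle>\<xi>(r), b \<eta>(r)\<rangle>,
  because no other coefficients occur in slices and k may be nonseparable. Both conditions hold on
  the whole line and are thus stable under translation.\<close>

definition good :: "real \<Rightarrow> (real \<Rightarrow> complex \<times> 'k) \<Rightarrow> (real \<Rightarrow> complex \<times> 'k) \<Rightarrow> bool" where
  "good c \<xi> \<eta> \<longleftrightarrow> (\<forall>r. norm (\<xi> r) \<le> c \<and> norm (\<eta> r) \<le> c) \<and>
    (\<forall>b\<in>bop. (\<lambda>r. cinner (\<xi> r) (blinfun_apply b (\<eta> r))) \<in> borel_measurable borel)"

lemma good_pos: "good c \<xi> \<eta> \<Longrightarrow> 0 \<le> c"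
  using norm_ge_zero order_trans unfolding good_def by blast

lemma good_translate: "good c \<xi> \<eta> \<Longrightarrow> good c (\<lambda>r. \<xi> (s + r)) (\<lambda>r. \<eta> (s + r))"
proof -
  assume g: "good c \<xi> \<eta>"
  have "(\<lambda>r. cinner (\<xi> (s + r)) (blinfun_apply b (\<eta> (s + r)))) \<in> borel_measurable borel" if "b \<in> bop" for b
  proof -
    have "(\<lambda>r. cinner (\<xi> r) (blinfun_apply b (\<eta> r))) \<in> borel_measurable borel"
      using g that by (simp add: good_def)
    from measurable_compose[OF _ this, of "\<lambda>r. s + r" borel] show ?thesis by simp
  qed
  thus ?thesis using g by (auto simp: good_def)
qed

lemma rw_growth:
  assumes "x \<in> A0"
  obtains C M where "C > 0" "M > 0" "\<And>n. norm (rw n x) \<le> C * M ^ n"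
  using assms growth unfolding A_phi_def by blast

text \<open>The endpoint r = t is left out, at the cost of a null set, because truncation to [0,t)
  changes a path there.\<close>

lemma iter_int_cong:
  assumes "\<And>r. 0 \<le> r \<Longrightarrow> r < t \<Longrightarrow> \<xi> r = \<xi>' r \<and> \<eta> r = \<eta>' r"
  shows "iter_int \<xi> \<eta> n t x = iter_int \<xi>' \<eta>' n t x"
  using assms
proof (induction n arbitrary: t x)
  case (Suc n)
  have "integral {0..t} (\<lambda>r. iter_int \<xi> \<eta> n r (sl (\<xi> r) (\<eta> r) x)) =
      integral {0..t} (\<lambda>r. iter_int \<xi>' \<eta>' n r (sl (\<xi>' r) (\<eta>' r) x))"
  proof (rule integral_spike[of "{t}"])
    fix r assume "r \<in> {0..t} - {t}"
    hence r: "0 \<le> r" "r < t" by auto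
    have "iter_int \<xi> \<eta> n r y = iter_int \<xi>' \<eta>' n r y" for y
      by (rule Suc.IH) (use r Suc.prems in auto)
    thus "iter_int \<xi>' \<eta>' n r (sl (\<xi>' r) (\<eta>' r) x) = iter_int \<xi> \<eta> n r (sl (\<xi> r) (\<eta> r) x)"
      using Suc.prems[OF r] by simp
  qed simp
  thus ?case by simp
qed simp

lemma A0_scaleR: "x \<in> A0 \<Longrightarrow> r *\<^sub>R x \<in> A0"
  by (rule csubspace_scaleR[OF A0_subspace])

lemma norm_iter_step:
  assumes g: "good c \<xi> \<eta>" and x: "x \<in> A0"
  shows "norm (rw n (sl (\<xi> r) (\<eta> r) x)) \<le> norm (rw (Suc n) x) * c\<^sup>2"
proof -
  have "norm (\<xi> r) * norm (\<eta> r) \<le> c * c"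
    using g good_pos[OF g] by (intro mult_mono) (auto simp: good_def)
  hence "norm (rw (Suc n) x) * (norm (\<xi> r) * norm (\<eta> r)) \<le> norm (rw (Suc n) x) * c\<^sup>2"
    unfolding power2_eq_square by (intro mult_left_mono) auto
  thus ?thesis using norm_rw_slice[OF x] order_trans by blast
qed

text \<open>Integrability at order n requires linearity and continuity at order n, and these are in
  turn obtained by integrating at the previous order. One induction therefore carries all the
  properties at once.\<close>

lemma
  assumes g: "good c \<xi> \<eta>"
  shows iter_int_props: "(\<forall>t\<ge>0. clinear_on A0 (iter_int \<xi> \<eta> n t)) \<and>
    (\<forall>x\<in>A0. continuous_on {0..} (\<lambda>t. iter_int \<xi> \<eta> n t x)) \<and>
    (\<forall>x\<in>A0. \<forall>t\<ge>0. iter_int \<xi> \<eta> n t x \<in> A \<and>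
       norm (iter_int \<xi> \<eta> n t x) \<le> norm (rw n x) * ((c\<^sup>2 * t) ^ n / fact n))"
    and iter_int_integrable: "\<lbrakk>x \<in> A0; t \<ge> 0\<rbrakk> \<Longrightarrow>
      (\<lambda>r. iter_int \<xi> \<eta> n r (sl (\<xi> r) (\<eta> r) x)) integrable_on {0..t}"
proof -
  \<comment> \<open>The slice is a sum of scalars w(r) times fixed elements a of \<open>A0\<close>.
    By linearity the integrand becomes a finite sum of w(r) times \<open>T r a\<close>, a bounded
    Borel scalar function times a continuous operator function.\<close>
  have integrable: "(\<lambda>r. T r (sl (\<xi> r) (\<eta> r) x)) integrable_on {0..t}"
    if lin: "\<And>t. t \<ge> 0 \<Longrightarrow> clinear_on A0 (T t)" and cont: "\<And>x. x \<in> A0 \<Longrightarrow> continuous_on {0..} (\<lambda>t. T t x)"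
      and x: "x \<in> A0" and t: "t \<ge> 0" for T :: "real \<Rightarrow> ('h \<Rightarrow>\<^sub>L 'h) \<Rightarrow> ('h \<Rightarrow>\<^sub>L 'h)" and x and t :: real
  proof -
    obtain ab where ab: "set ab \<subseteq> A0 \<times> bop" "\<phi> x = (\<Sum>(a, b)\<leftarrow>ab. tensor1 emb app a b)"
      using phi_list[OF x] by blast
    have ab': "set ab \<subseteq> A0 \<times> UNIV" using ab by auto
    define w where "w b r = cinner (\<xi> r) (blinfun_apply b (\<eta> r))" for b r
    have "T r (sl (\<xi> r) (\<eta> r) x) = (\<Sum>(a, b)\<leftarrow>ab. w b r *\<^sub>C T r a)" if "r \<in> {0..t}" for r
      unfolding slice_list[OF ab]
      using clinear_on_sum_list[OF lin A0_subspace ab', of r "\<lambda>b. w b r"] that by (simp add: w_def)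
    moreover have "(\<lambda>r. \<Sum>(a, b)\<leftarrow>ab. w b r *\<^sub>C T r a) integrable_on {0..t}"
      using ab(1)
    proof (induction ab)
      case (Cons q ab)
      obtain a b where q: "q = (a, b)" by fastforce
      have a: "a \<in> A0" "b \<in> bop" using Cons q by auto
      have "(\<lambda>r. w b r *\<^sub>C T r a) integrable_on {0..t}"
      proof (rule integrable_on_scaleC_continuous)
        show "w b \<in> borel_measurable borel" using g a(2) by (simp add: good_def w_def[abs_def])
        show "cmod (w b r) \<le> c * (norm b * c)" for r
        proof -
          have "cmod (w b r) \<le> norm (\<xi> r) * norm (blinfun_apply b (\<eta> r))"
            unfolding w_def by (rule cauchy_schwarz)
          also have "\<dots> \<le> c * (norm b * c)"
            using g good_pos[OF g] norm_blinfun[of b "\<eta> r"]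
            by (intro mult_mono order_trans[OF norm_blinfun] mult_left_mono) (auto simp: good_def)
          finally show ?thesis .
        qed
        show "continuous_on {0..t} (\<lambda>r. T r a)" by (rule continuous_on_subset[OF cont[OF a(1)]]) auto
      qed
      thus ?case using Cons by (auto simp: q intro!: integrable_add)
    qed (simp add: integrable_0)
    ultimately show ?thesis
      by (subst integrable_cong[where g = "\<lambda>r. \<Sum>(a, b)\<leftarrow>ab. w b r *\<^sub>C T r a"]) blast+
  qed
  have main: "(\<forall>t\<ge>0. clinear_on A0 (iter_int \<xi> \<eta> n t)) \<and>
    (\<forall>x\<in>A0. continuous_on {0..} (\<lambda>t. iter_int \<xi> \<eta> n t x)) \<and>
    (\<forall>x\<in>A0. \<forall>t\<ge>0. iter_int \<xi> \<eta> n t x \<in> A \<and>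
       norm (iter_int \<xi> \<eta> n t x) \<le> norm (rw n x) * ((c\<^sup>2 * t) ^ n / fact n))" for n
  proof (induction n)
    case 0
    show ?case using A0_A norm_le_rw0 by (auto simp: clinear_on_def simp del: random_walk.simps)
  next
    case (Suc n)
    hence lin: "\<And>t. t \<ge> 0 \<Longrightarrow> clinear_on A0 (iter_int \<xi> \<eta> n t)"
      and cont: "\<And>x. x \<in> A0 \<Longrightarrow> continuous_on {0..} (\<lambda>t. iter_int \<xi> \<eta> n t x)"
      and inA: "\<And>x t. x \<in> A0 \<Longrightarrow> t \<ge> 0 \<Longrightarrow> iter_int \<xi> \<eta> n t x \<in> A"
      and bd: "\<And>x t. x \<in> A0 \<Longrightarrow> t \<ge> 0 \<Longrightarrow> norm (iter_int \<xi> \<eta> n t x) \<le> norm (rw n x) * ((c\<^sup>2 * t) ^ n / fact n)"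
      by auto
    note int = integrable[OF lin cont]
    define f where "f x r = iter_int \<xi> \<eta> n r (sl (\<xi> r) (\<eta> r) x)" for x r
    have fint: "f x integrable_on {0..t}" if "x \<in> A0" "t \<ge> 0" for x t
      unfolding f_def[abs_def] by (rule int) (use that in auto)
    have it: "iter_int \<xi> \<eta> (Suc n) t x = integral {0..t} (f x)" for t x by (simp add: f_def[abs_def])
    have add: "f (x + y) r = f x r + f y r" if "x \<in> A0" "y \<in> A0" "r \<in> {0..t}" for x y r t
      using that lin[of r] slice_clinear[of "\<xi> r" "\<eta> r"] slice_A0 by (auto simp: f_def clinear_on_def)
    have sc: "f (q *\<^sub>C x) r = q *\<^sub>C f x r" if "x \<in> A0" "r \<in> {0..t}" for x r q t
      using that lin[of r] slice_clinear[of "\<xi> r" "\<eta> r"] slice_A0 by (auto simp: f_def clinear_on_def)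
    have c1: "clinear_on A0 (iter_int \<xi> \<eta> (Suc n) t)" if t: "t \<ge> 0" for t
      unfolding clinear_on_def it
    proof (intro conjI ballI allI)
      fix x y assume xy: "x \<in> A0" "y \<in> A0"
      have "integral {0..t} (f (x + y)) = integral {0..t} (\<lambda>r. f x r + f y r)"
        by (rule integral_cong) (rule add[OF xy])
      thus "integral {0..t} (f (x + y)) = integral {0..t} (f x) + integral {0..t} (f y)"
        using integral_add[OF fint[OF xy(1) t] fint[OF xy(2) t]] by simp
    next
      fix q x assume x: "x \<in> A0"
      have "integral {0..t} (f (q *\<^sub>C x)) = integral {0..t} ((\<lambda>T. q *\<^sub>C T) \<circ> f x)"
        by (rule integral_cong, unfold o_def, rule sc[OF x])
      thus "integral {0..t} (f (q *\<^sub>C x)) = q *\<^sub>C integral {0..t} (f x)"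
        using integral_linear[OF fint[OF x t]
          bounded_bilinear.bounded_linear_right[OF bounded_bilinear_scaleC_blinfun]] by simp
    qed
    have c2: "continuous_on {0..} (\<lambda>t. iter_int \<xi> \<eta> (Suc n) t x)" if x: "x \<in> A0" for x
      unfolding it by (intro continuous_on_atLeastI indefinite_integral_continuous_1 fint x)
    have c3: "iter_int \<xi> \<eta> (Suc n) t x \<in> A" if x: "x \<in> A0" and t: "t \<ge> 0" for x t
      unfolding it
      by (rule has_integral_closed_subspace(1)[OF csubspace_subspace[OF A_subspace] A_closed _
            integrable_integral[OF fint[OF x t]]])
         (use x inA slice_A0 in \<open>auto simp: f_def\<close>)
    have c4: "norm (iter_int \<xi> \<eta> (Suc n) t x) \<le> norm (rw (Suc n) x) * ((c\<^sup>2 * t) ^ Suc n / fact (Suc n))"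
      if x: "x \<in> A0" and t: "t \<ge> 0" for x t
    proof -
      have hi: "((\<lambda>r. norm (rw (Suc n) x) * (c\<^sup>2 * (c\<^sup>2 * r) ^ n / fact n)) has_integral
          norm (rw (Suc n) x) * ((c\<^sup>2 * t) ^ Suc n / fact (Suc n))) {0..t}"
        by (rule has_integral_mult_right[OF has_integral_power_fact[OF t]])
      have "norm (integral {0..t} (f x)) \<le>
          integral {0..t} (\<lambda>r. norm (rw (Suc n) x) * (c\<^sup>2 * (c\<^sup>2 * r) ^ n / fact n))"
      proof (rule integral_norm_bound_integral[OF fint[OF x t] has_integral_integrable[OF hi]])
        fix r assume r: "r \<in> {0..t}"
        have "norm (f x r) \<le> norm (rw n (sl (\<xi> r) (\<eta> r) x)) * ((c\<^sup>2 * r) ^ n / fact n)"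
          unfolding f_def using r x by (intro bd slice_A0) auto
        also have "\<dots> \<le> (norm (rw (Suc n) x) * c\<^sup>2) * ((c\<^sup>2 * r) ^ n / fact n)"
          using r by (intro mult_right_mono norm_iter_step[OF g x]) auto
        finally show "norm (f x r) \<le> norm (rw (Suc n) x) * (c\<^sup>2 * (c\<^sup>2 * r) ^ n / fact n)"
          by (simp add: mult.assoc)
      qed
      thus ?thesis unfolding it integral_unique[OF hi] .
    qed
    show ?case using c1 c2 c3 c4 by blast
  qed
  show "(\<forall>t\<ge>0. clinear_on A0 (iter_int \<xi> \<eta> n t)) \<and>
    (\<forall>x\<in>A0. continuous_on {0..} (\<lambda>t. iter_int \<xi> \<eta> n t x)) \<and>
    (\<forall>x\<in>A0. \<forall>t\<ge>0. iter_int \<xi> \<eta> n t x \<in> A \<and>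
       norm (iter_int \<xi> \<eta> n t x) \<le> norm (rw n x) * ((c\<^sup>2 * t) ^ n / fact n))"
    by (rule main)
  show "(\<lambda>r. iter_int \<xi> \<eta> n r (sl (\<xi> r) (\<eta> r) x)) integrable_on {0..t}" if "x \<in> A0" "t \<ge> 0"
    by (rule integrable) (use main[of n] that in auto)
qed

lemma iter_int_continuous: "good c \<xi> \<eta> \<Longrightarrow> x \<in> A0 \<Longrightarrow> continuous_on {0..} (\<lambda>t. iter_int \<xi> \<eta> n t x)"
  and iter_int_A: "good c \<xi> \<eta> \<Longrightarrow> x \<in> A0 \<Longrightarrow> t \<ge> 0 \<Longrightarrow> iter_int \<xi> \<eta> n t x \<in> A"
  and norm_iter_int: "good c \<xi> \<eta> \<Longrightarrow> x \<in> A0 \<Longrightarrow> t \<ge> 0 \<Longrightarrow>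
      norm (iter_int \<xi> \<eta> n t x) \<le> norm (rw n x) * ((c\<^sup>2 * t) ^ n / fact n)"
  using iter_int_props by blast+

text \<open>One majorant for the series itself and for the series of integrands in the flow
  equation. In the factor 1 + M c^2 the 1 serves x, and M c^2 pays for the additional step of the
  walk and the norms of the path vectors.\<close>

lemma iter_int_uniform_bound:
  assumes g: "good c \<xi> \<eta>" and x: "x \<in> A0" and b: "b \<ge> 0"
  shows "\<exists>B. summable B \<and> (\<forall>n. \<forall>t\<in>{0..b}. norm (iter_int \<xi> \<eta> n t x) \<le> B n \<and>
    norm (iter_int \<xi> \<eta> n t (sl (\<xi> t) (\<eta> t) x)) \<le> B n)"
proof -
  obtain C M where CM: "C > 0" "M > 0" "\<And>n. norm (rw n x) \<le> C * M ^ n" using rw_growth[OF x] by blast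
  define B where "B n = (C * (1 + M * c\<^sup>2)) * ((M * (c\<^sup>2 * b)) ^ n / fact n)" for n
  have "summable B"
    unfolding B_def using summable_exp[of "M * (c\<^sup>2 * b)"]
    by (intro summable_mult) (simp add: divide_inverse mult.commute)
  moreover have gen: "norm T \<le> B n" if T: "norm T \<le> D * ((c\<^sup>2 * t) ^ n / fact n)"
    and D: "D \<le> C * M ^ n * (1 + M * c\<^sup>2)" and t: "t \<in> {0..b}" for n t D and T :: "'h \<Rightarrow>\<^sub>L 'h"
  proof -
    have "norm T \<le> (C * M ^ n * (1 + M * c\<^sup>2)) * ((c\<^sup>2 * b) ^ n / fact n)"
    proof (rule order_trans[OF T], rule mult_mono[OF D])
      show "(c\<^sup>2 * t) ^ n / fact n \<le> (c\<^sup>2 * b) ^ n / fact n"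
        using t by (intro divide_right_mono power_mono mult_left_mono) auto
    qed (use t CM in auto)
    thus ?thesis by (simp add: B_def power_mult_distrib mult_ac)
  qed
  moreover have "norm (iter_int \<xi> \<eta> n t x) \<le> B n" if t: "t \<in> {0..b}" for n t
  proof (rule gen[OF norm_iter_int[OF g x] _ t])
    show "norm (rw n x) \<le> C * M ^ n * (1 + M * c\<^sup>2)"
      using CM(1,2) by (intro order_trans[OF CM(3)]) (simp add: distrib_left)
  qed (use t in auto)
  moreover have "norm (iter_int \<xi> \<eta> n t (sl (\<xi> t) (\<eta> t) x)) \<le> B n" if t: "t \<in> {0..b}" for n t
  proof (rule gen[OF norm_iter_int[OF g slice_A0[OF x]] _ t])
    have "norm (rw (Suc n) x) * c\<^sup>2 \<le> C * M ^ Suc n * c\<^sup>2" by (intro mult_right_mono CM) simp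
    also have "\<dots> \<le> C * M ^ n * (1 + M * c\<^sup>2)" using CM(1,2) by (simp add: algebra_simps)
    finally show "norm (rw n (sl (\<xi> t) (\<eta> t) x)) \<le> C * M ^ n * (1 + M * c\<^sup>2)"
      using norm_iter_step[OF g x] order_trans by blast
  qed (use t in auto)
  ultimately show ?thesis by blast
qed

section \<open>The sum of the iterated integrals and its integral equation\<close>

lemma iter_int_summable:
  assumes g: "good c \<xi> \<eta>" and x: "x \<in> A0" and t: "t \<ge> 0"
  shows "summable (\<lambda>n. iter_int \<xi> \<eta> n t x)"
proof -
  obtain B where "summable B" "\<And>n t'. t' \<in> {0..t} \<Longrightarrow> norm (iter_int \<xi> \<eta> n t' x) \<le> B n"
    using iter_int_uniform_bound[OF g x t] by blast
  thus ?thesis using t by (auto intro: summable_comparison_test'[of B 0])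
qed

lemma flow_sum_sums:
  "good c \<xi> \<eta> \<Longrightarrow> x \<in> A0 \<Longrightarrow> t \<ge> 0 \<Longrightarrow> (\<lambda>n. iter_int \<xi> \<eta> n t x) sums flow_sum \<xi> \<eta> t x"
  unfolding flow_sum_def by (rule summable_sums[OF iter_int_summable])

lemma flow_sum_A:
  assumes g: "good c \<xi> \<eta>" and x: "x \<in> A0" and t: "t \<ge> 0"
  shows "flow_sum \<xi> \<eta> t x \<in> A"
proof (rule closed_sequentially[OF A_closed])
  show "(\<lambda>N. \<Sum>n<N. iter_int \<xi> \<eta> n t x) \<longlonglongrightarrow> flow_sum \<xi> \<eta> t x"
    using flow_sum_sums[OF assms] by (simp add: sums_def)
  show "\<And>N. (\<Sum>n<N. iter_int \<xi> \<eta> n t x) \<in> A"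
    by (intro cvec.subspace_sum A_subspace iter_int_A[OF assms])
qed

lemma flow_sum_continuous:
  assumes g: "good c \<xi> \<eta>" and x: "x \<in> A0"
  shows "continuous_on {0..} (\<lambda>t. flow_sum \<xi> \<eta> t x)"
proof (rule continuous_on_atLeastI)
  fix b :: real assume b: "b \<ge> 0"
  obtain B where B: "summable B" "\<And>n t. t \<in> {0..b} \<Longrightarrow> norm (iter_int \<xi> \<eta> n t x) \<le> B n"
    using iter_int_uniform_bound[OF g x b] by blast
  have "uniform_limit {0..b} (\<lambda>N t. \<Sum>n<N. iter_int \<xi> \<eta> n t x) (\<lambda>t. flow_sum \<xi> \<eta> t x) sequentially"
    unfolding flow_sum_def by (rule Weierstrass_m_test[OF B(2,1)])
  moreover have "continuous_on {0..b} (\<lambda>t. \<Sum>n<N. iter_int \<xi> \<eta> n t x)" for N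
    by (intro continuous_on_sum continuous_on_subset[OF iter_int_continuous[OF g x]]) auto
  ultimately show "continuous_on {0..b} (\<lambda>t. flow_sum \<xi> \<eta> t x)"
    by (intro uniform_limit_theorem[where F = sequentially]) auto
qed

text \<open>Summing the recursion: the integral of the integrand of order n is the term of order n +
  1, so only the term of order zero, x itself, is missing on the right.\<close>

lemma flow_sum_integral:
  assumes g: "good c \<xi> \<eta>" and x: "x \<in> A0" and t: "t \<ge> 0"
  shows "((\<lambda>r. flow_sum \<xi> \<eta> r (sl (\<xi> r) (\<eta> r) x)) has_integral (flow_sum \<xi> \<eta> t x - x)) {0..t}"
proof -
  obtain B where B: "summable B"
    "\<And>n r. r \<in> {0..t} \<Longrightarrow> norm (iter_int \<xi> \<eta> n r (sl (\<xi> r) (\<eta> r) x)) \<le> B n"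
    using iter_int_uniform_bound[OF g x t] by blast
  show ?thesis
  proof (rule uniform_limit_has_integral)
    show "uniform_limit {0..t} (\<lambda>N r. \<Sum>n<N. iter_int \<xi> \<eta> n r (sl (\<xi> r) (\<eta> r) x))
        (\<lambda>r. flow_sum \<xi> \<eta> r (sl (\<xi> r) (\<eta> r) x)) sequentially"
      unfolding flow_sum_def by (rule Weierstrass_m_test[OF B(2,1)])
    show "((\<lambda>r. \<Sum>n<N. iter_int \<xi> \<eta> n r (sl (\<xi> r) (\<eta> r) x)) has_integral
        (\<Sum>n<N. iter_int \<xi> \<eta> (Suc n) t x)) {0..t}" for N
      unfolding iter_int.simps
      by (intro has_integral_sum integrable_integral iter_int_integrable[OF g x t]) auto
    have "(\<lambda>n. iter_int \<xi> \<eta> (Suc n) t x) sums (flow_sum \<xi> \<eta> t x - iter_int \<xi> \<eta> 0 t x)"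
      using flow_sum_sums[OF assms] sums_Suc_iff[of "\<lambda>n. iter_int \<xi> \<eta> n t x"] by (simp del: iter_int.simps)
    thus "(\<lambda>N. \<Sum>n<N. iter_int \<xi> \<eta> (Suc n) t x) \<longlonglongrightarrow> flow_sum \<xi> \<eta> t x - x"
      by (simp add: sums_def)
  qed
qed

text \<open>The bound by \<open>norm x\<close> starts an induction on the scale of the walk, since
  \<open>norm x\<close> is at most \<open>norm (rw 0 x)\<close>. Substituting the homogeneous
  equation into itself n times raises the index to n and gains (c^2 t)^n / n!, which beats the
  exponential growth of the walk.\<close>

lemma flow_equation_unique:
  fixes D :: "real \<Rightarrow> ('h \<Rightarrow>\<^sub>L 'h) \<Rightarrow> 'b::banach"
  assumes g: "good c \<xi> \<eta>"
    and bd: "\<And>t x. t \<ge> 0 \<Longrightarrow> x \<in> A0 \<Longrightarrow> norm (D t x) \<le> K * norm x"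
    and int: "\<And>t x. t \<ge> 0 \<Longrightarrow> x \<in> A0 \<Longrightarrow>
      ((\<lambda>r. D r (sl (\<xi> r) (\<eta> r) x)) has_integral D t x) {0..t}"
    and x: "x \<in> A0" and t: "t \<ge> 0"
  shows "D t x = 0"
proof -
  have bd': "norm (D t x) \<le> \<bar>K\<bar> * norm x" if "t \<ge> 0" "x \<in> A0" for t x
    by (rule order_trans[OF bd[OF that]]) (simp add: mult_right_mono)
  have "norm (D t x) \<le> \<bar>K\<bar> * norm (rw n x) * ((c\<^sup>2 * t) ^ n / fact n)" if "t \<ge> 0" "x \<in> A0" for n t x
    using that
  proof (induction n arbitrary: t x)
    case 0
    have "\<bar>K\<bar> * norm x \<le> \<bar>K\<bar> * norm (rw 0 x)" using 0 by (intro mult_left_mono norm_le_rw0) auto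
    thus ?case using bd'[OF 0] by (simp del: random_walk.simps)
  next
    case (Suc n)
    have hi: "((\<lambda>r. \<bar>K\<bar> * norm (rw (Suc n) x) * (c\<^sup>2 * (c\<^sup>2 * r) ^ n / fact n)) has_integral
          \<bar>K\<bar> * norm (rw (Suc n) x) * ((c\<^sup>2 * t) ^ Suc n / fact (Suc n))) {0..t}"
      by (rule has_integral_mult_right[OF has_integral_power_fact[OF Suc.prems(1)]])
    note i = int[OF Suc.prems]
    have "norm (integral {0..t} (\<lambda>r. D r (sl (\<xi> r) (\<eta> r) x))) \<le>
        integral {0..t} (\<lambda>r. \<bar>K\<bar> * norm (rw (Suc n) x) * (c\<^sup>2 * (c\<^sup>2 * r) ^ n / fact n))"
    proof (rule integral_norm_bound_integral[OF has_integral_integrable[OF i] has_integral_integrable[OF hi]])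
      fix r assume r: "r \<in> {0..t}"
      have "norm (D r (sl (\<xi> r) (\<eta> r) x)) \<le>
          \<bar>K\<bar> * norm (rw n (sl (\<xi> r) (\<eta> r) x)) * ((c\<^sup>2 * r) ^ n / fact n)"
        using r Suc.prems by (intro Suc.IH slice_A0) auto
      also have "\<dots> \<le> \<bar>K\<bar> * (norm (rw (Suc n) x) * c\<^sup>2) * ((c\<^sup>2 * r) ^ n / fact n)"
        using r Suc.prems by (intro mult_right_mono mult_left_mono norm_iter_step[OF g]) auto
      finally show "norm (D r (sl (\<xi> r) (\<eta> r) x)) \<le> \<bar>K\<bar> * norm (rw (Suc n) x) * (c\<^sup>2 * (c\<^sup>2 * r) ^ n / fact n)"
        by (simp add: mult.assoc)
    qed
    thus ?case unfolding integral_unique[OF i] integral_unique[OF hi] .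
  qed
  from this[OF t x] have le: "norm (D t x) \<le> \<bar>K\<bar> * norm (rw n x) * ((c\<^sup>2 * t) ^ n / fact n)" for n .
  obtain C M where CM: "C > 0" "M > 0" "\<And>n. norm (rw n x) \<le> C * M ^ n" using rw_growth[OF x] by blast
  have le2: "norm (D t x) \<le> (\<bar>K\<bar> * C) * ((M * (c\<^sup>2 * t)) ^ n / fact n)" for n
  proof -
    have "norm (D t x) \<le> \<bar>K\<bar> * (C * M ^ n) * ((c\<^sup>2 * t) ^ n / fact n)"
      using t by (intro order_trans[OF le[of n]] mult_right_mono mult_left_mono CM) auto
    thus ?thesis by (simp add: power_mult_distrib mult_ac)
  qed
  have "summable (\<lambda>n. (M * (c\<^sup>2 * t)) ^ n / fact n)"
    using summable_exp[of "M * (c\<^sup>2 * t)"] by (simp add: divide_inverse mult.commute)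
  hence "(\<lambda>n. (\<bar>K\<bar> * C) * ((M * (c\<^sup>2 * t)) ^ n / fact n)) \<longlonglongrightarrow> (\<bar>K\<bar> * C) * 0"
    by (intro tendsto_mult tendsto_const summable_LIMSEQ_zero)
  hence "norm (D t x) \<le> 0"
    using le2 by (intro LIMSEQ_le_const[where X = "\<lambda>n. (\<bar>K\<bar> * C) * ((M * (c\<^sup>2 * t)) ^ n / fact n)"]) auto
  thus ?thesis by simp
qed

text \<open>As functions of \<open>t\<close>, both sides solve the integral equation of the translated paths.\<close>

lemma flow_sum_cocycle:
  fixes \<Phi> :: "real \<Rightarrow> ('h \<Rightarrow>\<^sub>L 'h) \<Rightarrow> ('h \<Rightarrow>\<^sub>L 'h)"
  assumes g: "good c \<xi> \<eta>" and s: "s \<ge> 0"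
    and lin: "\<And>r. r \<ge> 0 \<Longrightarrow> clinear_on A (\<Phi> r)"
    and bd: "\<And>r a. r \<ge> 0 \<Longrightarrow> a \<in> A \<Longrightarrow> norm (\<Phi> r a) \<le> K * norm a"
    and eq: "\<And>r x. r \<ge> 0 \<Longrightarrow> x \<in> A0 \<Longrightarrow> \<Phi> r x = flow_sum \<xi> \<eta> r x"
    and bd2: "\<And>r x. r \<ge> 0 \<Longrightarrow> x \<in> A0 \<Longrightarrow>
      norm (flow_sum (\<lambda>r. \<xi> (s + r)) (\<lambda>r. \<eta> (s + r)) r x) \<le> K' * norm x"
    and x: "x \<in> A0" and t: "t \<ge> 0"
  shows "\<Phi> (s + t) x = \<Phi> s (flow_sum (\<lambda>r. \<xi> (s + r)) (\<lambda>r. \<eta> (s + r)) t x)"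
proof -
  let ?\<xi> = "\<lambda>r. \<xi> (s + r)" and ?\<eta> = "\<lambda>r. \<eta> (s + r)"
  note g' = good_translate[OF g, of s]
  define G where "G = flow_sum ?\<xi> ?\<eta>"
  have GA: "G r y \<in> A" if "r \<ge> 0" "y \<in> A0" for r y
    unfolding G_def using flow_sum_A[OF g' that(2,1)] .
  have \<Phi>_diff: "\<Phi> s (a - b) = \<Phi> s a - \<Phi> s b" if "a \<in> A" "b \<in> A" for a b
  proof -
    have "\<Phi> s (a + (-1) *\<^sub>C b) = \<Phi> s a + \<Phi> s ((-1) *\<^sub>C b)"
      using lin[OF s] that A_subspace unfolding clinear_on_def by (metis cvec.subspace_scale)
    also have "\<Phi> s ((-1) *\<^sub>C b) = (-1) *\<^sub>C \<Phi> s b" using lin[OF s] that unfolding clinear_on_def by blast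
    finally show ?thesis by simp
  qed
  \<comment> \<open>Both sides have the same initial term \<open>\<Phi> s y\<close>, which cancels
    in the difference and leaves a homogeneous equation.\<close>
  define D where "D r y = \<Phi> (s + r) y - \<Phi> s (G r y)" for r y
  have "D t x = 0"
  proof (rule flow_equation_unique[OF g', where D = D and K = "\<bar>K\<bar> + \<bar>K\<bar> * \<bar>K'\<bar>"])
    fix r :: real and y assume r: "r \<ge> 0" and y: "y \<in> A0"
    have yA: "y \<in> A" using y A0_A by auto
    have "norm (\<Phi> (s + r) y) \<le> \<bar>K\<bar> * norm y"
      using bd[of "s + r" y] r s yA mult_right_mono[of K "\<bar>K\<bar>" "norm y"] by force
    moreover have "norm (\<Phi> s (G r y)) \<le> \<bar>K\<bar> * (\<bar>K'\<bar> * norm y)"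
    proof -
      have "norm (\<Phi> s (G r y)) \<le> \<bar>K\<bar> * norm (G r y)"
        using bd[OF s GA[OF r y]] mult_right_mono[of K "\<bar>K\<bar>" "norm (G r y)"] by force
      also have "norm (G r y) \<le> \<bar>K'\<bar> * norm y"
        unfolding G_def using bd2[OF r y] mult_right_mono[of K' "\<bar>K'\<bar>" "norm y"] by force
      finally show ?thesis by (simp add: mult_left_mono)
    qed
    ultimately show "norm (D r y) \<le> (\<bar>K\<bar> + \<bar>K\<bar> * \<bar>K'\<bar>) * norm y"
      unfolding D_def using norm_triangle_ineq4[of "\<Phi> (s + r) y" "\<Phi> s (G r y)"]
      by (simp add: algebra_simps)
    let ?f = "\<lambda>u. flow_sum \<xi> \<eta> u (sl (\<xi> u) (\<eta> u) y)"
    have i1: "(?f has_integral (flow_sum \<xi> \<eta> s y - y)) {0..s}"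
      and i2: "(?f has_integral (flow_sum \<xi> \<eta> (s + r) y - y)) {0..s + r}"
      using s r by (auto intro!: flow_sum_integral[OF g y])
    \<comment> \<open>Subtracting the equation on [0,s] from the one on [0,s+r] and translating by s
      shows that \<open>\<Phi> (s + r)\<close> solves the equation of the translated paths with
      initial term \<open>\<Phi> s y\<close>.\<close>
    have "?f integrable_on {s..s + r}"
      by (rule integrable_on_subinterval[OF has_integral_integrable[OF i2]]) (use s in auto)
    then obtain I where I: "(?f has_integral I) {s..s + r}" by (auto simp: integrable_on_def)
    have "(?f has_integral (flow_sum \<xi> \<eta> s y - y) + I) {0..s + r}"
      by (rule has_integral_combine[OF _ _ i1 I]) (use s r in auto)
    from has_integral_unique[OF this i2]
    have "(flow_sum \<xi> \<eta> s y - y) + I = flow_sum \<xi> \<eta> (s + r) y - y" .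
    hence "I = \<Phi> (s + r) y - \<Phi> s y" using eq y s r by (simp add: algebra_simps)
    with has_integral_translate[OF I]
    have j1: "((\<lambda>u. ?f (s + u)) has_integral (\<Phi> (s + r) y - \<Phi> s y)) {0..r}" by simp
    \<comment> \<open>Applying \<open>\<Phi> s\<close> under the integral of the equation for G
      gives the second solution; \<open>\<Phi> s\<close> is controlled on \<open>A\<close> only, and
      G takes its values there.\<close>
    have "((\<lambda>u. \<Phi> s (G u (sl (?\<xi> u) (?\<eta> u) y))) has_integral \<Phi> s (G r y - y)) {0..r}"
    proof (rule has_integral_closed_subspace(2)[OF csubspace_subspace[OF A_subspace] A_closed _ _ _ _ bd[OF s]])
      show "((\<lambda>u. G u (sl (?\<xi> u) (?\<eta> u) y)) has_integral (G r y - y)) {0..r}"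
        unfolding G_def by (rule flow_sum_integral[OF g' y r])
      show "G u (sl (?\<xi> u) (?\<eta> u) y) \<in> A" if "u \<in> {0..r}" for u
        using that y by (intro GA slice_A0) auto
    qed (use lin[OF s] in \<open>auto simp: clinear_on_def scaleR_scaleC\<close>)
    hence j2: "((\<lambda>u. \<Phi> s (G u (sl (?\<xi> u) (?\<eta> u) y))) has_integral (\<Phi> s (G r y) - \<Phi> s y)) {0..r}"
      using \<Phi>_diff[OF GA[OF r y] yA] by simp
    have j: "((\<lambda>u. ?f (s + u) - \<Phi> s (G u (sl (?\<xi> u) (?\<eta> u) y))) has_integral D r y) {0..r}"
      using has_integral_diff[OF j1 j2] by (simp add: D_def)
    have "?f (s + u) = \<Phi> (s + u) (sl (\<xi> (s + u)) (\<eta> (s + u)) y)" if "u \<in> {0..r}" for u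
      using that s y by (subst eq) (auto intro: slice_A0)
    hence "((\<lambda>u. D u (sl (?\<xi> u) (?\<eta> u) y)) has_integral D r y) {0..r} \<longleftrightarrow>
        ((\<lambda>u. ?f (s + u) - \<Phi> s (G u (sl (?\<xi> u) (?\<eta> u) y))) has_integral D r y) {0..r}"
      by (intro has_integral_cong) (simp add: D_def del: atLeastAtMost_iff)
    thus "((\<lambda>u. D u (sl (?\<xi> u) (?\<eta> u) y)) has_integral D r y) {0..r}" using j by blast
  qed (use x t in auto)
  thus ?thesis by (simp add: D_def G_def)
qed

end


section \<open>Integrals over the simplex of times\<close>

text \<open>Fubini with the inserted coordinate as the outer variable, which is the order in which
  the latest time is integrated last.\<close>

lemma (in product_sigma_finite) product_integral_insert_rev:
  fixes f :: "_ \<Rightarrow> _::{banach, second_countable_topology}"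
  assumes I: "finite I" "i \<notin> I" and f: "integrable (Pi\<^sub>M (insert i I) M) f"
  shows "integrable (M i) (\<lambda>y. \<integral>z. f (z(i := y)) \<partial>Pi\<^sub>M I M)"
    and "integral\<^sup>L (Pi\<^sub>M (insert i I) M) f = (\<integral>y. (\<integral>z. f (z(i := y)) \<partial>Pi\<^sub>M I M) \<partial>M i)"
proof -
  interpret I: finite_product_sigma_finite M I by standard fact
  interpret P: pair_sigma_finite "M i" "Pi\<^sub>M I M" ..
  have [measurable]: "f \<in> borel_measurable (Pi\<^sub>M (insert i I) M)" using f by auto
  have meas [measurable]: "(\<lambda>(y, z). f (z(i := y))) \<in> borel_measurable (M i \<Otimes>\<^sub>M Pi\<^sub>M I M)"
    by measurable
  have "(\<integral>\<^sup>+ p. ennreal (norm (case p of (y, z) \<Rightarrow> f (z(i := y)))) \<partial>(M i \<Otimes>\<^sub>M Pi\<^sub>M I M)) =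
      (\<integral>\<^sup>+ y. (\<integral>\<^sup>+ z. ennreal (norm (f (z(i := y)))) \<partial>Pi\<^sub>M I M) \<partial>M i)"
    by (subst I.nn_integral_fst[symmetric]) auto
  also have "\<dots> = (\<integral>\<^sup>+ z. ennreal (norm (f z)) \<partial>Pi\<^sub>M (insert i I) M)"
    by (subst product_nn_integral_insert_rev[OF I]) auto
  also have "\<dots> < \<infinity>" using f by (simp add: integrable_iff_bounded)
  finally have int: "integrable (M i \<Otimes>\<^sub>M Pi\<^sub>M I M) (\<lambda>(y, z). f (z(i := y)))"
    by (simp add: integrable_iff_bounded meas)
  show "integrable (M i) (\<lambda>y. \<integral>z. f (z(i := y)) \<partial>Pi\<^sub>M I M)"
    using P.integrable_fst'[OF int] by simp
  show "integral\<^sup>L (Pi\<^sub>M (insert i I) M) f = (\<integral>y. (\<integral>z. f (z(i := y)) \<partial>Pi\<^sub>M I M) \<partial>M i)"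
    unfolding product_integral_insert[OF I f] by (rule P.Fubini_integral[OF int])
qed

text \<open>With the latest time fixed at \<open>y\<close>, the earlier times range over \<open>open_simplex n y\<close>, both for the
  open and for the closed simplex; so the induction runs over the half-open sets.\<close>

definition open_simplex :: "nat \<Rightarrow> real \<Rightarrow> (nat \<Rightarrow> real) set"
  where "open_simplex n t = {\<tau> \<in> {..<n} \<rightarrow>\<^sub>E {0..<t}. \<forall>i j. i < j \<and> j < n \<longrightarrow> \<tau> i < \<tau> j}"

lemma fun_upd_open_simplex:
  assumes "z \<in> extensional {..<n}"
  shows "z(n := y) \<in> open_simplex (Suc n) t \<longleftrightarrow> y \<in> {0..<t} \<and> z \<in> open_simplex n y"
proof
  assume L: "z(n := y) \<in> open_simplex (Suc n) t"
  hence y: "y \<in> {0..<t}" and z: "\<And>i. i < n \<Longrightarrow> 0 \<le> z i"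
    by (auto simp: open_simplex_def PiE_iff less_Suc_eq split: if_splits)
  have lt: "\<forall>i j. i < j \<and> j < Suc n \<longrightarrow> (z(n := y)) i < (z(n := y)) j"
    using L by (simp add: open_simplex_def)
  have "z i < y" if "i < n" for i using lt[rule_format, of i n] that by simp
  moreover have "z i < z j" if "i < j" "j < n" for i j using lt[rule_format, of i j] that by simp
  ultimately show "y \<in> {0..<t} \<and> z \<in> open_simplex n y"
    using y z assms by (auto simp: open_simplex_def PiE_iff)
next
  assume R: "y \<in> {0..<t} \<and> z \<in> open_simplex n y"
  hence "z i \<in> {0..<y}" if "i < n" for i
    using that by (simp add: open_simplex_def PiE_iff)
  hence "z i < t" if "i < n" for i
    using that R by force
  thus "z(n := y) \<in> open_simplex (Suc n) t"
    using assms R by (auto simp: open_simplex_def PiE_iff less_Suc_eq extensional_def)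
qed

lemma fun_upd_simplex_times:
  assumes "z \<in> extensional {..<n}"
  shows "z(n := y) \<in> simplex_times (Suc n) t \<longleftrightarrow> y \<in> {0..t} \<and> z \<in> open_simplex n y"
proof
  assume L: "z(n := y) \<in> simplex_times (Suc n) t"
  hence y: "y \<in> {0..t}" and z: "\<And>i. i < n \<Longrightarrow> 0 \<le> z i"
    by (auto simp: simplex_times_def PiE_iff less_Suc_eq split: if_splits)
  have lt: "\<forall>i j. i < j \<and> j < Suc n \<longrightarrow> (z(n := y)) i < (z(n := y)) j"
    using L by (simp add: simplex_times_def)
  have "z i < y" if "i < n" for i using lt[rule_format, of i n] that by simp
  moreover have "z i < z j" if "i < j" "j < n" for i j using lt[rule_format, of i j] that by simp
  ultimately show "y \<in> {0..t} \<and> z \<in> open_simplex n y"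
    using y z assms by (auto simp: open_simplex_def PiE_iff)
next
  assume R: "y \<in> {0..t} \<and> z \<in> open_simplex n y"
  hence "z i \<in> {0..<y}" if "i < n" for i
    using that by (simp add: open_simplex_def PiE_iff)
  hence "z i \<le> t" "0 \<le> z i" if "i < n" for i
    using that R by force+
  thus "z(n := y) \<in> simplex_times (Suc n) t"
    using assms R by (auto simp: open_simplex_def simplex_times_def PiE_iff less_Suc_eq extensional_def)
qed

lemma open_simplex_sets: "open_simplex n t \<in> sets (Pi\<^sub>M {..<n} (\<lambda>_. lborel))"
  and simplex_times_sets: "simplex_times n t \<in> sets (Pi\<^sub>M {..<n} (\<lambda>_. lborel))"
proof -
  let ?M = "Pi\<^sub>M {..<n} (\<lambda>_. lborel) :: (nat \<Rightarrow> real) measure"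
  have c [measurable]: "(\<lambda>\<tau>. \<tau> i) \<in> borel_measurable ?M" if "i \<in> {..<n}" for i
    using measurable_component_singleton[OF that, of "\<lambda>_. lborel"] by simp
  have "open_simplex n t = {\<tau> \<in> space ?M. \<forall>i\<in>{..<n}. \<forall>j\<in>{..<n}. 0 \<le> \<tau> i \<and> \<tau> i < t \<and> (i < j \<longrightarrow> \<tau> i < \<tau> j)}"
    by (auto simp: open_simplex_def space_PiM PiE_iff)
  also have "\<dots> \<in> sets ?M" by measurable
  finally show "open_simplex n t \<in> sets ?M" .
  have "simplex_times n t = {\<tau> \<in> space ?M. \<forall>i\<in>{..<n}. \<forall>j\<in>{..<n}. 0 \<le> \<tau> i \<and> \<tau> i \<le> t \<and> (i < j \<longrightarrow> \<tau> i < \<tau> j)}"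
    by (auto simp: simplex_times_def space_PiM PiE_iff)
  also have "\<dots> \<in> sets ?M" by measurable
  finally show "simplex_times n t \<in> sets ?M" .
qed

lemma emeasure_simplex_times: "emeasure (Pi\<^sub>M {..<n} (\<lambda>_. lborel)) (simplex_times n t) < \<infinity>"
proof -
  interpret product_sigma_finite "\<lambda>_::nat. lborel :: real measure" ..
  have "emeasure (Pi\<^sub>M {..<n} (\<lambda>_. lborel)) (simplex_times n t) \<le>
      emeasure (Pi\<^sub>M {..<n} (\<lambda>_. lborel)) (Pi\<^sub>E {..<n} (\<lambda>_. {0..t}))"
    by (intro emeasure_mono sets_PiM_I_finite) (auto simp: simplex_times_def)
  also have "\<dots> = (\<Prod>i<n. emeasure lborel {0..t})" by (subst emeasure_PiM) auto
  also have "\<dots> < \<infinity>" by (cases "0 \<le> t") (simp_all add: emeasure_lborel_Icc_eq ennreal_power power_0_left)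
  finally show ?thesis .
qed

lemma emeasure_open_simplex: "emeasure (Pi\<^sub>M {..<n} (\<lambda>_. lborel)) (open_simplex n t) < \<infinity>"
proof -
  have "open_simplex n t \<subseteq> simplex_times n t"
    by (auto simp: simplex_times_def open_simplex_def PiE_iff intro: less_imp_le)
  from emeasure_mono[OF this simplex_times_sets] show ?thesis
    using emeasure_simplex_times le_less_trans by blast
qed

section \<open>Quantum Wiener integrals as iterated integrals\<close>

context flow_in_algebra
begin

lemma tensor_word_snoc: "tensor_word emb app u (\<xi>s @ [\<xi>]) = app (tensor_word emb app u \<xi>s) \<xi>"
  by (simp add: tensor_word_def)

definition walk_inner where
  "walk_inner \<xi> \<eta> u v n x \<tau> =
    cinner (tensor_word emb app u (map (\<lambda>i. \<xi> (\<tau> i)) [0..<n]))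
      (blinfun_apply (rw n x) (tensor_word emb app v (map (\<lambda>i. \<eta> (\<tau> i)) [0..<n])))"

lemma walk_inner_cong:
  assumes "\<And>i. i < n \<Longrightarrow> \<tau> i = \<tau>' i" shows "walk_inner \<xi> \<eta> u v n x \<tau> = walk_inner \<xi> \<eta> u v n x \<tau>'"
proof -
  have "map (\<lambda>i. \<xi> (\<tau> i)) [0..<n] = map (\<lambda>i. \<xi> (\<tau>' i)) [0..<n]"
    "map (\<lambda>i. \<eta> (\<tau> i)) [0..<n] = map (\<lambda>i. \<eta> (\<tau>' i)) [0..<n]" using assms by auto
  thus ?thesis by (simp only: walk_inner_def)
qed

lemma walk_inner_Suc:
  assumes "x \<in> A0"
  shows "walk_inner \<xi> \<eta> u v (Suc n) x \<tau> = walk_inner \<xi> \<eta> u v n (sl (\<xi> (\<tau> n)) (\<eta> (\<tau> n)) x) \<tau>"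
  unfolding walk_inner_def upt_Suc_append[OF le0] map_append list.map tensor_word_snoc
  by (rule rw_Suc_inner[OF assms])

lemma norm_tensor_word:
  fixes \<xi> :: "real \<Rightarrow> complex \<times> 'k"
  assumes "\<And>r. norm (\<xi> r) \<le> c"
  shows "norm (tensor_word emb app u (map (\<lambda>i. \<xi> (\<tau> i)) [0..<n])) \<le> norm u * c ^ n"
proof (induction n)
  case (Suc n)
  have c: "c \<ge> 0" using assms[of 0] norm_ge_zero order_trans by blast
  have "norm (tensor_word emb app u (map (\<lambda>i. \<xi> (\<tau> i)) [0..<n])) * norm (\<xi> (\<tau> n)) \<le> (norm u * c ^ n) * c"
    using Suc c assms by (intro mult_mono) auto
  thus ?case
    unfolding upt_Suc_append[OF le0] map_append list.map tensor_word_snoc norm_app by (simp add: mult_ac)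
qed (simp add: tensor_word_def norm_emb)

lemma norm_walk_inner:
  assumes "good c \<xi> \<eta>"
  shows "cmod (walk_inner \<xi> \<eta> u v n x \<tau>) \<le> (norm u * c ^ n) * (norm (rw n x) * (norm v * c ^ n))"
proof -
  have c: "c \<ge> 0" by (rule good_pos[OF assms])
  have "cmod (walk_inner \<xi> \<eta> u v n x \<tau>) \<le> norm (tensor_word emb app u (map (\<lambda>i. \<xi> (\<tau> i)) [0..<n])) *
     norm (blinfun_apply (rw n x) (tensor_word emb app v (map (\<lambda>i. \<eta> (\<tau> i)) [0..<n])))"
    unfolding walk_inner_def by (rule cauchy_schwarz)
  also have "\<dots> \<le> (norm u * c ^ n) * (norm (rw n x) * (norm v * c ^ n))"
    using assms c
    by (intro mult_mono order_trans[OF norm_blinfun] mult_left_mono norm_tensor_word) (auto simp: good_def)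
  finally show ?thesis .
qed

text \<open>Slicing the last factor separates the variables: the integrand is a finite sum of scalar
  functions of the latest time times integrands of order n, taken at fixed elements of
  \<open>A0\<close>. The restriction of the time vector places the latter on the smaller product
  space of the induction hypothesis.\<close>

lemma walk_inner_measurable:
  assumes g: "good c \<xi> \<eta>" and x: "x \<in> A0"
  shows "walk_inner \<xi> \<eta> u v n x \<in> borel_measurable (Pi\<^sub>M {..<n} (\<lambda>_. lborel))"
  using x
proof (induction n arbitrary: x)
  case 0
  have "walk_inner \<xi> \<eta> u v 0 x = (\<lambda>_. cinner (emb u) (blinfun_apply (rw 0 x) (emb v)))"
    by (rule ext) (simp add: walk_inner_def tensor_word_def)
  thus ?case by simp
next
  case (Suc n)
  obtain ab where ab: "set ab \<subseteq> A0 \<times> bop" "\<phi> x = (\<Sum>(a, b)\<leftarrow>ab. tensor1 emb app a b)"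
    using phi_list[OF Suc.prems] by blast
  have ab': "set ab \<subseteq> A0 \<times> UNIV" using ab by auto
  define w where "w b r = cinner (\<xi> r) (blinfun_apply b (\<eta> r))" for b r
  have "walk_inner \<xi> \<eta> u v (Suc n) x \<tau> =
      (\<Sum>(a, b)\<leftarrow>ab. w b (\<tau> n) * walk_inner \<xi> \<eta> u v n a (restrict \<tau> {..<n}))" for \<tau>
  proof -
    have "walk_inner \<xi> \<eta> u v (Suc n) x \<tau> = walk_inner \<xi> \<eta> u v n (\<Sum>(a, b)\<leftarrow>ab. w b (\<tau> n) *\<^sub>C a) \<tau>"
      unfolding walk_inner_Suc[OF Suc.prems] slice_list[OF ab] w_def ..
    also have "\<dots> = (\<Sum>(a, b)\<leftarrow>ab. w b (\<tau> n) * walk_inner \<xi> \<eta> u v n a \<tau>)"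
      unfolding walk_inner_def clinear_on_sum_list[OF rw_clinear A0_subspace ab', THEN conjunct1]
      by (induction ab) (auto simp: blinfun.add_left cinner_add_right scaleC_blinfun.rep_eq cinner_scaleC_right)
    also have "\<dots> = (\<Sum>(a, b)\<leftarrow>ab. w b (\<tau> n) * walk_inner \<xi> \<eta> u v n a (restrict \<tau> {..<n}))"
      using walk_inner_cong[of n \<tau> "restrict \<tau> {..<n}"] by simp
    finally show ?thesis .
  qed
  hence eq: "walk_inner \<xi> \<eta> u v (Suc n) x =
      (\<lambda>\<tau>. \<Sum>(a, b)\<leftarrow>ab. w b (\<tau> n) * walk_inner \<xi> \<eta> u v n a (restrict \<tau> {..<n}))" by blast
  have "(\<lambda>\<tau>. \<Sum>(a, b)\<leftarrow>ab. w b (\<tau> n) * walk_inner \<xi> \<eta> u v n a (restrict \<tau> {..<n}))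
      \<in> borel_measurable (Pi\<^sub>M {..<Suc n} (\<lambda>_. lborel))"
    using ab(1)
  proof (induction ab)
    case (Cons q ab)
    obtain a b where q: "q = (a, b)" by fastforce
    have "w b \<in> borel_measurable borel"
      using g Cons.prems by (simp add: good_def w_def[abs_def] q)
    moreover have "(\<lambda>\<tau>. \<tau> n) \<in> borel_measurable (Pi\<^sub>M {..<Suc n} (\<lambda>_. lborel :: real measure))"
      using measurable_component_singleton[of n "{..<Suc n}" "\<lambda>_. lborel"] by simp
    ultimately have 1: "(\<lambda>\<tau>. w b (\<tau> n)) \<in> borel_measurable (Pi\<^sub>M {..<Suc n} (\<lambda>_. lborel))"
      by (rule measurable_compose[rotated])
    have "(\<lambda>\<tau>. restrict \<tau> {..<n}) \<in> measurable (Pi\<^sub>M {..<Suc n} (\<lambda>_. lborel)) (Pi\<^sub>M {..<n} (\<lambda>_. lborel))"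
      by (rule measurable_restrict_subset) auto
    moreover have "a \<in> A0" using Cons.prems q by auto
    ultimately have 2: "(\<lambda>\<tau>. walk_inner \<xi> \<eta> u v n a (restrict \<tau> {..<n})) \<in> borel_measurable (Pi\<^sub>M {..<Suc n} (\<lambda>_. lborel))"
      using measurable_compose[OF _ Suc.IH] by blast
    show ?case
      unfolding q list.map sum_list.Cons prod.case
      by (intro borel_measurable_add borel_measurable_times 1 2 Cons.IH) (use Cons.prems in auto)
  qed simp
  thus ?case unfolding eq .
qed

text \<open>Treats the half-open and the closed simplex together. The set S of admissible latest
  times is [0,t) or [0,t], and in both cases the earlier times range over a half-open simplex, so
  that a single induction hypothesis suffices.\<close>

lemma set_integral_peel_last:
  assumes g: "good c \<xi> \<eta>" and x: "x \<in> A0" and t: "t \<ge> 0"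
    and W: "W \<in> sets (Pi\<^sub>M {..<Suc n} (\<lambda>_. lborel))" "emeasure (Pi\<^sub>M {..<Suc n} (\<lambda>_. lborel)) W < \<infinity>"
    and sect: "\<And>z y. z \<in> extensional {..<n} \<Longrightarrow> z(n := y) \<in> W \<longleftrightarrow> y \<in> S \<and> z \<in> open_simplex n y"
    and S: "S \<subseteq> {0..t}" "{0..t} - S \<subseteq> {t}"
    and IH: "\<And>y r. y \<in> A0 \<Longrightarrow> r \<ge> 0 \<Longrightarrow>
      (LINT \<tau>:open_simplex n r|Pi\<^sub>M {..<n} (\<lambda>_. lborel). walk_inner \<xi> \<eta> u v n y \<tau>) =
      cinner u (blinfun_apply (iter_int \<xi> \<eta> n r y) v)"
  shows "(LINT \<tau>:W|Pi\<^sub>M {..<Suc n} (\<lambda>_. lborel). walk_inner \<xi> \<eta> u v (Suc n) x \<tau>) =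
      cinner u (blinfun_apply (iter_int \<xi> \<eta> (Suc n) t x) v)"
proof -
  interpret product_sigma_finite "\<lambda>_::nat. lborel :: real measure" ..
  define f where "f \<tau> = indicator W \<tau> *\<^sub>R walk_inner \<xi> \<eta> u v (Suc n) x \<tau>" for \<tau>
  have ins: "{..<Suc n} = insert n {..<n}" by auto
  have int: "integrable (Pi\<^sub>M (insert n {..<n}) (\<lambda>_. lborel)) f"
    unfolding f_def ins[symmetric]
    by (rule integrableI_bounded_set_indicator[OF W(1) walk_inner_measurable[OF g x] W(2)])
       (use norm_walk_inner[OF g] in blast)
  define q where "q y = cinner u (blinfun_apply (iter_int \<xi> \<eta> n y (sl (\<xi> y) (\<eta> y) x)) v)" for y
  have inner: "(\<integral>z. f (z(n := y)) \<partial>Pi\<^sub>M {..<n} (\<lambda>_. lborel)) = indicator S y *\<^sub>R q y" for y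
  proof -
    have "(\<integral>z. f (z(n := y)) \<partial>Pi\<^sub>M {..<n} (\<lambda>_. lborel)) =
      (\<integral>z. indicator S y *\<^sub>R (indicator (open_simplex n y) z *\<^sub>R
          walk_inner \<xi> \<eta> u v n (sl (\<xi> y) (\<eta> y) x) z) \<partial>Pi\<^sub>M {..<n} (\<lambda>_. lborel))"
    proof (rule Bochner_Integration.integral_cong[OF refl])
      fix z :: "nat \<Rightarrow> real" assume "z \<in> space (Pi\<^sub>M {..<n} (\<lambda>_. lborel))"
      hence z: "z \<in> extensional {..<n}" by (simp add: space_PiM PiE_def)
      have "walk_inner \<xi> \<eta> u v (Suc n) x (z(n := y)) = walk_inner \<xi> \<eta> u v n (sl (\<xi> y) (\<eta> y) x) (z(n := y))"
        using walk_inner_Suc[OF x, of \<xi> \<eta> u v n "z(n := y)"] by simp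
      also have "\<dots> = walk_inner \<xi> \<eta> u v n (sl (\<xi> y) (\<eta> y) x) z" by (rule walk_inner_cong) simp
      finally show "f (z(n := y)) = indicator S y *\<^sub>R (indicator (open_simplex n y) z *\<^sub>R
          walk_inner \<xi> \<eta> u v n (sl (\<xi> y) (\<eta> y) x) z)"
        unfolding f_def using sect[OF z, of y] by (auto simp: indicator_def)
    qed
    also have "\<dots> = indicator S y *\<^sub>R (LINT z:open_simplex n y|Pi\<^sub>M {..<n} (\<lambda>_. lborel).
        walk_inner \<xi> \<eta> u v n (sl (\<xi> y) (\<eta> y) x) z)"
      by (simp only: set_lebesgue_integral_def Bochner_Integration.integral_scaleR_right)
    also have "\<dots> = indicator S y *\<^sub>R q y"
    proof (cases "y \<in> S")
      case True
      hence "y \<ge> 0" using S(1) by auto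
      thus ?thesis using IH[OF slice_A0[OF x, of "\<xi> y" "\<eta> y"]] by (simp add: q_def)
    qed simp
    finally show ?thesis .
  qed
  note rev = product_integral_insert_rev[OF _ _ int]
  have qint: "set_integrable lborel S q"
    using rev(1) by (simp add: inner set_integrable_def)
  have "(LINT \<tau>:W|Pi\<^sub>M {..<Suc n} (\<lambda>_. lborel). walk_inner \<xi> \<eta> u v (Suc n) x \<tau>) =
      integral\<^sup>L (Pi\<^sub>M (insert n {..<n}) (\<lambda>_. lborel)) f"
    by (simp add: set_lebesgue_integral_def f_def[abs_def] ins)
  also have "\<dots> = (LINT y:S|lborel. q y)"
    using rev(2) by (simp add: inner set_lebesgue_integral_def)
  \<comment> \<open>The scalar Lebesgue integral becomes a Henstock-Kurzweil integral here. Only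
    then can the functional T \<mapsto> \<langle>u, T v\<rangle> be pulled out of the
    operator-valued integral; S and [0,t] differ at most in the point t.\<close>
  also have "\<dots> = integral S q" by (rule set_borel_integral_eq_integral(2)[OF qint])
  also have "\<dots> = integral {0..t} q"
    by (rule integral_spike_set) (rule negligible_subset[of "{t}"], use S in auto)+
  also have "\<dots> = cinner u (blinfun_apply (iter_int \<xi> \<eta> (Suc n) t x) v)"
  proof -
    have "bounded_linear (\<lambda>T::'h \<Rightarrow>\<^sub>L 'h. cinner u (blinfun_apply T v))"
      using bounded_linear_compose[OF bounded_bilinear.bounded_linear_right[OF bounded_bilinear_cinner]
        blinfun.bounded_linear_left] .
    from integral_linear[OF iter_int_integrable[OF g x t] this] show ?thesis
      by (simp add: q_def[abs_def] o_def)
  qed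
  finally show ?thesis .
qed

lemma integral_open_simplex:
  assumes g: "good c \<xi> \<eta>" and "x \<in> A0" and "t \<ge> 0"
  shows "(LINT \<tau>:open_simplex n t|Pi\<^sub>M {..<n} (\<lambda>_. lborel). walk_inner \<xi> \<eta> u v n x \<tau>) =
      cinner u (blinfun_apply (iter_int \<xi> \<eta> n t x) v)"
  using assms(2,3)
proof (induction n arbitrary: x t)
  case 0
  have "open_simplex 0 t = {\<lambda>_. undefined}" by (auto simp: open_simplex_def)
  hence "(LINT \<tau>:open_simplex 0 t|Pi\<^sub>M {..<0::nat} (\<lambda>_. lborel). walk_inner \<xi> \<eta> u v 0 x \<tau>) =
      walk_inner \<xi> \<eta> u v 0 x (\<lambda>_. undefined)"
    by (simp add: set_lebesgue_integral_def PiM_empty integral_count_space_nat lebesgue_integral_count_space_finite)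
  also have "\<dots> = cinner u (blinfun_apply x v)"
    using 0 A0_bop by (auto simp: walk_inner_def tensor_word_def level0_emb emb_inner)
  finally show ?case by simp
next
  case (Suc n)
  show ?case
    by (rule set_integral_peel_last[OF g Suc.prems open_simplex_sets emeasure_open_simplex
          fun_upd_open_simplex _ _ Suc.IH]) auto
qed

text \<open>Only positive orders occur, since the Wiener integral of order zero is defined without
  an integral.\<close>

lemma integral_simplex_times:
  assumes g: "good c \<xi> \<eta>" and "x \<in> A0" and "t \<ge> 0"
  shows "(LINT \<tau>:simplex_times (Suc n) t|Pi\<^sub>M {..<Suc n} (\<lambda>_. lborel). walk_inner \<xi> \<eta> u v (Suc n) x \<tau>) =
      cinner u (blinfun_apply (iter_int \<xi> \<eta> (Suc n) t x) v)"
  by (rule set_integral_peel_last[OF assms simplex_times_sets emeasure_simplex_times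
        fun_upd_simplex_times _ _ integral_open_simplex[OF g]]) auto

end


section \<open>Square-integrable functions and exponential vectors\<close>

lemma space_half_line [simp]: "space half_line = {0..}"
  by (simp add: space_restrict_space)

text \<open>Both functions are pointwise limits of simple functions on the half-line, so a
  sequentially continuous expression in them is a limit of simple functions with values in a metric
  space. No countability of k enters.\<close>

lemma L2_measurable2:
  fixes h :: "'k::complex_hilbert \<Rightarrow> 'k \<Rightarrow> 'c::metric_space"
  assumes f: "f \<in> L2" and g: "g \<in> L2"
    and h: "\<And>x y a b. x \<longlonglongrightarrow> a \<Longrightarrow> y \<longlonglongrightarrow> b \<Longrightarrow> (\<lambda>m. h (x m) (y m)) \<longlonglongrightarrow> h a b"
  shows "(\<lambda>r. h (f r) (g r)) \<in> borel_measurable half_line"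
proof -
  obtain s where s: "\<And>m. simple_function half_line (s m)" "\<And>r. r \<ge> 0 \<Longrightarrow> (\<lambda>m. s m r) \<longlonglongrightarrow> f r"
    using f by (auto simp: L2_def)
  obtain s' where s': "\<And>m. simple_function half_line (s' m)" "\<And>r. r \<ge> 0 \<Longrightarrow> (\<lambda>m. s' m r) \<longlonglongrightarrow> g r"
    using g by (auto simp: L2_def)
  show ?thesis
  proof (rule borel_measurable_LIMSEQ_metric)
    show "(\<lambda>r. h (s m r) (s' m r)) \<in> borel_measurable half_line" for m
      by (rule borel_measurable_simple_function[OF simple_function_compose2[OF s(1) s'(1)]])
    show "(\<lambda>m. h (s m r) (s' m r)) \<longlonglongrightarrow> h (f r) (g r)" if "r \<in> space half_line" for r
      using h[OF s(2) s'(2), of r r] that by simp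
  qed
qed

lemma L2_norm_measurable: "f \<in> L2 \<Longrightarrow> (\<lambda>r. norm (f r)) \<in> borel_measurable half_line"
  using L2_measurable2[of f f "\<lambda>x y. norm x"] tendsto_norm by blast

lemma L2_inner_measurable:
  "f \<in> L2 \<Longrightarrow> g \<in> L2 \<Longrightarrow> (\<lambda>r. cinner (f r) (g r)) \<in> borel_measurable half_line"
  using L2_measurable2[of f g cinner] tendsto_cinner by blast

lemma L2_fhat_measurable:
  fixes f g :: "real \<Rightarrow> 'k::complex_hilbert"
  assumes "f \<in> L2" "g \<in> L2"
  shows "(\<lambda>r. cinner (fhat f r) (blinfun_apply b (fhat g r))) \<in> borel_measurable half_line"
  unfolding fhat_def
  by (rule L2_measurable2[OF assms, of "\<lambda>x y. cinner (1, x) (blinfun_apply b (1, y))"])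
     (intro tendsto_cinner tendsto_intros blinfun.tendsto; assumption)

text \<open>One operation for truncation in time and truncation in size. What the Fock space
  estimates exploit is that multiplication by an indicator is an orthogonal projection.\<close>

definition cut :: "real set \<Rightarrow> (real \<Rightarrow> 'k::complex_hilbert) \<Rightarrow> real \<Rightarrow> 'k"
  where "cut B f = (\<lambda>r. indicator B r *\<^sub>R f r)"

lemma upto_time_cut: "upto_time t f = cut {0..<t} f"
  by (simp add: upto_time_def cut_def)

lemma cut_L2:
  assumes f: "f \<in> L2" and B: "B \<inter> {0..} \<in> sets half_line"
  shows "cut B f \<in> L2"
proof -
  obtain s where s: "\<And>m. simple_function half_line (s m)" "\<And>r. r \<ge> 0 \<Longrightarrow> (\<lambda>m. s m r) \<longlonglongrightarrow> f r"
    using f by (auto simp: L2_def)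
  have ind: "simple_function half_line (indicator (B \<inter> {0..}) :: real \<Rightarrow> real)"
    using B by (rule simple_function_indicator)
  have "simple_function half_line (\<lambda>r. indicator (B \<inter> {0..}) r *\<^sub>R s m r)" for m
    by (rule simple_function_compose2[OF ind s(1)])
  moreover have "(\<lambda>m. indicator (B \<inter> {0..}) r *\<^sub>R s m r) \<longlonglongrightarrow> cut B f r" if "r \<ge> 0" for r
  proof -
    have "cut B f r = indicator (B \<inter> {0..}) r *\<^sub>R f r" using that by (simp add: cut_def indicator_def)
    thus ?thesis using s(2)[OF that] by (simp add: tendsto_scaleR)
  qed
  moreover have "integrable half_line (\<lambda>r. (norm (cut B f r))\<^sup>2)"
  proof (rule Bochner_Integration.integrable_bound[of half_line "\<lambda>r. (norm (f r))\<^sup>2"])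
    show "integrable half_line (\<lambda>r. (norm (f r))\<^sup>2)" using f by (simp add: L2_def)
    have "(\<lambda>r. indicator (B \<inter> {0..}) r * (norm (f r))\<^sup>2) \<in> borel_measurable half_line"
      using B L2_norm_measurable[OF f] by (intro borel_measurable_times borel_measurable_indicator borel_measurable_power)
    thus "(\<lambda>r. (norm (cut B f r))\<^sup>2) \<in> borel_measurable half_line"
      by (rule measurable_cong[THEN iffD1, rotated]) (auto simp: cut_def indicator_def)
    show "AE r in half_line. norm ((norm (cut B f r))\<^sup>2) \<le> norm ((norm (f r))\<^sup>2)"
      by (auto simp: cut_def indicator_def)
  qed
  ultimately show ?thesis
    unfolding L2_def by (auto intro!: exI[of _ "\<lambda>m r. indicator (B \<inter> {0..}) r *\<^sub>R s m r"])
qed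

lemma borel_half_line: "B \<in> sets borel \<Longrightarrow> B \<inter> {0..} \<in> sets half_line"
  by (auto simp: sets_restrict_space)

lemma upto_time_L2: "f \<in> L2 \<Longrightarrow> upto_time t f \<in> L2"
  unfolding upto_time_cut by (rule cut_L2[OF _ borel_half_line]) auto

lemma zero_L2: "(\<lambda>_. 0) \<in> L2"
  by (auto simp: L2_def intro!: exI[of _ "\<lambda>_ _. 0"])

lemma translate_L2:
  assumes f: "f \<in> L2" and s: "s \<ge> 0"
  shows "(\<lambda>r. f (r + s)) \<in> L2"
proof -
  obtain S where S: "\<And>m. simple_function half_line (S m)" "\<And>r. r \<ge> 0 \<Longrightarrow> (\<lambda>m. S m r) \<longlonglongrightarrow> f r"
    using f by (auto simp: L2_def)
  have m: "(\<lambda>r. r + s) \<in> measurable half_line half_line"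
    by (rule measurable_restrict_space2) (use s in \<open>auto intro!: measurable_restrict_space1\<close>)
  have "simple_function half_line (\<lambda>r. S m (r + s))" for m
    using simple_function_comp[OF m S(1)[of m]] by (simp add: o_def)
  moreover have "(\<lambda>m. S m (r + s)) \<longlonglongrightarrow> f (r + s)" if "r \<ge> 0" for r
    using S(2) that s by simp
  moreover have "integrable half_line (\<lambda>r. (norm (f (r + s)))\<^sup>2)"
  proof -
    have "integrable half_line (\<lambda>r. (norm (f r))\<^sup>2)" using f by (simp add: L2_def)
    hence "integrable lborel (\<lambda>r. indicator {0..} r *\<^sub>R (norm (f r))\<^sup>2)"
      by (subst (asm) integrable_restrict_space) auto
    from lborel_integrable_real_affine[OF this, of 1 s]
    have "integrable lborel (\<lambda>r. indicator {0..} (r + s) *\<^sub>R (norm (f (r + s)))\<^sup>2)"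
      by (simp add: add.commute)
    from integrable_mult_indicator[of "{0..}", OF _ this]
    have "integrable lborel (\<lambda>r. indicator {0..} r *\<^sub>R (indicator {0..} (r + s) *\<^sub>R (norm (f (r + s)))\<^sup>2))"
      by simp
    also have "(\<lambda>r. indicator {0..} r *\<^sub>R (indicator {0..} (r + s) *\<^sub>R (norm (f (r + s)))\<^sup>2)) =
        (\<lambda>r. indicator {0..} r *\<^sub>R (norm (f (r + s)))\<^sup>2)"
      using s by (auto simp: indicator_def)
    finally show ?thesis by (subst integrable_restrict_space) auto
  qed
  ultimately show ?thesis unfolding L2_def by (auto intro!: exI[of _ "\<lambda>m r. S m (r + s)"])
qed

section \<open>Truncation of square-integrable functions and exponential vectors\<close>

definition L2_normsq :: "(real \<Rightarrow> 'k::complex_hilbert) \<Rightarrow> real"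
  where "L2_normsq f = (LINT r|half_line. (norm (f r))\<^sup>2)"

lemma L2_inner_self: "L2_inner f f = of_real (L2_normsq f)"
  by (simp add: L2_inner_def L2_normsq_def cinner_self del: of_real_power)

lemma L2_inner_cut_left: "L2_inner (cut B f) (cut B g) = L2_inner (cut B f) g"
  by (simp add: L2_inner_def cut_def cinner_scaleR_left cinner_scaleR_right indicator_def cong: if_cong)
     (intro Bochner_Integration.integral_cong, auto)

text \<open>Restricting to C cannot enlarge the part of f that lies outside B, pointwise and hence
  after integration. With C = [0,t) this makes the truncation error uniform in t.\<close>

lemma L2_normsq_diff:
  assumes f: "f \<in> L2" and B: "B \<inter> {0..} \<in> sets half_line" and t: "C \<inter> {0..} \<in> sets half_line"
  shows "L2_normsq (cut C f) - L2_normsq (cut B (cut C f)) \<le> L2_normsq f - L2_normsq (cut B f)"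
    and "L2_normsq (cut B f) \<le> L2_normsq f"
proof -
  have i: "integrable half_line (\<lambda>r. (norm (h r))\<^sup>2)" if "h \<in> L2" for h :: "real \<Rightarrow> 'a"
    using that by (simp add: L2_def)
  note L = f cut_L2[OF f B] cut_L2[OF f t] cut_L2[OF cut_L2[OF f t] B]
  show "L2_normsq (cut B f) \<le> L2_normsq f"
    unfolding L2_normsq_def by (intro integral_mono i L) (auto simp: cut_def indicator_def)
  have "L2_normsq (cut C f) - L2_normsq (cut B (cut C f)) =
      (LINT r|half_line. (norm (cut C f r))\<^sup>2 - (norm (cut B (cut C f) r))\<^sup>2)"
    unfolding L2_normsq_def by (intro Bochner_Integration.integral_diff[symmetric] i L)
  also have "\<dots> \<le> (LINT r|half_line. (norm (f r))\<^sup>2 - (norm (cut B f r))\<^sup>2)"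
    by (intro integral_mono Bochner_Integration.integrable_diff i L) (auto simp: cut_def indicator_def)
  also have "\<dots> = L2_normsq f - L2_normsq (cut B f)"
    unfolding L2_normsq_def by (intro Bochner_Integration.integral_diff i L)
  finally show "L2_normsq (cut C f) - L2_normsq (cut B (cut C f)) \<le> L2_normsq f - L2_normsq (cut B f)" .
qed

text \<open>Large values are replaced by zero, not rescaled. So the operation is a cut, and it
  commutes with translations and with truncation in time.\<close>

definition truncate :: "nat \<Rightarrow> (real \<Rightarrow> 'k::complex_hilbert) \<Rightarrow> real \<Rightarrow> 'k"
  where "truncate m f = cut {r. norm (f r) \<le> real m} f"

lemma truncate_sets: "f \<in> L2 \<Longrightarrow> {r. norm (f r) \<le> real m} \<inter> {0..} \<in> sets half_line"
proof -
  assume "f \<in> L2"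
  from borel_measurable_le[OF L2_norm_measurable[OF this] borel_measurable_const[of "real m"]]
  show ?thesis by (simp add: Collect_conj_eq Int_commute atLeast_def)
qed

lemma truncate_L2: "f \<in> L2 \<Longrightarrow> truncate m f \<in> L2"
  unfolding truncate_def by (rule cut_L2[OF _ truncate_sets])

lemma norm_truncate: "norm (truncate m f r) \<le> real m"
  by (auto simp: truncate_def cut_def indicator_def)

lemma truncate_translate: "(\<lambda>r. truncate m f (r + s)) = truncate m (\<lambda>r. f (r + s))"
  by (auto simp: truncate_def cut_def indicator_def)

lemma upto_time_truncate: "upto_time t (truncate m f) = cut {r. norm (f r) \<le> real m} (upto_time t f)"
  by (auto simp: truncate_def upto_time_def cut_def indicator_def)

lemma L2_normsq_truncate_tendsto:
  assumes f: "f \<in> L2" shows "(\<lambda>m. L2_normsq (truncate m f)) \<longlonglongrightarrow> L2_normsq f"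
  unfolding L2_normsq_def
proof (rule integral_dominated_convergence[where w = "\<lambda>r. (norm (f r))\<^sup>2"])
  show "integrable half_line (\<lambda>r. (norm (f r))\<^sup>2)" using f by (simp add: L2_def)
  show "(\<lambda>r. (norm (f r))\<^sup>2) \<in> borel_measurable half_line"
    using L2_norm_measurable[OF f] by simp
  show "(\<lambda>r. (norm (truncate m f r))\<^sup>2) \<in> borel_measurable half_line" for m
    using L2_norm_measurable[OF truncate_L2[OF f]] by simp
  show "AE r in half_line. (\<lambda>m. (norm (truncate m f r))\<^sup>2) \<longlonglongrightarrow> (norm (f r))\<^sup>2"
  proof (rule AE_I2)
    fix r
    obtain M :: nat where M: "norm (f r) \<le> real M" using real_arch_simple by blast
    have "truncate m f r = f r" if "m \<ge> M" for m
      using M that by (auto simp: truncate_def cut_def indicator_def)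
    hence "\<forall>\<^sub>F m in sequentially. (norm (truncate m f r))\<^sup>2 = (norm (f r))\<^sup>2"
      by (intro eventually_sequentiallyI[of M]) simp
    thus "(\<lambda>m. (norm (truncate m f r))\<^sup>2) \<longlonglongrightarrow> (norm (f r))\<^sup>2" by (rule tendsto_eventually)
  qed
  show "AE r in half_line. norm ((norm (truncate m f r))\<^sup>2) \<le> (norm (f r))\<^sup>2" for m
    by (auto simp: truncate_def cut_def indicator_def)
qed

lemma exp_vector_norm:
  assumes "boson_fock \<epsilon>" "f \<in> L2" shows "(norm (\<epsilon> f))\<^sup>2 = exp (L2_normsq f)"
proof -
  have "complex_of_real ((norm (\<epsilon> f))\<^sup>2) = complex_of_real (exp (L2_normsq f))"
    unfolding cinner_self[symmetric] using assms by (simp add: boson_fock_def L2_inner_self exp_of_real)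
  thus ?thesis unfolding of_real_eq_iff .
qed

text \<open>The inner product of the cut function with f is the squared norm of the cut function.
  Hence the cross term equals the squared norm of its exponential vector, and the distance follows a
  Pythagorean law.\<close>

lemma exp_vector_cut_dist:
  assumes \<epsilon>: "boson_fock \<epsilon>" and f: "f \<in> L2" and B: "B \<inter> {0..} \<in> sets half_line"
  shows "(norm (\<epsilon> (cut B f) - \<epsilon> f))\<^sup>2 = exp (L2_normsq f) - exp (L2_normsq (cut B f))"
proof -
  note c = cut_L2[OF f B]
  have "cinner (\<epsilon> (cut B f)) (\<epsilon> f) = exp (L2_inner (cut B f) (cut B f))"
    using \<epsilon> f c by (simp add: boson_fock_def L2_inner_cut_left)
  hence "Re (cinner (\<epsilon> (cut B f)) (\<epsilon> f)) = exp (L2_normsq (cut B f))"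
    by (simp add: L2_inner_self exp_of_real)
  thus ?thesis by (simp add: norm_diff_sq exp_vector_norm[OF \<epsilon> f] exp_vector_norm[OF \<epsilon> c])
qed

text \<open>For b \<le> a one has e^a - e^b \<le> e^a (a - b). Here a and a - b, taken at time t,
  are bounded by the same quantities of the whole f, so the right-hand side does not depend on
  t.\<close>

lemma exp_vector_truncate_dist:
  assumes \<epsilon>: "boson_fock \<epsilon>" and f: "f \<in> L2"
  shows "norm (\<epsilon> (upto_time t (truncate m f)) - \<epsilon> (upto_time t f)) \<le>
    sqrt (exp (L2_normsq f) * (L2_normsq f - L2_normsq (truncate m f)))"
proof (rule real_le_rsqrt)
  let ?B = "{r. norm (f r) \<le> real m}" and ?u = "upto_time t f"
  note B = truncate_sets[OF f, of m] and u = upto_time_L2[OF f, of t]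
  have C: "{0..<t} \<inter> {0..} \<in> sets half_line" by (rule borel_half_line) simp
  define a b where "a = L2_normsq ?u" and "b = L2_normsq (cut ?B ?u)"
  have "1 + (b - a) \<le> exp (b - a)" by (rule exp_ge_add_one_self)
  hence "exp a * (1 + (b - a)) \<le> exp a * exp (b - a)" by (rule mult_left_mono) simp
  hence "exp a - exp b \<le> exp a * (a - b)" by (simp add: exp_diff algebra_simps)
  moreover have "a - b \<le> L2_normsq f - L2_normsq (truncate m f)"
    using L2_normsq_diff(1)[OF f B C] by (simp add: a_def b_def upto_time_cut truncate_def)
  moreover have "b \<le> a" unfolding a_def b_def by (rule L2_normsq_diff(2)[OF u B C])
  moreover have "a \<le> L2_normsq f" unfolding a_def upto_time_cut by (rule L2_normsq_diff(2)[OF f C C])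
  ultimately have "exp a - exp b \<le> exp a * (a - b)" "exp a \<le> exp (L2_normsq f)"
      "a - b \<le> L2_normsq f - L2_normsq (truncate m f)" "0 \<le> a - b" by auto
  hence "exp a - exp b \<le> exp (L2_normsq f) * (L2_normsq f - L2_normsq (truncate m f))"
    using mult_mono[of "exp a" "exp (L2_normsq f)" "a - b" "L2_normsq f - L2_normsq (truncate m f)"]
    by simp
  thus "(norm (\<epsilon> (upto_time t (truncate m f)) - \<epsilon> ?u))\<^sup>2 \<le>
      exp (L2_normsq f) * (L2_normsq f - L2_normsq (truncate m f))"
    unfolding upto_time_truncate exp_vector_cut_dist[OF \<epsilon> u B] a_def b_def .
qed

lemma truncate_dist_tendsto:
  assumes "f \<in> L2"
  shows "(\<lambda>m. sqrt (exp (L2_normsq f) * (L2_normsq f - L2_normsq (truncate m f)))) \<longlonglongrightarrow> 0"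
proof -
  have "(\<lambda>m. sqrt (exp (L2_normsq f) * (L2_normsq f - L2_normsq (truncate m f)))) \<longlonglongrightarrow>
      sqrt (exp (L2_normsq f) * (L2_normsq f - L2_normsq f))"
    by (intro tendsto_intros L2_normsq_truncate_tendsto assms)
  thus ?thesis by simp
qed

lemma norm_exp_vector_upto:
  assumes "boson_fock \<epsilon>" "f \<in> L2"
  shows "norm (\<epsilon> (upto_time t f)) \<le> exp (L2_normsq f / 2)"
proof (rule power2_le_imp_le)
  have C: "{0..<t} \<inter> {0..} \<in> sets half_line" by (rule borel_half_line) simp
  have "(norm (\<epsilon> (upto_time t f)))\<^sup>2 \<le> exp (L2_normsq f)"
    using L2_normsq_diff(2)[OF assms(2) C C] exp_vector_norm[OF assms(1) upto_time_L2[OF assms(2)], of t]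
    by (simp add: upto_time_cut)
  thus "(norm (\<epsilon> (upto_time t f)))\<^sup>2 \<le> (exp (L2_normsq f / 2))\<^sup>2"
    by (simp add: power2_eq_square flip: exp_add)
qed simp

lemma L2_normsq_truncate_le: "f \<in> L2 \<Longrightarrow> L2_normsq (truncate m f) \<le> L2_normsq f"
  unfolding truncate_def using L2_normsq_diff(2)[OF _ truncate_sets truncate_sets] by blast

text \<open>Set to zero on the negative axis, where representatives of square-integrable functions
  are arbitrary.\<close>

definition inner_path :: "(real \<Rightarrow> 'k::complex_hilbert) \<Rightarrow> (real \<Rightarrow> 'k) \<Rightarrow> real \<Rightarrow> complex"
  where "inner_path f g r = (if r \<ge> 0 then cinner (f r) (g r) else 0)"

lemma inner_path_integrable:
  assumes "f \<in> L2" "g \<in> L2" "\<And>r. norm (f r) \<le> c" "\<And>r. norm (g r) \<le> c"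
  shows "set_integrable lborel {a..b} (inner_path f g)"
proof (rule set_integrable_bounded_borel)
  have "(\<lambda>r. indicator {0..} r *\<^sub>R cinner (f r) (g r)) \<in> borel_measurable lborel"
    using L2_inner_measurable[OF assms(1,2)] by (subst (asm) borel_measurable_restrict_space_iff) auto
  also have "(\<lambda>r. indicator {0..} r *\<^sub>R cinner (f r) (g r)) = inner_path f g"
    by (auto simp: inner_path_def indicator_def)
  finally show "inner_path f g \<in> borel_measurable borel" by simp
  have c: "c \<ge> 0" using assms(3)[of 0] norm_ge_zero order_trans by blast
  show "cmod (inner_path f g r) \<le> c * c" for r
    using cauchy_schwarz[of "f r" "g r"] mult_mono[OF assms(3)[of r] assms(4)[of r]] c
    by (auto simp: inner_path_def)
qed

text \<open>Writes the exponent of the scalar factor as an indefinite integral, which is visibly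
  continuous and additive in time.\<close>

lemma L2_inner_upto:
  assumes "f \<in> L2" "g \<in> L2" "\<And>r. norm (f r) \<le> c" "\<And>r. norm (g r) \<le> c" and t: "t \<ge> 0"
  shows "L2_inner (upto_time t f) (upto_time t g) = integral {0..t} (inner_path f g)"
proof -
  have si: "set_integrable lborel {0..<t} (inner_path f g)"
    by (rule set_integrable_subset[OF inner_path_integrable[OF assms(1-4), of 0 t]]) auto
  have "L2_inner (upto_time t f) (upto_time t g) =
      (LINT r|lborel. indicator {0..} r *\<^sub>R cinner (upto_time t f r) (upto_time t g r))"
    unfolding L2_inner_def by (subst integral_restrict_space) auto
  also have "\<dots> = (LINT r:{0..<t}|lborel. inner_path f g r)"
    unfolding set_lebesgue_integral_def
    by (intro Bochner_Integration.integral_cong refl)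
       (auto simp: upto_time_def indicator_def inner_path_def)
  also have "\<dots> = integral {0..<t} (inner_path f g)"
    by (rule set_borel_integral_eq_integral(2)[OF si])
  also have "\<dots> = integral {0..t} (inner_path f g)"
    by (rule integral_spike_set) (rule negligible_subset[of "{t}"], use t in auto)+
  finally show ?thesis .
qed

section \<open>The cocycle\<close>

locale fock_flow = flow_in_algebra emb app A0 \<phi> A
  for emb :: "'h::complex_hilbert \<Rightarrow> 'p::complex_hilbert"
    and app :: "'p \<Rightarrow> complex \<times> 'k::complex_hilbert \<Rightarrow> 'p"
    and A0 :: "('h \<Rightarrow>\<^sub>L 'h) set" and \<phi> :: "('h \<Rightarrow>\<^sub>L 'h) \<Rightarrow> ('p \<Rightarrow>\<^sub>L 'p)"
    and A :: "('h \<Rightarrow>\<^sub>L 'h) set" +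
  fixes \<epsilon> :: "(real \<Rightarrow> 'k) \<Rightarrow> 'f::complex_hilbert"
    and tensF :: "'h \<Rightarrow> 'f \<Rightarrow> 'g::complex_hilbert"
    and j :: "real \<Rightarrow> ('h \<Rightarrow>\<^sub>L 'h) \<Rightarrow> ('g \<Rightarrow>\<^sub>L 'g)"
  assumes A_unital: "unital_cstar_of_operators A"
    and fock: "boson_fock \<epsilon>" and tensF: "hilbert_tensor tensF"
    and hom: "\<And>t. t \<ge> 0 \<Longrightarrow> unital_star_hom (op_cstar A) (op_cstar bop) (j t)"
    and series: "\<And>t x. t \<ge> 0 \<Longrightarrow> x \<in> A0 \<Longrightarrow> is_flow_series emb app \<epsilon> tensF A0 \<phi> t x (j t x)"
begin

lemma operator_hom: "t \<ge> 0 \<Longrightarrow> operator_hom A (j t)"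
  by (simp add: operator_hom_def A_unital hom)

lemma tensF_isometric: "bilinear_isometric tensF"
  using tensF by (simp add: hilbert_tensor_def)

lemma ketF_apply: "blinfun_apply (ketF tensF \<eta>) u = tensF u \<eta>"
  and ketF_bop: "ketF tensF \<eta> \<in> bop"
  and norm_ketF: "norm (ketF tensF \<eta>) \<le> norm \<eta>"
proof -
  have bl: "bounded_linear (\<lambda>u. tensF u \<eta>)"
    by (rule bounded_linear_intro[where K = "norm \<eta>"])
       (auto simp: bilinear_isometricD[OF tensF_isometric] scaleR_scaleC bilinear_isometric_norm[OF tensF_isometric])
  thus a: "blinfun_apply (ketF tensF \<eta>) u = tensF u \<eta>" for u
    by (simp add: ketF_def bounded_linear_Blinfun_apply)
  thus "ketF tensF \<eta> \<in> bop" by (simp add: bop_def bilinear_isometricD[OF tensF_isometric])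
  show "norm (ketF tensF \<eta>) \<le> norm \<eta>"
    by (rule norm_blinfun_bound) (simp_all add: a bilinear_isometric_norm[OF tensF_isometric] mult.commute)
qed

text \<open>Slices at arbitrary Fock vectors. Besides the time-dependent vectors of
  \<open>fock_slice\<close> the argument needs fixed vectors \<epsilon>(f), \<epsilon>(g), for which
  bounds do not involve the time.\<close>

definition vec_slice :: "'f \<Rightarrow> 'f \<Rightarrow> real \<Rightarrow> ('h \<Rightarrow>\<^sub>L 'h) \<Rightarrow> ('h \<Rightarrow>\<^sub>L 'h)"
  where "vec_slice \<zeta> \<eta> t a = adj (ketF tensF \<zeta>) o\<^sub>L j t a o\<^sub>L ketF tensF \<eta>"

lemma fock_slice_vec: "fock_slice \<epsilon> tensF j t f g = vec_slice (\<epsilon> (upto_time t f)) (\<epsilon> (upto_time t g)) t"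
  by (rule ext) (simp add: fock_slice_def vec_slice_def)

lemma vec_slice_inner:
  "cinner u (blinfun_apply (vec_slice \<zeta> \<eta> t a) v) = cinner (tensF u \<zeta>) (blinfun_apply (j t a) (tensF v \<eta>))"
  by (simp add: vec_slice_def cinner_adj_right ketF_bop ketF_apply)

lemma norm_vec_slice:
  assumes "t \<ge> 0" "a \<in> A"
  shows "norm (vec_slice \<zeta> \<eta> t a) \<le> norm \<zeta> * norm \<eta> * norm a"
proof -
  have "norm (vec_slice \<zeta> \<eta> t a) \<le> norm (ketF tensF \<zeta>) * norm (j t a) * norm (ketF tensF \<eta>)"
    unfolding vec_slice_def norm_adj[OF ketF_bop, of \<zeta>, symmetric]
    by (rule order_trans[OF norm_blinfun_compose mult_right_mono[OF norm_blinfun_compose norm_ge_zero]])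
  also have "\<dots> \<le> norm \<zeta> * norm a * norm \<eta>"
    by (intro mult_mono norm_ketF operator_hom.hom_contractive[OF operator_hom[OF assms(1)] assms(2)]) auto
  finally show ?thesis by (simp add: mult_ac)
qed

lemma vec_slice_clinear:
  assumes "t \<ge> 0" shows "clinear_on A (vec_slice \<zeta> \<eta> t)"
  unfolding clinear_on_def
  by (intro conjI ballI allI; rule blinfun_eq_cinnerI)
     (simp_all add: vec_slice_inner operator_hom.hom_add[OF operator_hom[OF assms]]
        operator_hom.hom_scale[OF operator_hom[OF assms]] blinfun.add_left scaleC_blinfun.rep_eq cinner_algebra)

lemma vec_slice_diff:
  assumes "t \<ge> 0" "a \<in> A" "b \<in> A"
  shows "vec_slice \<zeta> \<eta> t (a - b) = vec_slice \<zeta> \<eta> t a - vec_slice \<zeta> \<eta> t b"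
  by (rule blinfun_eq_cinnerI)
     (simp add: vec_slice_inner operator_hom.hom_diff[OF operator_hom] assms blinfun.diff_left cinner_diff_right)

lemma vec_slice_vec_diff:
  assumes "t \<ge> 0" "a \<in> A"
  shows "norm (vec_slice \<zeta> \<eta> t a - vec_slice \<zeta>' \<eta>' t a) \<le>
    (norm (\<zeta> - \<zeta>') * norm \<eta> + norm \<zeta>' * norm (\<eta> - \<eta>')) * norm a"
proof -
  note t' = bilinear_isometricD(2)[OF tensF_isometric]
  have "vec_slice \<zeta> \<eta> t a - vec_slice \<zeta>' \<eta>' t a = vec_slice (\<zeta> - \<zeta>') \<eta> t a + vec_slice \<zeta>' (\<eta> - \<eta>') t a"
  proof (rule blinfun_eq_cinnerI)
    fix u v
    show "cinner u (blinfun_apply (vec_slice \<zeta> \<eta> t a - vec_slice \<zeta>' \<eta>' t a) v) =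
      cinner u (blinfun_apply (vec_slice (\<zeta> - \<zeta>') \<eta> t a + vec_slice \<zeta>' (\<eta> - \<eta>') t a) v)"
      using t'[of u "\<zeta> - \<zeta>'" \<zeta>'] t'[of v "\<eta> - \<eta>'" \<eta>']
      by (simp add: blinfun.diff_left blinfun.add_left blinfun.add_right cinner_algebra vec_slice_inner)
  qed
  also have "norm \<dots> \<le> norm (\<zeta> - \<zeta>') * norm \<eta> * norm a + norm \<zeta>' * norm (\<eta> - \<eta>') * norm a"
    by (intro norm_triangle_mono norm_vec_slice assms)
  finally show ?thesis by (simp add: algebra_simps)
qed

lemma vec_slice_tendsto:
  assumes t: "t \<ge> 0" and x: "\<And>n. x n \<in> A" "a \<in> A" "x \<longlonglongrightarrow> a"
  shows "(\<lambda>n. vec_slice \<zeta> \<eta> t (x n)) \<longlonglongrightarrow> vec_slice \<zeta> \<eta> t a"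
proof (rule LIM_zero_cancel, rule Lim_null_comparison)
  have "norm (vec_slice \<zeta> \<eta> t (x n) - vec_slice \<zeta> \<eta> t a) \<le> norm \<zeta> * norm \<eta> * norm (x n - a)" for n
    unfolding vec_slice_diff[OF t x(1,2), symmetric]
    by (intro norm_vec_slice t cvec.subspace_diff A_subspace x)
  thus "\<forall>\<^sub>F n in sequentially. norm (vec_slice \<zeta> \<eta> t (x n) - vec_slice \<zeta> \<eta> t a) \<le>
      norm \<zeta> * norm \<eta> * norm (x n - a)" by simp
  show "(\<lambda>n. norm \<zeta> * norm \<eta> * norm (x n - a)) \<longlonglongrightarrow> 0"
    using tendsto_mult[OF tendsto_const tendsto_norm_zero[OF LIM_zero[OF x(3)]]] by simp
qed

lemma dense_seq:
  assumes "a \<in> A" obtains x where "\<And>n::nat. x n \<in> A0" "\<And>n. x n \<in> A" "x \<longlonglongrightarrow> a"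
proof -
  have "a \<in> closure A0" using assms A_dense by blast
  then obtain x where "\<forall>n. x n \<in> A0" "x \<longlonglongrightarrow> a" using closure_sequential[of a A0] by blast
  thus ?thesis using that[of x] A0_A by blast
qed

lemma vec_slice_eqI:
  assumes t: "t \<ge> 0" "t' \<ge> 0" and eq: "\<And>x. x \<in> A0 \<Longrightarrow> vec_slice \<zeta> \<eta> t x = q *\<^sub>C vec_slice \<zeta>' \<eta>' t' x"
    and a: "a \<in> A"
  shows "vec_slice \<zeta> \<eta> t a = q *\<^sub>C vec_slice \<zeta>' \<eta>' t' a"
proof -
  obtain x where x: "\<And>n::nat. x n \<in> A0" "\<And>n. x n \<in> A" "x \<longlonglongrightarrow> a" by (rule dense_seq[OF a]) blast
  have "(\<lambda>n. vec_slice \<zeta> \<eta> t (x n)) \<longlonglongrightarrow> vec_slice \<zeta> \<eta> t a" by (rule vec_slice_tendsto[OF t(1) x(2) a x(3)])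
  moreover have "(\<lambda>n. q *\<^sub>C vec_slice \<zeta>' \<eta>' t' (x n)) \<longlonglongrightarrow> q *\<^sub>C vec_slice \<zeta>' \<eta>' t' a"
    by (intro bounded_bilinear.tendsto[OF bounded_bilinear_scaleC_blinfun] tendsto_const
        vec_slice_tendsto[OF t(2) x(2) a x(3)])
  ultimately show ?thesis using eq x(1) LIMSEQ_unique by simp
qed

text \<open>The path (1, f) on the half-line, extended by zero: \<open>good\<close> imposes its
  conditions on the whole line, where f itself is uncontrolled.\<close>

definition clip_path :: "(real \<Rightarrow> 'k) \<Rightarrow> real \<Rightarrow> complex \<times> 'k"
  where "clip_path f r = (if r \<ge> 0 then fhat f r else 0)"

lemma good_clip_path:
  assumes "f \<in> L2" "g \<in> L2" "\<And>r. norm (f r) \<le> c" "\<And>r. norm (g r) \<le> c"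
  shows "good (1 + c) (clip_path f) (clip_path g)"
proof -
  have c: "c \<ge> 0" using assms(3)[of 0] norm_ge_zero order_trans by blast
  have n: "norm (clip_path h r) \<le> 1 + c" if "\<And>r. norm (h r) \<le> c" for h r
    using norm_Pair_le[of "1::complex" "h r"] that[of r] c by (auto simp: clip_path_def fhat_def)
  have "(\<lambda>r. cinner (clip_path f r) (blinfun_apply b (clip_path g r))) \<in> borel_measurable borel" for b
  proof -
    have "(\<lambda>r. indicator {0..} r *\<^sub>R cinner (fhat f r) (blinfun_apply b (fhat g r))) \<in> borel_measurable lborel"
      using L2_fhat_measurable[OF assms(1,2), of b] by (subst (asm) borel_measurable_restrict_space_iff) auto
    also have "(\<lambda>r. indicator {0..} r *\<^sub>R cinner (fhat f r) (blinfun_apply b (fhat g r))) =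
        (\<lambda>r. cinner (clip_path f r) (blinfun_apply b (clip_path g r)))"
      by (auto simp: clip_path_def indicator_def)
    finally show ?thesis by simp
  qed
  thus ?thesis using n assms by (auto simp: good_def)
qed

text \<open>The vectors are not truncated at t. The Wiener integrals see the paths only up to t,
  whereas the scalar factor involves all of f and g and is constant in t; the cocycle proof divides
  it out.\<close>

lemma vec_slice_exp:
  assumes f: "f \<in> L2" and g: "g \<in> L2" and bd: "\<And>r. norm (f r) \<le> c" "\<And>r. norm (g r) \<le> c"
    and t: "t \<ge> 0" and x: "x \<in> A0"
  shows "vec_slice (\<epsilon> f) (\<epsilon> g) t x = exp (L2_inner f g) *\<^sub>C flow_sum (clip_path f) (clip_path g) t x"
proof (rule blinfun_eq_cinnerI)
  fix u v
  note gd = good_clip_path[OF f g bd]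
  have efg: "cinner (\<epsilon> f) (\<epsilon> g) = exp (L2_inner f g)" using fock f g by (simp add: boson_fock_def)
  obtain \<Lambda> where \<Lambda>: "\<And>n. wiener_integral emb app \<epsilon> tensF n t (rw n x) (\<Lambda> n)"
    "\<And>\<zeta>. \<zeta> \<in> exp_domain \<epsilon> tensF \<Longrightarrow> (\<lambda>n. \<Lambda> n \<zeta>) sums blinfun_apply (j t x) \<zeta>"
    using series[OF t x] by (auto simp: is_flow_series_def)
  have "tensF v (\<epsilon> g) \<in> exp_domain \<epsilon> tensF"
    unfolding exp_domain_def by (rule cvec.span_base) (use g in blast)
  from bounded_linear.sums[OF bounded_bilinear.bounded_linear_right[OF bounded_bilinear_cinner] \<Lambda>(2)[OF this]]
  have "(\<lambda>n. cinner (tensF u (\<epsilon> f)) (\<Lambda> n (tensF v (\<epsilon> g)))) sums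
      cinner u (blinfun_apply (vec_slice (\<epsilon> f) (\<epsilon> g) t x) v)"
    by (simp add: vec_slice_inner)
  moreover have "cinner (tensF u (\<epsilon> f)) (\<Lambda> n (tensF v (\<epsilon> g))) =
      exp (L2_inner f g) * cinner u (blinfun_apply (iter_int (clip_path f) (clip_path g) n t x) v)" for n
  proof (cases n)
    case 0
    obtain a where a: "a \<in> bop" "level0 emb app x = level0 emb app a"
      "\<Lambda> 0 (tensF v (\<epsilon> g)) = tensF (blinfun_apply a v) (\<epsilon> g)"
      using \<Lambda>(1)[of 0] g by (auto simp: wiener_integral_def)
    have "x = a" using level0_inject[of x a] a x A0_bop by auto
    thus ?thesis using a(3) by (simp add: 0 bilinear_isometricD(5)[OF tensF_isometric] efg)
  next
    case (Suc m)
    have "cinner (tensF u (\<epsilon> f)) (\<Lambda> n (tensF v (\<epsilon> g))) =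
      (LINT \<tau>:simplex_times n t|Pi\<^sub>M {..<n} (\<lambda>_. lborel).
            cinner (tensor_word emb app u (map (\<lambda>i. fhat f (\<tau> i)) [0..<n]))
              (blinfun_apply (rw n x) (tensor_word emb app v (map (\<lambda>i. fhat g (\<tau> i)) [0..<n]))))
         * cinner (\<epsilon> f) (\<epsilon> g)"
      using \<Lambda>(1)[of n] f g by (simp add: wiener_integral_def Suc del: upt_Suc random_walk.simps)
    also have "(LINT \<tau>:simplex_times n t|Pi\<^sub>M {..<n} (\<lambda>_. lborel).
            cinner (tensor_word emb app u (map (\<lambda>i. fhat f (\<tau> i)) [0..<n]))
              (blinfun_apply (rw n x) (tensor_word emb app v (map (\<lambda>i. fhat g (\<tau> i)) [0..<n])))) =
       (LINT \<tau>:simplex_times n t|Pi\<^sub>M {..<n} (\<lambda>_. lborel).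
          walk_inner (clip_path f) (clip_path g) u v n x \<tau>)"
    proof (rule set_lebesgue_integral_cong[OF simplex_times_sets], intro allI impI)
      fix \<tau> assume \<tau>: "\<tau> \<in> simplex_times n t"
      have "map (\<lambda>i. fhat h (\<tau> i)) [0..<n] = map (\<lambda>i. clip_path h (\<tau> i)) [0..<n]" for h
        using \<tau> by (auto simp: simplex_times_def PiE_iff clip_path_def)
      thus "cinner (tensor_word emb app u (map (\<lambda>i. fhat f (\<tau> i)) [0..<n]))
              (blinfun_apply (rw n x) (tensor_word emb app v (map (\<lambda>i. fhat g (\<tau> i)) [0..<n]))) =
          walk_inner (clip_path f) (clip_path g) u v n x \<tau>"
        unfolding walk_inner_def by (simp only:)
    qed
    also have "\<dots> = cinner u (blinfun_apply (iter_int (clip_path f) (clip_path g) n t x) v)"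
      unfolding Suc by (rule integral_simplex_times[OF gd x t])
    finally show ?thesis using efg by simp
  qed
  moreover have s2: "(\<lambda>n. cinner u (blinfun_apply (iter_int (clip_path f) (clip_path g) n t x) v)) sums
      cinner u (blinfun_apply (flow_sum (clip_path f) (clip_path g) t x) v)"
    using bounded_linear.sums[OF bounded_linear_compose[OF
      bounded_bilinear.bounded_linear_right[OF bounded_bilinear_cinner] blinfun.bounded_linear_left]
      flow_sum_sums[OF gd x t]] .
  moreover note sums_mult[OF s2, of "exp (L2_inner f g)"]
  ultimately show "cinner u (blinfun_apply (vec_slice (\<epsilon> f) (\<epsilon> g) t x) v) =
    cinner u (blinfun_apply (exp (L2_inner f g) *\<^sub>C flow_sum (clip_path f) (clip_path g) t x) v)"
    by (simp add: scaleC_blinfun.rep_eq cinner_scaleC_right sums_unique2)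
qed

lemma flow_sum_cong:
  assumes "\<And>r. 0 \<le> r \<Longrightarrow> r < t \<Longrightarrow> \<xi> r = \<xi>' r \<and> \<eta> r = \<eta>' r"
  shows "flow_sum \<xi> \<eta> t x = flow_sum \<xi>' \<eta>' t x"
  unfolding flow_sum_def by (subst iter_int_cong[OF assms]) auto

lemma norm_upto_time: "norm (f r) \<le> c \<Longrightarrow> norm (upto_time t f r) \<le> c"
  using norm_ge_zero[of "f r"] by (auto simp: upto_time_def indicator_def simp del: norm_ge_zero)

section \<open>The cocycle for bounded f and g\<close>

context
  fixes f g :: "real \<Rightarrow> 'k" and c :: real
  assumes f: "f \<in> L2" and g: "g \<in> L2" and bd: "\<And>r. norm (f r) \<le> c" "\<And>r. norm (g r) \<le> c"
begin

text \<open>Truncation at t alters the scalar factor but not the sum, which depends on the paths on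
  [0,t) only.\<close>

lemma fock_slice_flow_sum:
  assumes t: "t \<ge> 0" and x: "x \<in> A0"
  shows "fock_slice \<epsilon> tensF j t f g x =
    exp (integral {0..t} (inner_path f g)) *\<^sub>C flow_sum (clip_path f) (clip_path g) t x"
proof -
  have "fock_slice \<epsilon> tensF j t f g x = exp (L2_inner (upto_time t f) (upto_time t g)) *\<^sub>C
      flow_sum (clip_path (upto_time t f)) (clip_path (upto_time t g)) t x"
    unfolding fock_slice_vec
    by (rule vec_slice_exp[OF upto_time_L2[OF f] upto_time_L2[OF g] norm_upto_time[OF bd(1)]
          norm_upto_time[OF bd(2)] t x])
  also have "flow_sum (clip_path (upto_time t f)) (clip_path (upto_time t g)) t x =
      flow_sum (clip_path f) (clip_path g) t x"
    by (rule flow_sum_cong) (simp add: clip_path_def fhat_def upto_time_def)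
  finally show ?thesis unfolding L2_inner_upto[OF f g bd t] .
qed

lemma fock_slice_A_bounded:
  assumes t: "t \<ge> 0" and a: "a \<in> A" shows "fock_slice \<epsilon> tensF j t f g a \<in> A"
proof -
  obtain x where x: "\<And>n::nat. x n \<in> A0" "\<And>n. x n \<in> A" "x \<longlonglongrightarrow> a" by (rule dense_seq[OF a]) blast
  show ?thesis
  proof (rule closed_sequentially[OF A_closed])
    show "fock_slice \<epsilon> tensF j t f g (x n) \<in> A" for n
      unfolding fock_slice_flow_sum[OF t x(1)]
      by (intro cvec.subspace_scale A_subspace flow_sum_A[OF good_clip_path[OF f g bd]] x t)
    show "(\<lambda>n. fock_slice \<epsilon> tensF j t f g (x n)) \<longlonglongrightarrow> fock_slice \<epsilon> tensF j t f g a"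
      unfolding fock_slice_vec by (rule vec_slice_tendsto[OF t x(2) a x(3)])
  qed
qed

lemma fock_slice_continuous_bounded:
  assumes a: "a \<in> A" shows "continuous_on {0..} (\<lambda>t. fock_slice \<epsilon> tensF j t f g a)"
proof -
  obtain x where x: "\<And>n::nat. x n \<in> A0" "\<And>n. x n \<in> A" "x \<longlonglongrightarrow> a" by (rule dense_seq[OF a]) blast
  have c0: "continuous_on {0..} (\<lambda>t. fock_slice \<epsilon> tensF j t f g (x n))" for n
  proof -
    have "continuous_on {0..} (\<lambda>t. integral {0..t} (inner_path f g))"
      by (intro continuous_on_atLeastI indefinite_integral_continuous_1
          set_borel_integral_eq_integral(1)[OF inner_path_integrable[OF f g bd]])
    hence "continuous_on {0..} (\<lambda>t. exp (integral {0..t} (inner_path f g)) *\<^sub>C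
        flow_sum (clip_path f) (clip_path g) t (x n))"
      by (intro bounded_bilinear.continuous_on[OF bounded_bilinear_scaleC_blinfun] continuous_on_exp
          flow_sum_continuous[OF good_clip_path[OF f g bd]] x(1))
    thus ?thesis by (rule continuous_on_eq) (simp add: fock_slice_flow_sum x(1))
  qed
  \<comment> \<open>Truncation in time never increases the norm of an exponential vector beyond
    exp(|f|^2 / 2). So the approximation of a by elements of \<open>A0\<close> is uniform in t, and
    continuity passes to the limit.\<close>
  define K where "K = exp (L2_normsq f / 2) * exp (L2_normsq g / 2)"
  have "uniform_limit {0..} (\<lambda>n t. fock_slice \<epsilon> tensF j t f g (x n)) (\<lambda>t. fock_slice \<epsilon> tensF j t f g a) sequentially"
    unfolding uniform_limit_iff
  proof (intro allI impI)
    fix e :: real assume e: "e > 0"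
    have "(\<lambda>n. K * norm (x n - a)) \<longlonglongrightarrow> 0"
      using tendsto_mult[OF tendsto_const tendsto_norm_zero[OF LIM_zero[OF x(3)]]] by simp
    hence ev: "\<forall>\<^sub>F n in sequentially. K * norm (x n - a) < e" using e by (rule order_tendstoD)
    have le: "dist (fock_slice \<epsilon> tensF j t f g (x n)) (fock_slice \<epsilon> tensF j t f g a) \<le> K * norm (x n - a)"
      if t: "t \<ge> 0" for n t
    proof -
      have "dist (fock_slice \<epsilon> tensF j t f g (x n)) (fock_slice \<epsilon> tensF j t f g a) \<le>
          norm (\<epsilon> (upto_time t f)) * norm (\<epsilon> (upto_time t g)) * norm (x n - a)"
        unfolding fock_slice_vec dist_norm vec_slice_diff[OF t x(2) a, symmetric]
        by (intro norm_vec_slice t cvec.subspace_diff A_subspace x a)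
      also have "\<dots> \<le> K * norm (x n - a)"
        unfolding K_def by (intro mult_right_mono mult_mono norm_exp_vector_upto fock f g) auto
      finally show ?thesis .
    qed
    from ev show "\<forall>\<^sub>F n in sequentially. \<forall>t\<in>{0..}. dist (fock_slice \<epsilon> tensF j t f g (x n))
        (fock_slice \<epsilon> tensF j t f g a) < e"
      by eventually_elim (auto intro: le_less_trans[OF le])
  qed
  thus ?thesis by (rule uniform_limit_theorem[rotated]) (auto intro!: always_eventually c0)
qed

end

text \<open>\<open>\<Phi>\<close> extends the sums from \<open>A0\<close> to \<open>A\<close> by
  means of the fixed vectors, divided by their scalar factor. It satisfies the bare cocycle
  identity, and the scalars restored at the end multiply correctly because their exponents
  add.\<close>

lemma fock_slice_cocycle_bounded:
  assumes f: "f \<in> L2" and g: "g \<in> L2" and bd: "\<And>r. norm (f r) \<le> c" "\<And>r. norm (g r) \<le> c"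
    and s: "s \<ge> 0" and t: "t \<ge> 0" and a: "a \<in> A"
  shows "fock_slice \<epsilon> tensF j (s + t) f g a =
       fock_slice \<epsilon> tensF j s f g (fock_slice \<epsilon> tensF j t (\<lambda>r. f (r + s)) (\<lambda>r. g (r + s)) a)"
proof -
  let ?f = "\<lambda>r. f (r + s)" and ?g = "\<lambda>r. g (r + s)"
  note f' = translate_L2[OF f s] and g' = translate_L2[OF g s]
  have st: "s + t \<ge> 0" using s t by simp
  note gd = good_clip_path[OF f g bd]
  define q where "q = exp (- L2_inner f g)"
  define \<Phi> where "\<Phi> r a = q *\<^sub>C vec_slice (\<epsilon> f) (\<epsilon> g) r a" for r a
  have \<Phi>_eq: "\<Phi> r x = flow_sum (clip_path f) (clip_path g) r x" if "r \<ge> 0" "x \<in> A0" for r x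
    unfolding \<Phi>_def q_def vec_slice_exp[OF f g bd that] by (simp add: scaleC_scaleC scaleC_one flip: exp_add)
  have \<Phi>_lin: "clinear_on A (\<Phi> r)" if "r \<ge> 0" for r
    using vec_slice_clinear[OF that, of "\<epsilon> f" "\<epsilon> g"]
    by (simp add: clinear_on_def \<Phi>_def scaleC_add_right scaleC_scaleC mult.commute)
  have \<Phi>_bd: "norm (\<Phi> r a) \<le> (cmod q * (norm (\<epsilon> f) * norm (\<epsilon> g))) * norm a" if "r \<ge> 0" "a \<in> A" for r a
    unfolding \<Phi>_def norm_scaleC_blinfun using norm_vec_slice[OF that] by (simp add: mult_left_mono mult.assoc)
  define G where "G = flow_sum (\<lambda>r. clip_path f (s + r)) (\<lambda>r. clip_path g (s + r))"
  have G_eq: "G r = flow_sum (clip_path ?f) (clip_path ?g) r" for r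
    unfolding G_def
    by (rule ext, rule flow_sum_cong) (use s in \<open>simp add: clip_path_def fhat_def add.commute\<close>)
  \<comment> \<open>A bound on the sums in terms of \<open>norm x\<close> is not visible from the
    series; it comes from the representation of the shifted paths by contractive
    homomorphisms.\<close>
  have G_bd: "norm (G r x) \<le> (cmod (exp (- L2_inner ?f ?g)) * (norm (\<epsilon> ?f) * norm (\<epsilon> ?g))) * norm x"
    if "r \<ge> 0" "x \<in> A0" for r x
  proof -
    have "G r x = exp (- L2_inner ?f ?g) *\<^sub>C vec_slice (\<epsilon> ?f) (\<epsilon> ?g) r x"
      unfolding G_eq vec_slice_exp[OF f' g' bd that] by (simp add: scaleC_scaleC scaleC_one flip: exp_add)
    moreover have "x \<in> A" using that A0_A by auto
    ultimately show ?thesis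
      unfolding norm_scaleC_blinfun
      using norm_vec_slice[OF that(1), of x "\<epsilon> ?f" "\<epsilon> ?g"]
      by (simp add: norm_scaleC_blinfun mult_left_mono mult.assoc del: norm_exp_eq_Re)
  qed
  have co: "\<Phi> (s + t) x = \<Phi> s (G t x)" if "x \<in> A0" for x
    unfolding G_def
    by (rule flow_sum_cocycle[OF gd s \<Phi>_lin \<Phi>_bd \<Phi>_eq G_bd[unfolded G_def] that t])
  define I where "I r = integral {0..r} (inner_path f g)" for r
  define I' where "I' = integral {0..t} (inner_path ?f ?g)"
  have I_add: "I (s + t) = I s + I'"
  proof -
    note int = set_borel_integral_eq_integral(1)[OF inner_path_integrable[OF f g bd]]
    have "I (s + t) = I s + integral {s..s + t} (inner_path f g)"
      unfolding I_def using s t by (intro Henstock_Kurzweil_Integration.integral_combine[symmetric] int) auto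
    also have "integral {s..s + t} (inner_path f g) = integral {0..t} (\<lambda>r. inner_path f g (s + r))"
      using integral_unique[OF has_integral_translate[OF integrable_integral[OF int]]] by simp
    also have "\<dots> = I'" unfolding I'_def
      by (rule Henstock_Kurzweil_Integration.integral_cong) (use s in \<open>auto simp: inner_path_def add.commute\<close>)
    finally show ?thesis .
  qed
  \<comment> \<open>The inner slice of an element of \<open>A0\<close> is in \<open>A\<close> but
    not known to be in \<open>A0\<close>, so the relation between truncated and fixed vectors must
    be available on all of \<open>A\<close>.\<close>
  have fs: "fock_slice \<epsilon> tensF j s f g b = exp (I s) *\<^sub>C \<Phi> s b" if b: "b \<in> A" for b
    unfolding fock_slice_vec \<Phi>_def scaleC_scaleC
  proof (rule vec_slice_eqI[OF s s _ b])
    fix x assume x: "x \<in> A0"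
    have "vec_slice (\<epsilon> (upto_time s f)) (\<epsilon> (upto_time s g)) s x = exp (I s) *\<^sub>C \<Phi> s x"
      using fock_slice_flow_sum[OF f g bd s x] \<Phi>_eq[OF s x] by (simp add: fock_slice_vec I_def)
    thus "vec_slice (\<epsilon> (upto_time s f)) (\<epsilon> (upto_time s g)) s x = (exp (I s) * q) *\<^sub>C vec_slice (\<epsilon> f) (\<epsilon> g) s x"
      by (simp add: \<Phi>_def scaleC_scaleC)
  qed
  have main: "fock_slice \<epsilon> tensF j (s + t) f g x = fock_slice \<epsilon> tensF j s f g (fock_slice \<epsilon> tensF j t ?f ?g x)"
    if x: "x \<in> A0" for x
  proof -
    have GA: "G t x \<in> A" unfolding G_def by (rule flow_sum_A[OF good_translate[OF gd] x t])
    have "fock_slice \<epsilon> tensF j t ?f ?g x = exp I' *\<^sub>C G t x"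
      using fock_slice_flow_sum[OF f' g' bd t x] by (simp add: I'_def G_eq)
    hence "fock_slice \<epsilon> tensF j s f g (fock_slice \<epsilon> tensF j t ?f ?g x) = exp (I s) *\<^sub>C \<Phi> s (exp I' *\<^sub>C G t x)"
      using fs[of "exp I' *\<^sub>C G t x"] cvec.subspace_scale[OF A_subspace GA] by simp
    also have "\<dots> = exp (I (s + t)) *\<^sub>C \<Phi> (s + t) x"
      using \<Phi>_lin[OF s] GA by (simp add: co[OF x] I_add exp_add clinear_on_def scaleC_scaleC)
    also have "\<dots> = fock_slice \<epsilon> tensF j (s + t) f g x"
      using fock_slice_flow_sum[OF f g bd st x] \<Phi>_eq[OF st x] by (simp add: I_def)
    finally show ?thesis by simp
  qed
  obtain x where x: "\<And>n::nat. x n \<in> A0" "\<And>n. x n \<in> A" "x \<longlonglongrightarrow> a" by (rule dense_seq[OF a]) blast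
  have 1: "(\<lambda>n. fock_slice \<epsilon> tensF j (s + t) f g (x n)) \<longlonglongrightarrow> fock_slice \<epsilon> tensF j (s + t) f g a"
    unfolding fock_slice_vec by (rule vec_slice_tendsto[OF st x(2) a x(3)])
  have 2: "(\<lambda>n. fock_slice \<epsilon> tensF j t ?f ?g (x n)) \<longlonglongrightarrow> fock_slice \<epsilon> tensF j t ?f ?g a"
    unfolding fock_slice_vec by (rule vec_slice_tendsto[OF t x(2) a x(3)])
  note inA = fock_slice_A_bounded[OF f' g' bd t]
  have 3: "(\<lambda>n. fock_slice \<epsilon> tensF j s f g (fock_slice \<epsilon> tensF j t ?f ?g (x n))) \<longlonglongrightarrow>
      fock_slice \<epsilon> tensF j s f g (fock_slice \<epsilon> tensF j t ?f ?g a)"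
    unfolding fock_slice_vec[of s]
    by (rule vec_slice_tendsto[OF s inA[OF x(2)] inA[OF a] 2])
  show ?thesis using LIMSEQ_unique[OF 1] 3 by (simp add: main[OF x(1)])
qed

text \<open>The error depends neither on t nor on a except through \<open>norm a\<close>. The first
  gives norm continuity in t, the second allows a to vary along with the truncation.\<close>

lemma fock_slice_truncate_dist:
  assumes f: "f \<in> L2" and g: "g \<in> L2"
  obtains \<delta> where "\<delta> \<longlonglongrightarrow> 0" "\<And>m t a. t \<ge> 0 \<Longrightarrow> a \<in> A \<Longrightarrow>
    norm (fock_slice \<epsilon> tensF j t (truncate m f) (truncate m g) a - fock_slice \<epsilon> tensF j t f g a) \<le> \<delta> m * norm a"
proof
  define d where "d h m = sqrt (exp (L2_normsq h) * (L2_normsq h - L2_normsq (truncate m h)))" for h :: "real \<Rightarrow> 'k" and m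
  define \<delta> where "\<delta> m = d f m * exp (L2_normsq g / 2) + exp (L2_normsq f / 2) * d g m" for m
  have "\<delta> \<longlonglongrightarrow> 0 * exp (L2_normsq g / 2) + exp (L2_normsq f / 2) * 0"
    unfolding \<delta>_def d_def by (intro tendsto_intros truncate_dist_tendsto f g)
  thus "\<delta> \<longlonglongrightarrow> 0" by simp
  fix m a and t :: real assume t: "t \<ge> 0" and a: "a \<in> A"
  have tr: "norm (\<epsilon> (upto_time t (truncate m g))) \<le> exp (L2_normsq g / 2)"
    using norm_exp_vector_upto[OF fock truncate_L2[OF g], of t m] L2_normsq_truncate_le[OF g, of m]
    by (smt (verit) divide_right_mono exp_le_cancel_iff)
  have d0: "0 \<le> d f m" "0 \<le> d g m"
    unfolding d_def using L2_normsq_truncate_le[OF f, of m] L2_normsq_truncate_le[OF g, of m] by auto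
  have "norm (fock_slice \<epsilon> tensF j t (truncate m f) (truncate m g) a - fock_slice \<epsilon> tensF j t f g a) \<le>
      (norm (\<epsilon> (upto_time t (truncate m f)) - \<epsilon> (upto_time t f)) * norm (\<epsilon> (upto_time t (truncate m g))) +
       norm (\<epsilon> (upto_time t f)) * norm (\<epsilon> (upto_time t (truncate m g)) - \<epsilon> (upto_time t g))) * norm a"
    unfolding fock_slice_vec by (rule vec_slice_vec_diff[OF t a])
  also have "\<dots> \<le> \<delta> m * norm a"
    unfolding \<delta>_def
    using exp_vector_truncate_dist[OF fock f, of t m] exp_vector_truncate_dist[OF fock g, of t m] d0
    by (intro mult_right_mono add_mono mult_mono tr norm_exp_vector_upto fock f) (auto simp: d_def)
  finally show "norm (fock_slice \<epsilon> tensF j t (truncate m f) (truncate m g) a - fock_slice \<epsilon> tensF j t f g a) \<le>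
    \<delta> m * norm a" .
qed

text \<open>The argument moves with m because in the cocycle identity the outer slice is applied to
  an inner slice that is itself truncated.\<close>

lemma fock_slice_truncate_tendsto:
  assumes f: "f \<in> L2" and g: "g \<in> L2" and t: "t \<ge> 0" and x: "\<And>m. x m \<in> A" "a \<in> A" "x \<longlonglongrightarrow> a"
  shows "(\<lambda>m. fock_slice \<epsilon> tensF j t (truncate m f) (truncate m g) (x m)) \<longlonglongrightarrow> fock_slice \<epsilon> tensF j t f g a"
proof -
  obtain \<delta> where \<delta>: "\<delta> \<longlonglongrightarrow> 0" "\<And>m t a. t \<ge> 0 \<Longrightarrow> a \<in> A \<Longrightarrow>
    norm (fock_slice \<epsilon> tensF j t (truncate m f) (truncate m g) a - fock_slice \<epsilon> tensF j t f g a) \<le> \<delta> m * norm a"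
    by (rule fock_slice_truncate_dist[OF f g]) blast
  have "(\<lambda>m. fock_slice \<epsilon> tensF j t (truncate m f) (truncate m g) (x m) - fock_slice \<epsilon> tensF j t f g (x m)) \<longlonglongrightarrow> 0"
  proof (rule Lim_null_comparison)
    show "\<forall>\<^sub>F m in sequentially. norm (fock_slice \<epsilon> tensF j t (truncate m f) (truncate m g) (x m) -
        fock_slice \<epsilon> tensF j t f g (x m)) \<le> \<delta> m * norm (x m)"
      using \<delta>(2)[OF t x(1)] by simp
    show "(\<lambda>m. \<delta> m * norm (x m)) \<longlonglongrightarrow> 0"
      using tendsto_mult[OF \<delta>(1) tendsto_norm[OF x(3)]] by simp
  qed
  moreover have "(\<lambda>m. fock_slice \<epsilon> tensF j t f g (x m)) \<longlonglongrightarrow> fock_slice \<epsilon> tensF j t f g a"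
    unfolding fock_slice_vec by (rule vec_slice_tendsto[OF t x])
  ultimately show ?thesis using tendsto_add by fastforce
qed

lemma fock_slice_A:
  assumes f: "f \<in> L2" and g: "g \<in> L2" and t: "t \<ge> 0" and a: "a \<in> A"
  shows "fock_slice \<epsilon> tensF j t f g a \<in> A"
  by (rule closed_sequentially[OF A_closed _ fock_slice_truncate_tendsto[OF f g t a a tendsto_const]])
     (rule fock_slice_A_bounded[OF truncate_L2[OF f] truncate_L2[OF g] norm_truncate norm_truncate t a])

lemma fock_slice_continuous:
  assumes f: "f \<in> L2" and g: "g \<in> L2" and a: "a \<in> A"
  shows "continuous_on {0..} (\<lambda>t. fock_slice \<epsilon> tensF j t f g a)"
proof -
  obtain \<delta> where \<delta>: "\<delta> \<longlonglongrightarrow> 0" "\<And>m t a. t \<ge> 0 \<Longrightarrow> a \<in> A \<Longrightarrow>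
    norm (fock_slice \<epsilon> tensF j t (truncate m f) (truncate m g) a - fock_slice \<epsilon> tensF j t f g a) \<le> \<delta> m * norm a"
    by (rule fock_slice_truncate_dist[OF f g]) blast
  have "uniform_limit {0..} (\<lambda>m t. fock_slice \<epsilon> tensF j t (truncate m f) (truncate m g) a)
      (\<lambda>t. fock_slice \<epsilon> tensF j t f g a) sequentially"
    unfolding uniform_limit_iff
  proof (intro allI impI)
    fix e :: real assume e: "e > 0"
    have "(\<lambda>m. \<delta> m * norm a) \<longlonglongrightarrow> 0" using tendsto_mult[OF \<delta>(1) tendsto_const, of "norm a"] by simp
    hence "\<forall>\<^sub>F m in sequentially. \<delta> m * norm a < e" using e by (rule order_tendstoD)
    thus "\<forall>\<^sub>F m in sequentially. \<forall>t\<in>{0..}. dist (fock_slice \<epsilon> tensF j t (truncate m f) (truncate m g) a)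
        (fock_slice \<epsilon> tensF j t f g a) < e"
      by eventually_elim (auto simp: dist_norm intro: le_less_trans[OF \<delta>(2)[OF _ a]])
  qed
  thus ?thesis
    by (rule uniform_limit_theorem[rotated])
       (auto intro!: always_eventually fock_slice_continuous_bounded[OF truncate_L2[OF f] truncate_L2[OF g]
          norm_truncate norm_truncate a])
qed

lemma fock_slice_cocycle:
  assumes f: "f \<in> L2" and g: "g \<in> L2" and s: "s \<ge> 0" and t: "t \<ge> 0" and a: "a \<in> A"
  shows "fock_slice \<epsilon> tensF j (s + t) f g a =
       fock_slice \<epsilon> tensF j s f g (fock_slice \<epsilon> tensF j t (\<lambda>r. f (r + s)) (\<lambda>r. g (r + s)) a)"
proof -
  note f' = translate_L2[OF f s] and g' = translate_L2[OF g s]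
  have st: "s + t \<ge> 0" using s t by simp
  have inner: "(\<lambda>m. fock_slice \<epsilon> tensF j t (truncate m (\<lambda>r. f (r + s))) (truncate m (\<lambda>r. g (r + s))) a) \<longlonglongrightarrow>
      fock_slice \<epsilon> tensF j t (\<lambda>r. f (r + s)) (\<lambda>r. g (r + s)) a"
    by (rule fock_slice_truncate_tendsto[OF f' g' t a a tendsto_const])
  have "(\<lambda>m. fock_slice \<epsilon> tensF j s (truncate m f) (truncate m g)
      (fock_slice \<epsilon> tensF j t (truncate m (\<lambda>r. f (r + s))) (truncate m (\<lambda>r. g (r + s))) a)) \<longlonglongrightarrow>
      fock_slice \<epsilon> tensF j s f g (fock_slice \<epsilon> tensF j t (\<lambda>r. f (r + s)) (\<lambda>r. g (r + s)) a)"
    by (rule fock_slice_truncate_tendsto[OF f g s _ _ inner])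
       (intro fock_slice_A truncate_L2 f' g' t a)+
  moreover have "(\<lambda>m. fock_slice \<epsilon> tensF j (s + t) (truncate m f) (truncate m g) a) \<longlonglongrightarrow>
      fock_slice \<epsilon> tensF j (s + t) f g a"
    by (rule fock_slice_truncate_tendsto[OF f g st a a tendsto_const])
  ultimately show ?thesis
    using fock_slice_cocycle_bounded[OF truncate_L2[OF f] truncate_L2[OF g] norm_truncate norm_truncate s t a]
    by (simp add: truncate_translate LIMSEQ_unique)
qed

lemma upto_time_zero: "upto_time t (\<lambda>_. 0) = (\<lambda>_. 0::'k)"
  by (simp add: upto_time_def)

lemma norm_exp_zero: "norm (\<epsilon> (\<lambda>_. 0)) = 1"
  using exp_vector_norm[OF fock zero_L2] by (simp add: L2_normsq_def power2_eq_1_iff) (metis norm_ge_zero not_one_le_zero neg_0_le_iff_le)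

lemma fock_slice_zero_time: "a \<in> A \<Longrightarrow> fock_slice \<epsilon> tensF j 0 (\<lambda>_. 0) (\<lambda>_. 0) a = a"
proof -
  assume a: "a \<in> A"
  obtain x where x: "\<And>n::nat. x n \<in> A0" "\<And>n. x n \<in> A" "x \<longlonglongrightarrow> a" by (rule dense_seq[OF a]) blast
  note gd = good_clip_path[OF zero_L2 zero_L2, of 0]
  have "fock_slice \<epsilon> tensF j 0 (\<lambda>_. 0) (\<lambda>_. 0) (x n) = x n" for n
  proof -
    have "(\<lambda>k. iter_int \<xi> \<eta> k 0 (x n)) sums iter_int \<xi> \<eta> 0 0 (x n)" for \<xi> \<eta>
    proof -
      have "iter_int \<xi> \<eta> k 0 (x n) = 0" if "k \<noteq> 0" for k using that by (cases k) auto
      from sums_finite[of "{0}" "\<lambda>k. iter_int \<xi> \<eta> k 0 (x n)", OF _ this] show ?thesis by simp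
    qed
    hence "flow_sum \<xi> \<eta> 0 (x n) = x n" for \<xi> \<eta> by (simp add: flow_sum_def sums_iff)
    thus ?thesis
      using fock_slice_flow_sum[OF zero_L2 zero_L2, of 0 0 "x n"] x(1) by (simp add: scaleC_one)
  qed
  moreover have "(\<lambda>n. fock_slice \<epsilon> tensF j 0 (\<lambda>_. 0) (\<lambda>_. 0) (x n)) \<longlonglongrightarrow> fock_slice \<epsilon> tensF j 0 (\<lambda>_. 0) (\<lambda>_. 0) a"
    unfolding fock_slice_vec by (rule vec_slice_tendsto[OF order_refl x(2) a x(3)])
  ultimately show ?thesis using x(3) LIMSEQ_unique by simp
qed

lemma feller: "feller_cocycle \<epsilon> tensF A j"
  unfolding feller_cocycle_def
  using fock_slice_zero_time fock_slice_A fock_slice_continuous fock_slice_cocycle by blast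

end


section \<open>Complete positivity\<close>

lemma quadratic_form_zero:
  assumes T: "T \<in> bop" and q: "\<And>x. cinner x (blinfun_apply T x) = 0"
  shows "T = 0"
proof (rule blinfun_eq_cinnerI)
  fix x y
  have 1: "cinner x (blinfun_apply T y) + cinner y (blinfun_apply T x) = 0"
    using q[of "x + y"] by (simp add: blinfun.add_right cinner_algebra q add.commute)
  have "\<i> * cinner x (blinfun_apply T y) - \<i> * cinner y (blinfun_apply T x) = 0"
    using q[of "x + \<i> *\<^sub>C y"] by (simp add: blinfun.add_right bop_scaleC[OF T] cinner_algebra q)
  hence "cinner x (blinfun_apply T y) = cinner y (blinfun_apply T x)" by simp
  with 1 show "cinner x (blinfun_apply T y) = cinner x (blinfun_apply 0 y)" by simp
qed

text \<open>Positivity of a matrix is given by its quadratic form alone; polarisation recovers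
  self-adjointness, which the square root requires.\<close>

lemma adj_eq_self_of_real_form:
  assumes T: "T \<in> bop" and q: "\<And>x. cinner x (blinfun_apply T x) \<in> \<real>"
  shows "adj T = T"
proof -
  have "adj T - T = 0"
  proof (rule quadratic_form_zero)
    show "adj T - T \<in> bop" using T by blast
    show "cinner x (blinfun_apply (adj T - T) x) = 0" for x
    proof -
      have "cinner x (blinfun_apply (adj T) x) = cnj (cinner x (blinfun_apply T x))"
        unfolding cinner_adj_right[OF T] by (rule cinner_commute)
      also have "\<dots> = cinner x (blinfun_apply T x)" using q[of x] by (simp add: Reals_cnj_iff)
      finally show ?thesis by (simp add: blinfun.diff_left cinner_diff_right)
    qed
  qed
  thus ?thesis by simp
qed

lemma sum_blinfun_compose_left: "(\<Sum>i\<in>I. g i) o\<^sub>L T = (\<Sum>i\<in>I. g i o\<^sub>L T)"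
  by (rule bounded_bilinear.sum_left[OF bounded_bilinear_blinfun_compose])

lemma sum_blinfun_compose_right: "T o\<^sub>L (\<Sum>i\<in>I. g i) = (\<Sum>i\<in>I. T o\<^sub>L g i)"
  by (rule bounded_bilinear.sum_right[OF bounded_bilinear_blinfun_compose])

lemma blinfun_compose_assoc': "(R o\<^sub>L S) o\<^sub>L T = R o\<^sub>L (S o\<^sub>L T)"
  by (rule blinfun_eqI) simp

lemmas blinfun_compose_algebra =
  bounded_bilinear.add_left[OF bounded_bilinear_blinfun_compose]
  bounded_bilinear.add_right[OF bounded_bilinear_blinfun_compose]
  bounded_bilinear.diff_left[OF bounded_bilinear_blinfun_compose]
  bounded_bilinear.diff_right[OF bounded_bilinear_blinfun_compose]
  bounded_bilinear.scaleR_left[OF bounded_bilinear_blinfun_compose]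
  bounded_bilinear.scaleR_right[OF bounded_bilinear_blinfun_compose]

text \<open>Matrices over \<open>A\<close> are realised as operators on \<open>\<H>\<close> through isometries \<open>V\<^sub>i\<close> of \<open>h\<close> into \<open>\<H>\<close> with
  orthogonal ranges.\<close>

locale matrix_units =
  fixes V :: "nat \<Rightarrow> 'h::complex_hilbert \<Rightarrow>\<^sub>L 'p::complex_hilbert"
    and A :: "('h \<Rightarrow>\<^sub>L 'h) set"
  assumes V_bop: "V i \<in> bop"
    and V_inner: "cinner (blinfun_apply (V i) u) (blinfun_apply (V k) v) = (if i = k then cinner u v else 0)"
    and A: "unital_cstar_of_operators A"
begin

lemma A_alg: "star_subalgebra A" and A_id: "id_blinfun \<in> A" and A_closed: "closed A"
  using A by (auto simp: unital_cstar_of_operators_def)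

abbreviation "W i \<equiv> adj (V i)"

lemma W_bop: "W i \<in> bop" using V_bop by blast

lemma W_V: "W i o\<^sub>L V k = (if i = k then id_blinfun else 0)"
  by (rule blinfun_eq_cinnerI) (simp add: cinner_adj_right[OF V_bop] V_inner)

text \<open>The projection onto the first n copies of h. It is the unit of the matrix algebra below
  and is not the identity of the ambient space in general.\<close>

definition "P n = (\<Sum>i<n. V i o\<^sub>L W i)"

lemma P_bop: "P n \<in> bop"
  unfolding P_def by (intro bop_sum bop_compose V_bop W_bop)

lemma P_adj: "adj (P n) = P n"
  unfolding P_def by (subst adj_sum) (auto simp: adj_compose adj_adj V_bop W_bop bop_compose)

lemma W_P: "i < n \<Longrightarrow> W i o\<^sub>L P n = W i"
proof -
  assume i: "i < n"
  have "W i o\<^sub>L P n = (\<Sum>k<n. (W i o\<^sub>L V k) o\<^sub>L W k)"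
    by (simp add: P_def sum_blinfun_compose_right blinfun_compose_assoc')
  also have "\<dots> = (\<Sum>k<n. if k = i then W i else 0)"
    by (intro sum.cong refl) (auto simp: W_V intro: blinfun_eqI)
  finally show ?thesis using i by simp
qed

lemma P_V: "i < n \<Longrightarrow> P n o\<^sub>L V i = V i"
  using arg_cong[OF W_P[of i n], of adj] by (simp add: adj_compose V_bop W_bop P_bop P_adj adj_adj)

lemma P_P: "P n o\<^sub>L P n = P n"
proof -
  have "P n o\<^sub>L P n = (\<Sum>i<n. V i o\<^sub>L (W i o\<^sub>L P n))"
    by (subst (1) P_def) (simp only: sum_blinfun_compose_left blinfun_compose_assoc')
  also have "\<dots> = P n"
    unfolding P_def[of n, symmetric] by (subst (2) P_def) (intro sum.cong refl, simp add: W_P)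
  finally show ?thesis .
qed

text \<open>The n by n matrices over \<open>A\<close>, as operators supported on the range of
  \<open>P n\<close>; the entries of y are the compressions
  \<open>W i o\<^sub>L y o\<^sub>L V k\<close>.\<close>

definition "M n = {y \<in> bop. P n o\<^sub>L y = y \<and> y o\<^sub>L P n = y \<and> (\<forall>i<n. \<forall>k<n. W i o\<^sub>L y o\<^sub>L V k \<in> A)}"

lemma M_alg: "star_subalgebra (M n)"
proof -
  note S = star_subalgebraD[OF A_alg]
  have "cvec.subspace (M n)"
    unfolding cvec.subspace_def
  proof (intro conjI ballI allI)
    show "0 \<in> M n"
      using cvec.subspace_0[OF S(2)]
      by (simp add: M_def bounded_bilinear.zero_left[OF bounded_bilinear_blinfun_compose]
        bounded_bilinear.zero_right[OF bounded_bilinear_blinfun_compose])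
    show "x + y \<in> M n" if "x \<in> M n" "y \<in> M n" for x y
      using that cvec.subspace_add[OF S(2)] by (auto simp: M_def blinfun_compose_algebra)
    show "c *\<^sub>C x \<in> M n" if x: "x \<in> M n" for c x
    proof -
      have 1: "(c *\<^sub>C x) o\<^sub>L T = c *\<^sub>C (x o\<^sub>L T)" for T :: "'d::real_normed_vector \<Rightarrow>\<^sub>L 'p"
        by (rule blinfun_eqI) (simp add: scaleC_blinfun.rep_eq)
      have 2: "T o\<^sub>L (c *\<^sub>C R) = c *\<^sub>C (T o\<^sub>L R)" if "T \<in> bop"
        for T :: "'p \<Rightarrow>\<^sub>L 'e::complex_hilbert" and R :: "'p \<Rightarrow>\<^sub>L 'p"
        by (rule blinfun_eqI) (simp add: scaleC_blinfun.rep_eq bop_scaleC[OF that])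
      have 3: "(c *\<^sub>C R) o\<^sub>L T = c *\<^sub>C (R o\<^sub>L T)" for T :: "'h \<Rightarrow>\<^sub>L 'p" and R :: "'p \<Rightarrow>\<^sub>L 'h"
        by (rule blinfun_eqI) (simp add: scaleC_blinfun.rep_eq)
      show ?thesis
        using x cvec.subspace_scale[OF S(2)] by (auto simp: M_def 1 2[OF P_bop] 2[OF W_bop] 3)
    qed
  qed
  moreover have "x o\<^sub>L y \<in> M n" if x: "x \<in> M n" and y: "y \<in> M n" for x y
  proof -
    have "W i o\<^sub>L (x o\<^sub>L y) o\<^sub>L V k \<in> A" if ik: "i < n" "k < n" for i k
    proof -
      \<comment> \<open>Inserting \<open>P n\<close>, the sum of the projections onto the copies of
        h, between the factors turns composition into matrix multiplication.\<close>
      have "W i o\<^sub>L (x o\<^sub>L y) o\<^sub>L V k = W i o\<^sub>L x o\<^sub>L P n o\<^sub>L y o\<^sub>L V k"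
        using y by (simp add: M_def blinfun_compose_assoc')
      also have "\<dots> = (\<Sum>l<n. (W i o\<^sub>L x o\<^sub>L V l) o\<^sub>L (W l o\<^sub>L y o\<^sub>L V k))"
        by (simp add: P_def sum_blinfun_compose_left sum_blinfun_compose_right blinfun_compose_assoc')
      also have "\<dots> \<in> A" using x y ik by (intro cvec.subspace_sum[OF S(2)] S(3)) (auto simp: M_def)
      finally show ?thesis .
    qed
    moreover have "P n o\<^sub>L (x o\<^sub>L y) = x o\<^sub>L y" using x by (simp add: M_def flip: blinfun_compose_assoc')
    moreover have "(x o\<^sub>L y) o\<^sub>L P n = x o\<^sub>L y" using y by (simp add: M_def blinfun_compose_assoc')
    ultimately show ?thesis using x y by (auto simp: M_def)
  qed
  moreover have "adj x \<in> M n" if x: "x \<in> M n" for x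
  proof -
    have xb: "x \<in> bop" and PX: "P n o\<^sub>L x = x" "x o\<^sub>L P n = x" using x by (auto simp: M_def)
    have "P n o\<^sub>L adj x = adj x"
      using arg_cong[OF PX(2), of adj] by (simp add: adj_compose xb P_bop P_adj)
    moreover have "adj x o\<^sub>L P n = adj x"
      using arg_cong[OF PX(1), of adj] by (simp add: adj_compose xb P_bop P_adj)
    moreover have "W i o\<^sub>L adj x o\<^sub>L V k \<in> A" if "i < n" "k < n" for i k
    proof -
      have "W i o\<^sub>L adj x o\<^sub>L V k = adj (W k o\<^sub>L x o\<^sub>L V i)"
        by (simp add: adj_compose xb V_bop W_bop bop_compose adj_adj blinfun_compose_assoc')
      thus ?thesis using x that S(4) by (auto simp: M_def)
    qed
    ultimately show ?thesis using xb by (auto simp: M_def)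
  qed
  ultimately show ?thesis by (auto simp: star_subalgebra_def M_def)
qed

lemma M_closed: "closed (M n)"
proof -
  have "M n = bop \<inter> {y. P n o\<^sub>L y = y} \<inter> {y. y o\<^sub>L P n = y} \<inter>
      (\<Inter>i\<in>{..<n}. \<Inter>k\<in>{..<n}. (\<lambda>y. W i o\<^sub>L y o\<^sub>L V k) -` A)"
    by (auto simp: M_def)
  also have "closed \<dots>"
    by (intro closed_Int closed_bop closed_Collect_eq closed_INT ballI closed_vimage A_closed
        bounded_bilinear.continuous_on[OF bounded_bilinear_blinfun_compose] continuous_intros)
  finally show ?thesis .
qed

text \<open>On the range of \<open>P n\<close> the operator T of the perturbed matrix is bounded
  below by d > 0. Hence z = P - T/c has norm below 1 for large c, the square root of P - z = T/c
  exists inside the matrix algebra, and its entries times the root of c are the factor. Without d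
  the norm could equal 1.\<close>

lemma positive_matrix_factor:
  assumes a: "\<And>i k. i < n \<Longrightarrow> k < n \<Longrightarrow> a i k \<in> A" and pos: "positive_matrix n a" and d: "d > 0"
  shows "\<exists>b. (\<forall>i<n. \<forall>k<n. b i k \<in> A) \<and>
    (\<forall>i<n. \<forall>k<n. a i k + (if i = k then d *\<^sub>R id_blinfun else 0) = (\<Sum>l<n. adj (b l i) o\<^sub>L b l k))"
proof -
  note S = star_subalgebraD[OF A_alg]
  define s where "s i k = a i k + (if i = k then d *\<^sub>R id_blinfun else 0)" for i k
  have sA: "s i k \<in> A" if "i < n" "k < n" for i k
    unfolding s_def using that a A_id S(2)
    by (auto intro!: cvec.subspace_add csubspace_scaleR cvec.subspace_0)
  hence sb: "s i k \<in> bop" if "i < n" "k < n" for i k using that S(1) by blast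
  define T where "T = (\<Sum>i<n. \<Sum>k<n. V i o\<^sub>L s i k o\<^sub>L W k)"
  have Tb: "T \<in> bop"
    unfolding T_def by (intro bop_sum bop_compose V_bop W_bop sb) auto
  have WTV: "W i o\<^sub>L T o\<^sub>L V k = s i k" if ik: "i < n" "k < n" for i k
  proof -
    have "W i o\<^sub>L T o\<^sub>L V k = (\<Sum>i'<n. \<Sum>k'<n. (W i o\<^sub>L V i') o\<^sub>L s i' k' o\<^sub>L (W k' o\<^sub>L V k))"
      by (simp add: T_def sum_blinfun_compose_left sum_blinfun_compose_right blinfun_compose_assoc')
    also have "\<dots> = (\<Sum>i'<n. \<Sum>k'<n. if i' = i then if k' = k then s i k else 0 else 0)"
      by (intro sum.cong refl) (auto simp: W_V intro: blinfun_eqI)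
    also have "\<dots> = (\<Sum>i'<n. if i' = i then \<Sum>k'<n. if k' = k then s i k else 0 else 0)"
      by (intro sum.cong) auto
    also have "\<dots> = s i k" using ik by simp
    finally show ?thesis .
  qed
  have PT: "P n o\<^sub>L T = T" unfolding T_def sum_blinfun_compose_right
    by (intro sum.cong refl) (simp add: P_V flip: blinfun_compose_assoc')
  have TP: "T o\<^sub>L P n = T" unfolding T_def sum_blinfun_compose_left
    by (intro sum.cong refl) (simp add: W_P blinfun_compose_assoc')
  have TM: "T \<in> M n" using Tb PT TP WTV sA by (auto simp: M_def)
  have PM: "P n \<in> M n"
    using P_bop P_P A_id cvec.subspace_0[OF S(2)] by (auto simp: M_def W_P W_V)
  have Psum: "(\<Sum>i<n. (norm (blinfun_apply (W i) x))\<^sup>2) = (norm (blinfun_apply (P n) x))\<^sup>2" for x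
  proof -
    have "complex_of_real ((norm (blinfun_apply (P n) x))\<^sup>2) = cinner x (blinfun_apply (P n) x)"
      unfolding cinner_self[symmetric] cinner_adj_right[OF P_bop, symmetric] P_adj
      using arg_cong[OF P_P[of n], of "\<lambda>T. blinfun_apply T x"] by simp
    also have "\<dots> = (\<Sum>i<n. cinner x (blinfun_apply (V i) (blinfun_apply (W i) x)))"
      by (simp add: P_def blinfun.sum_left cinner_sum_right)
    also have "\<dots> = complex_of_real (\<Sum>i<n. (norm (blinfun_apply (W i) x))\<^sup>2)"
      by (simp add: cinner_self cinner_adj_left[OF V_bop, symmetric])
    finally show ?thesis unfolding of_real_eq_iff by simp
  qed
  have form: "cinner x (blinfun_apply T x) =
     (\<Sum>i<n. \<Sum>k<n. cinner (blinfun_apply (W i) x) (blinfun_apply (a i k) (blinfun_apply (W k) x))) +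
     of_real (d * (norm (blinfun_apply (P n) x))\<^sup>2)" for x
  proof -
    have "cinner x (blinfun_apply T x) =
       (\<Sum>i<n. \<Sum>k<n. cinner (blinfun_apply (W i) x) (blinfun_apply (s i k) (blinfun_apply (W k) x)))"
      by (simp add: T_def blinfun.sum_left cinner_sum_right cinner_adj_left[OF V_bop])
    also have "\<dots> = (\<Sum>i<n. \<Sum>k<n. cinner (blinfun_apply (W i) x) (blinfun_apply (a i k) (blinfun_apply (W k) x)) +
        (if k = i then of_real (d * (norm (blinfun_apply (W i) x))\<^sup>2) else 0))"
      by (intro sum.cong refl)
         (auto simp: s_def blinfun.add_left blinfun.scaleR_left cinner_add_right cinner_scaleR_right cinner_self)
    also have "\<dots> = (\<Sum>i<n. \<Sum>k<n. cinner (blinfun_apply (W i) x) (blinfun_apply (a i k) (blinfun_apply (W k) x))) +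
        of_real (d * (\<Sum>i<n. (norm (blinfun_apply (W i) x))\<^sup>2))"
      by (simp add: sum.distrib sum_distrib_left)
    finally show ?thesis unfolding Psum .
  qed
  have quad: "Re (cinner x (blinfun_apply T x)) \<ge> d * (norm (blinfun_apply (P n) x))\<^sup>2"
    and quad_real: "cinner x (blinfun_apply T x) \<in> \<real>" for x
  proof -
    have "(\<Sum>i<n. \<Sum>k<n. cinner (blinfun_apply (W i) x) (blinfun_apply (a i k) (blinfun_apply (W k) x))) \<in> \<real>\<^sub>\<ge>\<^sub>0"
      using pos unfolding positive_matrix_def by (rule spec[of _ "\<lambda>i. blinfun_apply (W i) x"])
    thus "Re (cinner x (blinfun_apply T x)) \<ge> d * (norm (blinfun_apply (P n) x))\<^sup>2"
      "cinner x (blinfun_apply T x) \<in> \<real>"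
      unfolding form complex_nonneg_Reals_iff complex_is_Real_iff by simp_all
  qed
  have Tsa: "adj T = T" by (rule adj_eq_self_of_real_form[OF Tb quad_real])
  \<comment> \<open>Chosen so that d \<le> c and |T|^2 \<le> d c. For y in the range of the
    projection this gives |y - T y/c|^2 \<le> (1 - 2 d/c + d/c) |y|^2, which is a strict
    contraction.\<close>
  define c where "c = (norm T)\<^sup>2 / d + d"
  have "c > 0" unfolding c_def using d by (intro add_nonneg_pos) auto
  moreover have "c \<ge> d" using d by (simp add: c_def)
  moreover have "d * c = (norm T)\<^sup>2 + d * d" using d by (simp add: c_def distrib_left)
  ultimately have c: "c > 0" "c \<ge> d" "(norm T)\<^sup>2 \<le> d * c" using d by auto
  define z where "z = P n - (1 / c) *\<^sub>R T"
  have zM: "z \<in> M n"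
    unfolding z_def using star_subalgebraD(2)[OF M_alg] PM TM by (intro cvec.subspace_diff csubspace_scaleR)
  have "adj ((1 / c) *\<^sub>R T) = (1 / c) *\<^sub>R T" using Tb Tsa by (simp add: adj_scaleR)
  hence zsa: "adj z = z"
    unfolding z_def using P_bop Tb P_adj by (subst adj_diff) (auto simp: scaleR_scaleC bop_scale)
  have nP: "norm (blinfun_apply (P n) x) \<le> norm x" for x
  proof -
    have "(norm (blinfun_apply (P n) x))\<^sup>2 = Re (cinner x (blinfun_apply (P n) x))"
      unfolding norm_sq_cinner cinner_adj_right[OF P_bop, symmetric] P_adj
      using arg_cong[OF P_P[of n], of "\<lambda>T. blinfun_apply T x"] by simp
    also have "\<dots> \<le> norm x * norm (blinfun_apply (P n) x)"
      using cauchy_schwarz complex_Re_le_cmod order_trans by blast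
    finally have "norm (blinfun_apply (P n) x) * norm (blinfun_apply (P n) x) \<le>
        norm x * norm (blinfun_apply (P n) x)" by (simp add: power2_eq_square)
    thus ?thesis by (cases "norm (blinfun_apply (P n) x) = 0") (auto simp: mult_le_cancel_right)
  qed
  have "norm z \<le> sqrt (1 - d / c)"
  proof (rule norm_blinfun_bound)
    have dc: "d / c \<le> 1" using c by simp
    thus "0 \<le> sqrt (1 - d / c)" by simp
    fix x
    define y where "y = blinfun_apply (P n) x"
    have Py: "blinfun_apply (P n) y = y" and Ty: "blinfun_apply T x = blinfun_apply T y"
      using arg_cong[OF P_P[of n], of "\<lambda>T. blinfun_apply T x"] arg_cong[OF TP, of "\<lambda>T. blinfun_apply T x"]
      by (auto simp: y_def)
    have "(norm (blinfun_apply z x))\<^sup>2 = (norm (y - (1 / c) *\<^sub>R blinfun_apply T y))\<^sup>2"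
      by (simp add: z_def blinfun.diff_left blinfun.scaleR_left y_def[symmetric] Ty)
    also have "\<dots> = (norm y)\<^sup>2 - 2 / c * Re (cinner y (blinfun_apply T y)) + (norm (blinfun_apply T y))\<^sup>2 / c\<^sup>2"
      using c by (simp add: norm_diff_sq cinner_scaleR_right power_divide)
    also have "\<dots> \<le> (norm y)\<^sup>2 - 2 / c * (d * (norm y)\<^sup>2) + (d * c * (norm y)\<^sup>2) / c\<^sup>2"
    proof (intro add_mono diff_mono mult_left_mono divide_right_mono order_refl)
      show "d * (norm y)\<^sup>2 \<le> Re (cinner y (blinfun_apply T y))" using quad[of y] Py by simp
      have "(norm (blinfun_apply T y))\<^sup>2 \<le> (norm T * norm y)\<^sup>2" by (intro power_mono norm_blinfun) simp
      also have "\<dots> \<le> d * c * (norm y)\<^sup>2"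
        unfolding power_mult_distrib by (intro mult_right_mono c) simp
      finally show "(norm (blinfun_apply T y))\<^sup>2 \<le> d * c * (norm y)\<^sup>2" .
    qed (use c in auto)
    also have "\<dots> = (1 - d / c) * (norm y)\<^sup>2" using c by (simp add: field_simps power2_eq_square)
    also have "\<dots> \<le> (1 - d / c) * (norm x)\<^sup>2"
      using dc nP[of x] by (intro mult_left_mono power_mono) (auto simp: y_def)
    also have "\<dots> = (sqrt (1 - d / c) * norm x)\<^sup>2" using dc by (simp add: power_mult_distrib)
    finally show "norm (blinfun_apply z x) \<le> sqrt (1 - d / c) * norm x"
      by (rule power2_le_imp_le) (use dc in simp)
  qed
  also have "\<dots> < 1" using c d by simp
  finally obtain b where b: "b \<in> M n" "adj b = b" "2 *\<^sub>R b = z + (b o\<^sub>L b)"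
    using exists_sqrt_one_minus[OF M_alg M_closed zM zsa] by blast
  define e where "e = P n - b"
  have eM: "e \<in> M n" unfolding e_def using star_subalgebraD(2)[OF M_alg] PM b by (intro cvec.subspace_diff)
  have eb: "e \<in> bop" using eM by (simp add: M_def)
  have esa: "adj e = e" using b P_bop P_adj by (simp add: e_def adj_diff M_def)
  have "e o\<^sub>L e = P n - 2 *\<^sub>R b + (b o\<^sub>L b)"
    using b(1) by (simp add: e_def M_def blinfun_compose_algebra P_P scaleR_2)
  also have "\<dots> = (1 / c) *\<^sub>R T" unfolding b(3) by (simp add: z_def)
  finally have ee: "e o\<^sub>L e = (1 / c) *\<^sub>R T" .
  define B where "B l i = sqrt c *\<^sub>R (W l o\<^sub>L e o\<^sub>L V i)" for l i
  have "B l i \<in> A" if "l < n" "i < n" for l i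
    unfolding B_def using eM that by (intro csubspace_scaleR S) (auto simp: M_def)
  moreover have "a i k + (if i = k then d *\<^sub>R id_blinfun else 0) = (\<Sum>l<n. adj (B l i) o\<^sub>L B l k)"
    if ik: "i < n" "k < n" for i k
  proof -
    have adjB: "adj (B l i) = sqrt c *\<^sub>R (W i o\<^sub>L e o\<^sub>L V l)" for l
      unfolding B_def
      by (simp add: adj_scaleR adj_compose bop_compose V_bop W_bop eb esa adj_adj blinfun_compose_assoc')
    have "(\<Sum>l<n. adj (B l i) o\<^sub>L B l k) = (\<Sum>l<n. c *\<^sub>R (W i o\<^sub>L e o\<^sub>L (V l o\<^sub>L W l) o\<^sub>L e o\<^sub>L V k))"
      unfolding adjB unfolding B_def using c
      by (simp add: blinfun_compose_algebra blinfun_compose_assoc')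
    also have "\<dots> = c *\<^sub>R (W i o\<^sub>L (e o\<^sub>L P n) o\<^sub>L e o\<^sub>L V k)"
      by (simp add: P_def sum_blinfun_compose_left sum_blinfun_compose_right blinfun_compose_assoc'
          flip: scaleR_sum_right)
    also have "\<dots> = c *\<^sub>R (W i o\<^sub>L (e o\<^sub>L e) o\<^sub>L V k)"
      using eM by (simp add: M_def blinfun_compose_assoc')
    also have "\<dots> = W i o\<^sub>L T o\<^sub>L V k" unfolding ee using c by (simp add: blinfun_compose_algebra)
    finally show ?thesis using WTV[OF ik] by (simp add: s_def)
  qed
  ultimately show ?thesis by blast
qed

text \<open>Applied to the entries of the factorisation, \<open>\<pi>\<close> again gives a sum of
  products of adjoints with their operators, whose quadratic form is a sum of squared norms. The
  perturbation adds d times the squared norm of the test vector, and d is arbitrary.\<close>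

lemma hom_positive_matrix:
  assumes hom: "operator_hom A \<pi>"
    and a: "\<And>i k. i < n \<Longrightarrow> k < n \<Longrightarrow> a i k \<in> A" and pos: "positive_matrix n a"
  shows "positive_matrix n (\<lambda>i k. \<pi> (a i k))"
  unfolding positive_matrix_def
proof
  interpret \<pi>: operator_hom A \<pi> by fact
  note S = star_subalgebraD[OF A_alg]
  fix w
  define X where "X = (\<Sum>i<n. \<Sum>k<n. cinner (w i) (blinfun_apply (\<pi> (a i k)) (w k)))"
  define q where "q = (\<Sum>i<n. (norm (w i))\<^sup>2)"
  have q0: "q \<ge> 0" by (simp add: q_def sum_nonneg)
  have X: "X + of_real (d * q) \<in> \<real>\<^sub>\<ge>\<^sub>0" if d: "d > 0" for d
  proof -
    obtain b where b: "\<And>i k. i < n \<Longrightarrow> k < n \<Longrightarrow> b i k \<in> A"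
      "\<And>i k. i < n \<Longrightarrow> k < n \<Longrightarrow>
        a i k + (if i = k then d *\<^sub>R id_blinfun else 0) = (\<Sum>l<n. adj (b l i) o\<^sub>L b l k)"
      using positive_matrix_factor[OF a pos d] by blast
    have hom_sum: "\<pi> (\<Sum>l\<in>L. g l) = (\<Sum>l\<in>L. \<pi> (g l)) \<and> (\<Sum>l\<in>L. g l) \<in> A"
      if "\<And>l. l \<in> L \<Longrightarrow> g l \<in> A" for L :: "nat set" and g
      using that \<pi>.hom_scaleR[OF A_id, of 0]
      by (induction L rule: infinite_finite_induct)
         (auto simp: \<pi>.hom_add cvec.subspace_0[OF S(2)] cvec.subspace_add[OF S(2)])
    have pb: "\<pi> (b l i) \<in> bop" if "l < n" "i < n" for l i using \<pi>.hom_bop b(1) that by blast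
    have eq: "\<pi> (a i k) + (if i = k then d *\<^sub>R id_blinfun else 0) = (\<Sum>l<n. adj (\<pi> (b l i)) o\<^sub>L \<pi> (b l k))"
      if ik: "i < n" "k < n" for i k
    proof -
      have "(if i = k then d *\<^sub>R id_blinfun else 0) \<in> A"
        using A_id S(2) by (auto intro: csubspace_scaleR cvec.subspace_0)
      from \<pi>.hom_add[OF a[OF ik] this]
      have "\<pi> (a i k) + \<pi> (if i = k then d *\<^sub>R id_blinfun else 0) = \<pi> (\<Sum>l<n. adj (b l i) o\<^sub>L b l k)"
        unfolding b(2)[OF ik] by simp
      moreover have "\<pi> (if i = k then d *\<^sub>R id_blinfun else 0) = (if i = k then d *\<^sub>R id_blinfun else 0)"
        using \<pi>.hom_scaleR[OF A_id, of d] \<pi>.hom_scaleR[OF A_id, of 0] \<pi>.hom_id by auto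
      moreover have "\<pi> (\<Sum>l<n. adj (b l i) o\<^sub>L b l k) = (\<Sum>l<n. \<pi> (adj (b l i) o\<^sub>L b l k))"
        using hom_sum[of "{..<n}" "\<lambda>l. adj (b l i) o\<^sub>L b l k"] b(1) ik S(3,4) by auto
      moreover have "\<dots> = (\<Sum>l<n. adj (\<pi> (b l i)) o\<^sub>L \<pi> (b l k))"
        using b(1) ik S(4) by (intro sum.cong refl) (auto simp: \<pi>.hom_mult \<pi>.hom_adj)
      ultimately show ?thesis by simp
    qed
    have "X + of_real (d * q) =
      (\<Sum>i<n. \<Sum>k<n. cinner (w i) (blinfun_apply (\<pi> (a i k) + (if i = k then d *\<^sub>R id_blinfun else 0)) (w k)))"
    proof -
      have "(\<Sum>i<n. \<Sum>k<n. cinner (w i) (blinfun_apply (\<pi> (a i k) + (if i = k then d *\<^sub>R id_blinfun else 0)) (w k))) =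
        (\<Sum>i<n. \<Sum>k<n. cinner (w i) (blinfun_apply (\<pi> (a i k)) (w k)) + (if k = i then of_real (d * (norm (w i))\<^sup>2) else 0))"
        by (intro sum.cong refl)
           (auto simp: blinfun.add_left blinfun.scaleR_left cinner_add_right cinner_scaleR_right cinner_self)
      thus ?thesis by (simp add: sum.distrib X_def q_def sum_distrib_left)
    qed
    also have "\<dots> = (\<Sum>i<n. \<Sum>k<n. \<Sum>l<n. cinner (blinfun_apply (\<pi> (b l i)) (w i)) (blinfun_apply (\<pi> (b l k)) (w k)))"
      by (intro sum.cong refl)
         (simp add: eq blinfun.sum_left cinner_sum_right cinner_adj_right pb)
    also have "\<dots> = (\<Sum>l<n. \<Sum>i<n. \<Sum>k<n. cinner (blinfun_apply (\<pi> (b l i)) (w i)) (blinfun_apply (\<pi> (b l k)) (w k)))"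
      by (subst (2) sum.swap, subst sum.swap) simp
    also have "\<dots> = (\<Sum>l<n. cinner (\<Sum>i<n. blinfun_apply (\<pi> (b l i)) (w i)) (\<Sum>k<n. blinfun_apply (\<pi> (b l k)) (w k)))"
      by (simp only: cinner_sum_left) (simp only: cinner_sum_right)
    also have "\<dots> = of_real (\<Sum>l<n. (norm (\<Sum>i<n. blinfun_apply (\<pi> (b l i)) (w i)))\<^sup>2)"
      by (simp add: cinner_self)
    finally show ?thesis by (simp add: complex_nonneg_Reals_iff sum_nonneg)
  qed
  have "Im X = 0" using X[of 1] by (simp add: complex_nonneg_Reals_iff)
  moreover have "0 \<le> Re X"
  proof (rule field_le_epsilon)
    fix r :: real assume r: "r > 0"
    have "r / (q + 1) > 0" using r q0 by simp
    from X[OF this] have "0 \<le> Re X + r / (q + 1) * q" by (simp add: complex_nonneg_Reals_iff)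
    also have "r / (q + 1) * q \<le> r" using r q0 by (simp add: field_simps)
    finally show "0 \<le> Re X + r" by simp
  qed
  ultimately show "(\<Sum>i<n. \<Sum>k<n. cinner (w i) (blinfun_apply (\<pi> (a i k)) (w k))) \<in> \<real>\<^sub>\<ge>\<^sub>0"
    unfolding X_def[symmetric] by (simp add: complex_nonneg_Reals_iff)
qed

end

context tower
begin

text \<open>The vector u \<otimes> e \<otimes> ... \<otimes> e with i factors e. For a unit vector e
  this places isometric, mutually orthogonal copies of h in the levels of the tower, so matrices of
  every size fit into the tower itself.\<close>

primrec level_vec :: "'q \<Rightarrow> nat \<Rightarrow> 'h \<Rightarrow> 'p" where
  "level_vec e 0 u = emb u"
| "level_vec e (Suc i) u = app (level_vec e i u) e"

lemma level_vec_inner: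
  assumes "norm e = 1"
  shows "cinner (level_vec e i u) (level_vec e k v) = (if i = k then cinner u v else 0)"
proof (induction i arbitrary: k)
  case 0
  show ?case by (cases k) (auto simp: emb_inner emb_app)
next
  case (Suc i)
  show ?case using Suc assms by (cases k) (auto simp: app_emb app_algebra(5) cinner_self)
qed

lemma level_vec_isometry:
  assumes e: "norm e = 1"
  shows "Blinfun (level_vec e i) \<in> bop" "blinfun_apply (Blinfun (level_vec e i)) u = level_vec e i u"
proof -
  have add: "level_vec e i (u + v) = level_vec e i u + level_vec e i v" for u v
    by (induction i) (auto simp: emb_add app_algebra)
  have sc: "level_vec e i (c *\<^sub>C u) = c *\<^sub>C level_vec e i u" for c u
    by (induction i) (auto simp: emb_scale app_algebra)
  have n: "norm (level_vec e i u) = norm u" for u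
    by (induction i) (auto simp: norm_emb norm_app e)
  have "bounded_linear (level_vec e i)"
    by (rule bounded_linear_intro[where K = 1]) (auto simp: add sc n scaleR_scaleC)
  thus "Blinfun (level_vec e i) \<in> bop" "blinfun_apply (Blinfun (level_vec e i)) u = level_vec e i u"
    using sc by (auto simp: bop_def bounded_linear_Blinfun_apply)
qed

end

section \<open>The vacuum expectation semigroup\<close>

lemma average_tendsto:
  fixes g :: "real \<Rightarrow> 'a::banach"
  assumes g: "continuous_on {0..} g"
  shows "((\<lambda>t. integral {0..t} g /\<^sub>R t) \<longlongrightarrow> g 0) (at_right 0)"
proof (rule tendstoI)
  fix e :: real assume e: "e > 0"
  obtain d where d: "d > 0" "\<And>r. r \<ge> 0 \<Longrightarrow> dist r 0 < d \<Longrightarrow> dist (g r) (g 0) < e / 2"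
    using g e unfolding continuous_on_iff by (metis atLeast_iff half_gt_zero order_refl)
  have "dist (integral {0..t} g /\<^sub>R t) (g 0) < e" if t: "0 < t" "t < d" for t
  proof -
    have "g integrable_on {0..t}"
      by (rule integrable_continuous_real[OF continuous_on_subset[OF g]]) auto
    from has_integral_diff[OF integrable_integral[OF this] has_integral_const_real[of "g 0" 0 t]]
    have "((\<lambda>r. g r - g 0) has_integral (integral {0..t} g - t *\<^sub>R g 0)) (cbox 0 t)" using t by simp
    hence "norm (integral {0..t} g - t *\<^sub>R g 0) \<le> e / 2 * measure lborel (cbox 0 t)"
    proof (rule has_integral_bound[rotated])
      show "norm (g r - g 0) \<le> e / 2" if "r \<in> cbox 0 t" for r
        using d(2)[of r] that t by (simp add: dist_norm)
    qed (use e in simp)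
    hence "norm (integral {0..t} g - t *\<^sub>R g 0) < e * t" using mult_pos_pos[OF e t(1)] t by (simp add: field_simps)
    moreover have "integral {0..t} g /\<^sub>R t - g 0 = (integral {0..t} g - t *\<^sub>R g 0) /\<^sub>R t"
      using t by (simp add: scaleR_diff_right)
    moreover have "norm (integral {0..t} g - t *\<^sub>R g 0) / t < e"
      using calculation(1) t by (simp add: pos_divide_less_eq)
    ultimately show ?thesis using t unfolding dist_norm by (simp add: divide_inverse mult.commute)
  qed
  thus "\<forall>\<^sub>F t in at_right 0. dist (integral {0..t} g /\<^sub>R t) (g 0) < e"
    unfolding eventually_at_right_field using d(1) by auto
qed

context fock_flow
begin

definition vac :: "real \<Rightarrow> ('h \<Rightarrow>\<^sub>L 'h) \<Rightarrow> ('h \<Rightarrow>\<^sub>L 'h)"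
  where "vac = vacuum_expectation \<epsilon> tensF j"

definition gen0 :: "('h \<Rightarrow>\<^sub>L 'h) \<Rightarrow> ('h \<Rightarrow>\<^sub>L 'h)" where "gen0 = sl omega omega"

lemma vac_vec: "vac t a = vec_slice (\<epsilon> (\<lambda>_. 0)) (\<epsilon> (\<lambda>_. 0)) t a"
  by (simp add: vac_def vacuum_expectation_def vec_slice_def)

lemma vac_fock_slice: "vac t a = fock_slice \<epsilon> tensF j t (\<lambda>_. 0) (\<lambda>_. 0) a"
  by (simp add: vac_vec fock_slice_vec upto_time_zero)

lemma vac_A: "t \<ge> 0 \<Longrightarrow> a \<in> A \<Longrightarrow> vac t a \<in> A"
  unfolding vac_fock_slice by (rule fock_slice_A[OF zero_L2 zero_L2])

lemma vac_contraction: "t \<ge> 0 \<Longrightarrow> a \<in> A \<Longrightarrow> norm (vac t a) \<le> norm a"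
  unfolding vac_vec using norm_vec_slice[of t a "\<epsilon> (\<lambda>_. 0)" "\<epsilon> (\<lambda>_. 0)"] by (simp add: norm_exp_zero)

lemma vac_continuous: "a \<in> A \<Longrightarrow> continuous_on {0..} (\<lambda>t. vac t a)"
  unfolding vac_fock_slice by (rule fock_slice_continuous[OF zero_L2 zero_L2])

lemma vac_zero: "a \<in> A \<Longrightarrow> vac 0 a = a"
  unfolding vac_fock_slice by (rule fock_slice_zero_time)

text \<open>A compression of a homomorphism: its quadratic form at u is that of the homomorphism at
  the vectors u(i) \<otimes> \<epsilon>(0).\<close>

lemma vac_completely_positive:
  assumes t: "t \<ge> 0" shows "completely_positive_on A (vac t)"
  unfolding completely_positive_on_def
proof (intro allI impI, elim conjE)
  fix n and a :: "nat \<Rightarrow> nat \<Rightarrow> 'h \<Rightarrow>\<^sub>L 'h"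
  assume a: "\<forall>i<n. \<forall>k<n. a i k \<in> A" and pos: "positive_matrix n a"
  have om: "norm (omega :: complex \<times> 'k) = 1" by (simp add: omega_def norm_prod_def)
  interpret matrix_units "\<lambda>i. Blinfun (level_vec omega i)" A
    by unfold_locales (simp_all add: level_vec_isometry[OF om] level_vec_inner[OF om] A_unital)
  have "positive_matrix n (\<lambda>i k. j t (a i k))"
    by (rule hom_positive_matrix[OF operator_hom[OF t] _ pos]) (use a in auto)
  hence "(\<Sum>i<n. \<Sum>k<n. cinner (tensF (u i) (\<epsilon> (\<lambda>_. 0))) (blinfun_apply (j t (a i k)) (tensF (u k) (\<epsilon> (\<lambda>_. 0))))) \<in> \<real>\<^sub>\<ge>\<^sub>0" for u
    unfolding positive_matrix_def by (rule spec[of _ "\<lambda>i. tensF (u i) (\<epsilon> (\<lambda>_. 0))"])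
  thus "positive_matrix n (\<lambda>i k. vac t (a i k))"
    by (simp add: positive_matrix_def vac_vec vec_slice_inner)
qed

lemma vac_semigroup: "cp_contraction_semigroup A vac"
  unfolding cp_contraction_semigroup_def
proof (intro conjI allI impI ballI)
  show "clinear_on A (vac t)" if "0 \<le> t" for t
    using vec_slice_clinear[OF that] by (simp add: vac_vec[abs_def])
  \<comment> \<open>The zero path is its own translate, so the cocycle identity reduces to the
    semigroup law.\<close>
  show "vac (s + t) a = vac s (vac t a)" if "0 \<le> s" "0 \<le> t" "a \<in> A" for s t a
    unfolding vac_fock_slice using fock_slice_cocycle[OF zero_L2 zero_L2 that] .
qed (auto intro: vac_A vac_contraction vac_completely_positive vac_zero vac_continuous)

lemma vac_id: "t \<ge> 0 \<Longrightarrow> vac t id_blinfun = id_blinfun"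
  by (rule blinfun_eq_cinnerI)
     (simp add: vac_vec vec_slice_inner operator_hom.hom_id[OF operator_hom]
       bilinear_isometricD(5)[OF tensF_isometric] cinner_self norm_exp_zero)

abbreviation "vac_path \<equiv> clip_path (\<lambda>_. 0)"

lemma vac_path: "r \<ge> 0 \<Longrightarrow> vac_path r = omega"
  by (simp add: clip_path_def fhat_def omega_def)

lemma good_vac_path: "good 1 vac_path vac_path"
  using good_clip_path[OF zero_L2 zero_L2, of 0] by simp

lemma vac_flow_sum:
  assumes "t \<ge> 0" "x \<in> A0" shows "vac t x = flow_sum vac_path vac_path t x"
proof -
  have "inner_path (\<lambda>_. 0) (\<lambda>_. 0::'k) = (\<lambda>_. 0)" by (simp add: inner_path_def fun_eq_iff)
  thus ?thesis
    unfolding vac_fock_slice using fock_slice_flow_sum[OF zero_L2 zero_L2, of 0 t x] assms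
    by (simp add: scaleC_one)
qed

lemma gen0_A0: "x \<in> A0 \<Longrightarrow> gen0 x \<in> A0"
  by (simp add: gen0_def slice_A0)

lemma gen0_pow_A0: "x \<in> A0 \<Longrightarrow> (gen0 ^^ n) x \<in> A0"
  by (induction n) (auto intro: gen0_A0)

text \<open>Along a constant path the same slice is applied at every time, and only the volume of
  the simplex remains to be integrated.\<close>

lemma iter_int_vac:
  assumes "t \<ge> 0"
  shows "iter_int vac_path vac_path n t x = (t ^ n / fact n) *\<^sub>R (gen0 ^^ n) x"
  using assms
proof (induction n arbitrary: t x)
  case (Suc n)
  have "((\<lambda>r. (1 * (1 * r) ^ n / fact n) *\<^sub>R (gen0 ^^ n) (gen0 x)) has_integral
      ((1 * t) ^ Suc n / fact (Suc n)) *\<^sub>R (gen0 ^^ n) (gen0 x)) {0..t}"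
    by (rule has_integral_scaleR_left[OF has_integral_power_fact[OF Suc.prems]])
  moreover have "integral {0..t} (\<lambda>r. iter_int vac_path vac_path n r (sl (vac_path r) (vac_path r) x)) =
      integral {0..t} (\<lambda>r. (r ^ n / fact n) *\<^sub>R (gen0 ^^ n) (gen0 x))"
    by (rule Henstock_Kurzweil_Integration.integral_cong) (simp add: Suc.IH vac_path gen0_def)
  ultimately show ?case
    by (simp add: integral_unique funpow_swap1 del: fact_Suc power_Suc)
qed simp

lemma vac_sums:
  assumes "t \<ge> 0" "x \<in> A0"
  shows "(\<lambda>n. (t ^ n / fact n) *\<^sub>R (gen0 ^^ n) x) sums vac t x"
  using flow_sum_sums[OF good_vac_path assms(2,1)] iter_int_vac[OF assms(1)] vac_flow_sum[OF assms] by simp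

lemma vac_integral_gen0:
  assumes x: "x \<in> A0" and t: "t \<ge> 0"
  shows "((\<lambda>r. vac r (gen0 x)) has_integral (vac t x - x)) {0..t}"
proof -
  have "((\<lambda>r. flow_sum vac_path vac_path r (sl (vac_path r) (vac_path r) x)) has_integral (vac t x - x)) {0..t}"
    using flow_sum_integral[OF good_vac_path x t] vac_flow_sum[OF t x] by simp
  moreover have "flow_sum vac_path vac_path r (sl (vac_path r) (vac_path r) x) = vac r (gen0 x)"
    if "r \<in> {0..t}" for r
    using that vac_flow_sum[OF _ gen0_A0[OF x]] by (simp add: vac_path gen0_def)
  ultimately show ?thesis by (rule has_integral_eq[rotated]) auto
qed

text \<open>By the flow equation the difference quotient is the mean over [0,t] of the continuous
  orbit of \<open>gen0 x\<close>, which tends to its value at time zero.\<close>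

lemma gen0_graph:
  assumes x: "x \<in> A0" shows "(x, gen0 x) \<in> generator_graph A vac"
proof -
  have gA: "gen0 x \<in> A" "x \<in> A" using gen0_A0[OF x] x A0_A by auto
  have "((\<lambda>t. integral {0..t} (\<lambda>r. vac r (gen0 x)) /\<^sub>R t) \<longlongrightarrow> vac 0 (gen0 x)) (at_right 0)"
    by (rule average_tendsto[OF vac_continuous[OF gA(1)]])
  moreover have "\<forall>\<^sub>F t in at_right 0. integral {0..t} (\<lambda>r. vac r (gen0 x)) /\<^sub>R t = (vac t x - x) /\<^sub>R t"
    unfolding eventually_at_right_field
    by (intro exI[of _ 1]) (auto simp: integral_unique[OF vac_integral_gen0[OF x]])
  ultimately have "((\<lambda>t. (vac t x - x) /\<^sub>R t) \<longlongrightarrow> vac 0 (gen0 x)) (at_right 0)"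
    by (rule Lim_transform_eventually)
  thus ?thesis using gA by (simp add: generator_graph_def vac_zero)
qed

section \<open>The core property of \<open>A0\<close>\<close>

abbreviation "core_graph \<equiv> generator_graph A vac \<inter> A0 \<times> UNIV"

text \<open>Means of orbits regularise: paired with the difference quotient at time t they can be
  approximated from the graph over \<open>A0\<close> for every a in \<open>A\<close>, and they
  return to a as t tends to zero.\<close>

definition avg :: "real \<Rightarrow> ('h \<Rightarrow>\<^sub>L 'h) \<Rightarrow> ('h \<Rightarrow>\<^sub>L 'h)"
  where "avg t a = integral {0..t} (\<lambda>r. vac r a) /\<^sub>R t"

text \<open>Elements of \<open>A\<^sub>0\<close> are entire vectors: both components are sums of power series in \<open>t\<close> whose
  partial sums lie in the graph over \<open>A\<^sub>0\<close>.\<close>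

lemma avg_core_A0:
  assumes x: "x \<in> A0" and t: "t > 0"
  shows "(avg t x, (vac t x - x) /\<^sub>R t) \<in> closure core_graph"
proof -
  have t0: "t \<ge> 0" using t by simp
  \<comment> \<open>The mean over [0,t] of r^n / n! is t^n / (n+1)!, so the q sum to the mean of the
    orbit. Applying \<open>gen0\<close> to \<open>q n\<close> gives 1/t times term n + 1 of the
    exponential series, and these sum to the difference quotient.\<close>
  define q where "q n = (t ^ n / fact (Suc n)) *\<^sub>R (gen0 ^^ n) x" for n
  define y where "y N = (\<Sum>n<N. q n)" for N
  note lin = slice_clinear[of omega omega, folded gen0_def]
  have q: "q n \<in> A0" for n unfolding q_def by (intro A0_scaleR gen0_pow_A0 x)
  have yA0: "y N \<in> A0" for N unfolding y_def by (intro cvec.subspace_sum A0_subspace q)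
  have g0: "gen0 0 = 0"
  proof -
    have "gen0 (0 *\<^sub>C x) = 0 *\<^sub>C gen0 x" using lin x unfolding clinear_on_def by blast
    thus ?thesis by simp
  qed
  have gy: "gen0 (y N) = (\<Sum>n<N. gen0 (q n))" for N
  proof (induction N)
    case (Suc N)
    have "gen0 (y N + q N) = gen0 (y N) + gen0 (q N)" using lin yA0 q unfolding clinear_on_def by blast
    thus ?case using Suc by (simp add: y_def)
  qed (simp add: y_def g0)
  have gq: "gen0 (q n) = ((t ^ Suc n / fact (Suc n)) *\<^sub>R (gen0 ^^ Suc n) x) /\<^sub>R t" for n
  proof -
    have "gen0 (q n) = (t ^ n / fact (Suc n)) *\<^sub>R gen0 ((gen0 ^^ n) x)"
      using lin gen0_pow_A0[OF x, of n] unfolding clinear_on_def q_def scaleR_scaleC by blast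
    thus ?thesis using t by (simp add: field_simps)
  qed
  have "(\<lambda>n. (t ^ Suc n / fact (Suc n)) *\<^sub>R (gen0 ^^ Suc n) x) sums (vac t x - x)"
    using vac_sums[OF t0 x] sums_Suc_iff[of "\<lambda>n. (t ^ n / fact n) *\<^sub>R (gen0 ^^ n) x"] by simp
  hence "(\<lambda>n. gen0 (q n)) sums ((vac t x - x) /\<^sub>R t)"
    unfolding gq by (rule sums_scaleR_right)
  hence lim2: "(\<lambda>N. gen0 (y N)) \<longlonglongrightarrow> (vac t x - x) /\<^sub>R t" by (simp add: sums_def gy)
  obtain B where B: "summable B" "\<And>n r. r \<in> {0..t} \<Longrightarrow> norm (iter_int vac_path vac_path n r x) \<le> B n"
    using iter_int_uniform_bound[OF good_vac_path x t0] by blast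
  have "norm (q n) \<le> B n" for n
  proof -
    have "norm (q n) = norm ((t ^ n / fact n) *\<^sub>R (gen0 ^^ n) x) / real (Suc n)"
      using t by (simp add: q_def field_simps)
    also have "\<dots> \<le> norm ((t ^ n / fact n) *\<^sub>R (gen0 ^^ n) x)"
      using divide_left_mono[of 1 "real (Suc n)" "norm ((t ^ n / fact n) *\<^sub>R (gen0 ^^ n) x)"] by simp
    also have "\<dots> \<le> B n" using B(2)[of t n] iter_int_vac[OF t0, of n x] t by simp
    finally show ?thesis .
  qed
  hence "summable q" by (rule summable_comparison_test'[OF B(1)])
  hence lim1: "y \<longlonglongrightarrow> suminf q" unfolding y_def using summable_LIMSEQ by blast
  have "((\<lambda>r. vac r x) has_integral t *\<^sub>R suminf q) {0..t}"
  proof (rule uniform_limit_has_integral)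
    have "uniform_limit {0..t} (\<lambda>N r. \<Sum>n<N. iter_int vac_path vac_path n r x)
        (\<lambda>r. flow_sum vac_path vac_path r x) sequentially"
      unfolding flow_sum_def by (rule Weierstrass_m_test[OF B(2,1)])
    thus "uniform_limit {0..t} (\<lambda>N r. \<Sum>n<N. iter_int vac_path vac_path n r x) (\<lambda>r. vac r x) sequentially"
      by (rule uniform_limit_cong'[THEN iffD1, rotated -1]) (auto simp: vac_flow_sum x)
    show "((\<lambda>r. \<Sum>n<N. iter_int vac_path vac_path n r x) has_integral t *\<^sub>R y N) {0..t}" for N
      unfolding y_def scaleR_sum_right
    proof (intro has_integral_sum finite_lessThan)
      fix n
      have "((\<lambda>r. (1 * (1 * r) ^ n / fact n) *\<^sub>R (gen0 ^^ n) x) has_integral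
          ((1 * t) ^ Suc n / fact (Suc n)) *\<^sub>R (gen0 ^^ n) x) {0..t}"
        by (rule has_integral_scaleR_left[OF has_integral_power_fact[OF t0]])
      thus "((\<lambda>r. iter_int vac_path vac_path n r x) has_integral t *\<^sub>R q n) {0..t}"
        by (rule has_integral_eq[rotated, THEN back_subst[of "\<lambda>v. (_ has_integral v) _"]])
           (simp_all add: iter_int_vac q_def)
    qed
    show "(\<lambda>N. t *\<^sub>R y N) \<longlonglongrightarrow> t *\<^sub>R suminf q" by (intro tendsto_scaleR tendsto_const lim1)
  qed
  hence "avg t x = suminf q" using t by (simp add: avg_def integral_unique)
  hence "(\<lambda>N. (y N, gen0 (y N))) \<longlonglongrightarrow> (avg t x, (vac t x - x) /\<^sub>R t)"
    using tendsto_Pair[OF lim1 lim2] by simp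
  moreover have "(y N, gen0 (y N)) \<in> core_graph" for N using gen0_graph[OF yA0] yA0 by simp
  ultimately show ?thesis unfolding closure_sequential by (intro exI[of _ "\<lambda>N. (y N, gen0 (y N))"]) simp
qed

lemma norm_avg_diff:
  assumes a: "a \<in> A" "b \<in> A" and t: "t > 0"
  shows "norm (avg t a - avg t b) \<le> norm (a - b)"
proof -
  have i: "(\<lambda>r. vac r c) integrable_on {0..t}" if "c \<in> A" for c
    by (rule integrable_continuous_real[OF continuous_on_subset[OF vac_continuous[OF that]]]) auto
  have "((\<lambda>r. vac r a - vac r b) has_integral
      (integral {0..t} (\<lambda>r. vac r a) - integral {0..t} (\<lambda>r. vac r b))) (cbox 0 t)"
    using has_integral_diff[OF integrable_integral[OF i[OF a(1)]] integrable_integral[OF i[OF a(2)]]] by simp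
  hence "norm (integral {0..t} (\<lambda>r. vac r a) - integral {0..t} (\<lambda>r. vac r b)) \<le>
      norm (a - b) * measure lborel (cbox 0 t)"
  proof (rule has_integral_bound[rotated])
    fix r assume "r \<in> cbox 0 t"
    hence r: "r \<ge> 0" by simp
    show "norm (vac r a - vac r b) \<le> norm (a - b)"
      using vac_contraction[OF r cvec.subspace_diff[OF A_subspace a]]
      by (simp add: vac_vec vec_slice_diff[OF r a])
  qed simp
  hence "norm (integral {0..t} (\<lambda>r. vac r a) - integral {0..t} (\<lambda>r. vac r b)) / t \<le> norm (a - b)"
    using t by (simp add: pos_divide_le_eq)
  thus ?thesis using t unfolding avg_def scaleR_diff_right[symmetric] by (simp add: divide_inverse mult.commute)
qed

text \<open>For fixed t both components depend continuously on a, so the case of \<open>A0\<close>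
  extends by density into the closed set.\<close>

lemma avg_core:
  assumes a: "a \<in> A" and t: "t > 0"
  shows "(avg t a, (vac t a - a) /\<^sub>R t) \<in> closure core_graph"
proof -
  have t0: "t \<ge> 0" using t by simp
  obtain x where x: "\<And>n::nat. x n \<in> A0" "\<And>n. x n \<in> A" "x \<longlonglongrightarrow> a" by (rule dense_seq[OF a]) blast
  have "(\<lambda>n. avg t (x n)) \<longlonglongrightarrow> avg t a"
  proof (rule LIM_zero_cancel, rule Lim_null_comparison)
    show "\<forall>\<^sub>F n in sequentially. norm (avg t (x n) - avg t a) \<le> norm (x n - a)"
      by (intro always_eventually allI norm_avg_diff x a t)
    show "(\<lambda>n. norm (x n - a)) \<longlonglongrightarrow> 0" by (rule tendsto_norm_zero[OF LIM_zero[OF x(3)]])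
  qed
  moreover have "(\<lambda>n. (vac t (x n) - x n) /\<^sub>R t) \<longlonglongrightarrow> (vac t a - a) /\<^sub>R t"
    unfolding vac_vec by (intro tendsto_intros vec_slice_tendsto[OF t0 x(2) a x(3)] x(3))
  ultimately have "(\<lambda>n. (avg t (x n), (vac t (x n) - x n) /\<^sub>R t)) \<longlonglongrightarrow> (avg t a, (vac t a - a) /\<^sub>R t)"
    by (rule tendsto_Pair)
  thus ?thesis
    by (rule closed_sequentially[OF closed_closure, rotated]) (rule avg_core_A0[OF x(1) t])
qed

text \<open>For (a, b) in the graph, the pairs of mean and difference quotient lie in the closure of
  the graph over \<open>A0\<close>. As t decreases to zero the first component tends to a by
  continuity of the orbit, the second to b by the definition of the generator.\<close>

lemma vac_core: "is_core A0 (generator_graph A vac)"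
  unfolding is_core_def
proof
  show "A0 \<subseteq> Domain (generator_graph A vac)" using gen0_graph by blast
  show "generator_graph A vac \<subseteq> closure core_graph"
  proof
    fix p assume p: "p \<in> generator_graph A vac"
    obtain a b where ab: "p = (a, b)" by fastforce
    have a: "a \<in> A" and b: "((\<lambda>t. (vac t a - a) /\<^sub>R t) \<longlongrightarrow> b) (at_right 0)"
      using p by (auto simp: ab generator_graph_def)
    have "((\<lambda>t. avg t a) \<longlongrightarrow> a) (at_right 0)"
      using average_tendsto[OF vac_continuous[OF a]] by (simp add: avg_def[abs_def] vac_zero[OF a])
    hence lim: "((\<lambda>t. (avg t a, (vac t a - a) /\<^sub>R t)) \<longlongrightarrow> (a, b)) (at_right 0)"
      using b by (rule tendsto_Pair)
    have "\<forall>\<^sub>F t in at_right 0. (avg t a, (vac t a - a) /\<^sub>R t) \<in> closure core_graph"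
      unfolding eventually_at_right_field by (intro exI[of _ 1]) (auto intro: avg_core[OF a])
    from Lim_in_closed_set[OF closed_closure this _ lim] show "p \<in> closure core_graph"
      by (simp add: ab trivial_limit_at_right_real)
  qed
qed

end

theorem theorem3p16:
  fixes A A0 :: "('h::complex_hilbert \<Rightarrow>\<^sub>L 'h) set"
    and emb :: "'h \<Rightarrow> 'p::complex_hilbert"
    and app :: "'p \<Rightarrow> complex \<times> 'k::complex_hilbert \<Rightarrow> 'p"
    and \<epsilon> :: "(real \<Rightarrow> 'k) \<Rightarrow> 'f::complex_hilbert"
    and tensF :: "'h \<Rightarrow> 'f \<Rightarrow> 'g::complex_hilbert"
    and \<phi> :: "('h \<Rightarrow>\<^sub>L 'h) \<Rightarrow> ('p \<Rightarrow>\<^sub>L 'p)"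
    and s :: "'i \<Rightarrow> ('h \<Rightarrow>\<^sub>L 'h)"
    and p :: "'r \<Rightarrow> 'i ncpoly"
    and j :: "real \<Rightarrow> ('h \<Rightarrow>\<^sub>L 'h) \<Rightarrow> ('g \<Rightarrow>\<^sub>L 'g)"
  assumes A: "unital_cstar_of_operators A"
    and A0: "star_subalgebra A0" "id_blinfun \<in> A0" "A0 \<subseteq> A" "A \<subseteq> closure A0"
    and tower: "tensor_tower emb app"
    and fock: "boson_fock \<epsilon>" "hilbert_tensor tensF"
    and gen: "flow_generator emb app A0 \<phi>"
    and A_phi: "A_phi emb app A0 \<phi> = A0"
    and a_or_b: "(\<forall>x\<in>A0. positive_op x \<longrightarrow> op_sqrt x \<in> A0) \<or>
      (universal_isometry_algebra A s p \<and> A0 = generated_star_algebra (range s))"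
    and hom: "\<And>t. t \<ge> 0 \<Longrightarrow> unital_star_hom (op_cstar A) (op_cstar bop) (j t)"
    and ext: "\<And>t x. t \<ge> 0 \<Longrightarrow> x \<in> A0 \<Longrightarrow> is_flow_series emb app \<epsilon> tensF A0 \<phi> t x (j t x)"
  shows "feller_cocycle \<epsilon> tensF A j \<and>
    (\<forall>t\<ge>0. \<forall>a\<in>A. vacuum_expectation \<epsilon> tensF j t a = fock_slice \<epsilon> tensF j t (\<lambda>_. 0) (\<lambda>_. 0) a) \<and>
    cp_contraction_semigroup A (vacuum_expectation \<epsilon> tensF j) \<and>
    (\<forall>t\<ge>0. \<forall>x\<in>A0.
      (\<lambda>n. (t ^ n / fact n) *\<^sub>R (slice emb app \<phi> omega omega ^^ n) x)
        sums vacuum_expectation \<epsilon> tensF j t x) \<and>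
    (\<forall>t\<ge>0. vacuum_expectation \<epsilon> tensF j t id_blinfun = id_blinfun) \<and>
    is_core A0 (generator_graph A (vacuum_expectation \<epsilon> tensF j))"
proof -
  interpret fock_flow emb app A0 \<phi> A \<epsilon> tensF j
    by unfold_locales
       (use A A0 tower fock gen A_phi hom ext in
         \<open>auto simp: unital_cstar_of_operators_def star_subalgebra_def\<close>)
  show ?thesis
    using feller vac_fock_slice vac_semigroup vac_sums vac_id vac_core
    unfolding vac_def gen0_def by blast
qed

end
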